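(* Let $\alpha\in(0,1)$. Let $m$ be a non-negative measurable function on $(0,1)$, let $b\in\mathbb R$, and let $\Phi$, $\mathbb C_\Phi$ and the operator $\partial_t^{\star\Phi}$ be the objects associated with $(b,m)$ (see context). (i) $\partial_t^{\star\Phi}$ is a linear operator that satisfies the scaling property $$\partial_t^{\star\Phi}d_cf(t)=c^\alpha\,\partial_t^{\star\Phi}f(ct),\qquad c,t>0,$$ where $d_cf(t)=f(ct)$. (ii) For any $z\in\mathbb C_\Phi$ and $t>0$, writing $p_z(t)=t^z$, $$\partial_t^{\star\Phi}p_z(t)=\Phi(z)\,p_{z-\alpha}(t).$$ Consequently, if $\phi\in\mathbf B$, then for any $z\in\mathbb C$ with $\Re(z)>\mathfrak a_\phi$, $\partial_t^{\star\phi}p_z(t)=\phi(z)p_{z-\alpha}(t)$. Moreover, let $m_\alpha(r)=r^{-\alpha}m(r)$, $r\in(0,1)$, and for $z\in\mathbb C_{\boldsymbol\phi}=\{z\in\mathbb C:\ r\mapsto r^{z-1}m_\alpha(r)\in L^1(0,1)\}$ define $$\boldsymbol\phi(z)=\frac{z}{z-\alpha}\,\Phi(z-\alpha).$$ Then, for $z\in\mathbb C_{\boldsymbol\phi}$ and $t>0$, $\partial_t^{\star\boldsymbol\phi}p_z(t)=\boldsymbol\phi(z)\,p_{z-\alpha}(t)$. Note that, in any case, $\partial_t^{\star\boldsymbol\phi}p_0(t)=0$. (iii) Assume that either $\phi\in\mathbf B$ with $\mathfrak a_\phi<0$ and $\phi(\infty)=\infty$, or $\phi\in\mathbf B_{\partial^\star}$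 with $\mathfrak a_\phi<-\alpha$. Then, writing $F_q(t)=\mathcal E_{\phi_\alpha}(qt^\alpha)$, we have, for any $q\in\mathbb R$ and $t>0$, $$\partial_t^{\star\boldsymbol\phi}F_q(t)=q\,F_q(t),$$ where $\boldsymbol\phi(z)=\frac{z}{z-\alpha}\phi(z-\alpha)$. Moreover, if in addition $\phi\in\mathbf B_{\partial^\star}$ and $r\mapsto m_\alpha(r)=r^{-\alpha}m(r)$ is a non-decreasing function on $(0,1)$ (with $m$ the function in the representation of $\phi$), then the mapping $\boldsymbol\phi$ is a Bernstein function, and $\boldsymbol\phi\in\mathbf B$ if $\mathfrak a_\phi<-\alpha$. (iv) Let $\phi\in\mathbf B$. Then, at least for functions $f$ such that $f,\,tf'\in C_b(\mathbb R_+)$, $$\partial_t^{\star\phi}\Lambda f(t)=-t^{-2\alpha}\,\Lambda\mathbf A f(t),$$ where $\Lambda f=f\circ\iota$ with $\iota(y)=\frac1y$ is an involution, and $\mathbf A$ is the characteristic operator of the $\alpha$-self-similar Markov process associated via the Lamperti mapping with $\phi$.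
   Context: **The operators.** For $m$ non-negative measurable on $(0,1)$ and $b\in\mathbb R$, put $$\Phi(z)=bz+z\int_0^1r^{z-1}m(r)\,dr,\qquad z\in\mathbb C_\Phi=\{z\in\mathbb C:\ r\mapsto r^{z-1}m(r)\in L^1(0,1)\}.$$ For $\alpha\in(0,1)$ and $f$ in $\mathcal D(\partial_t^{\star\Phi})=C^1(\mathbb R_+)\cap\{f\in AC[0,t];\ y\mapsto f'(y)m(y/t)\in L^1(0,t)\}$ ($AC$ = absolutely continuous), $$\partial_t^{\star\Phi}f(t)=t^{1-\alpha}\,b\,f'(t)+t^{-\alpha}\int_0^tf'(r)\,m\!\left(\frac rt\right)dr .$$ The same formula is used for other functions (such as powers $p_z$) for which the integral converges absolutely. The operator $\partial_t^{\star\boldsymbol\phi}$ is the one given by this formula with the pair $(b,m)$ replaced by $(b,m_\alpha)$, $m_\alpha(r)=r^{-\alpha}m(r)$; note $\boldsymbol\phi(z)=bz+z\int_0^1r^{z-1}m_\alpha(r)\,dr$ (value at $z=\alpha$ by continuity). If $\phi\in\mathbf B$ has representation $(b,m)$ as below, then $\Phi\equiv\phi$ and one writes $\partial_t^{\star\phi}$. **The classes $\mathbf B$ and $\mathbf B_{\partial^\star}$.** $\mathbf B$ is the set of (non-zero) Bernstein functions $$\phi(u)=bu+u\int_0^1 r^{u-1}m(r)\,dr,\qquad u\ge0,$$ where $b\ge0$, $m$ is non-negative and non-decreasing on $(0,1)$, $m(r)=\int_0^r m(ds)$, $\int_0^1(-\ln r\wedge1)\,r\,m(dr)<\infty$, and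 $\phi'(0^+)=b+\int_0^1\frac{m(r)}r\,dr<\infty$. Equivalently, $\phi$ is the Laplace exponent $\phi(u)=-\log\mathbb E[e^{-u\mathcal T_1}]$ of a subordinator $\mathcal T$ with drift $b$, finite mean, and Lévy measure $\Pi$ on $(0,\infty)$ with tail $\Pi((y,\infty))=m(e^{-y})$. Write $\phi(\infty)=\lim_{u\to\infty}\phi(u)$. Set $\mathfrak a_\phi=\sup\{u\le0:\ |\phi(u)|=\infty\}$ (with $\sup\emptyset=-\infty$); $\phi$ extends analytically to $\Re(z)>\mathfrak a_\phi$. For the fixed $\alpha\in(0,1)$, $$\mathbf B_{\partial^\star}=\{\phi\in\mathbf B:\ \mathfrak a_\phi\le-\alpha\ \text{ and }\ \lim_{u\downarrow0}u\,\phi(u-\alpha)\le0\}.$$ **The function $\mathcal E_{\phi_\alpha}$.** Put $\phi_\alpha(u)=\phi(\alpha u)$, and let $\mathfrak a_{\phi_\alpha}$ be defined from $\phi_\alpha$ as $\mathfrak a_\phi$ is from $\phi$. $W_{\phi_\alpha}$ is the unique Mellin transform of a positive measure that solves $W_{\phi_\alpha}(z+1)=\phi_\alpha(z)W_{\phi_\alpha}(z)$, $W_{\phi_\alpha}(1)=1$, for $\Re(z)>\mathfrak a_{\phi_\alpha}$; for integers $n\ge0$, $W_{\phi_\alpha}(n+1)=\prod_{k=1}^n\phi_\alpha(k)$. Then $$\mathcal E_{\phi_\alpha}(z)=\frac1{\phi_\alpha'(0^+)}\sum_{n=0}^\infty\frac{z^n}{nW_{\phi_\alpha}(n)},\qquad|z|<\phi(\infty),$$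 with the $n=0$ term understood as a limit ($nW_{\phi_\alpha}(n)|_{n=0}=1/\phi_\alpha'(0^+)$, so $\mathcal E_{\phi_\alpha}(0)=1$). When $\mathfrak a_{\phi_\alpha}<0$, $\mathcal E_{\phi_\alpha}$ is also represented (and thereby extended) by the Mellin–Barnes integral, for any $0<a<|\mathfrak a_{\phi_\alpha}|$, $$\mathcal E_{\phi_\alpha}(z)=-\frac{1}{\phi_\alpha'(0^+)}\frac1{2\pi i}\int_{a-i\infty}^{a+i\infty}\frac{\phi_\alpha(-\xi)}{\xi}\,\frac{\Gamma(\xi)\Gamma(1-\xi)}{W_{\phi_\alpha}(1-\xi)}\,(-z)^{-\xi}\,d\xi,$$ absolutely convergent at least on the sector $|\arg(-z)|<\frac\pi2$. One has $\mathcal E_{\phi_\alpha}(-q)=\mathbb E[e^{-q\zeta_1}]$ for $q>0$, where $\zeta_1=\inf\{s>0:\ \chi_s>1\}$ and $\chi$ is the process described next, started from $0$. **The self-similar process and $\mathbf A$.** The process $\chi$ associated with $\phi$ via the Lamperti mapping is the non-decreasing $\alpha$-self-similar Markov process which, started from $x>0$, is $\chi_t=x\exp(\mathcal T_{A_{x^{-\alpha}t}})$ with $A_t=\inf\{s>0:\ \int_0^se^{\alpha\mathcal T_r}dr>t\}$; since $\phi'(0^+)<\infty$ it can also be started from $0$. Its characteristic operator is given, at least for $f$ with $f,tf'\in C_b(\mathbb R_+)$ (continuous bounded functions on $\mathbb R_+$), by $$\mathbf Af(t)=t^{-\alpha}\left(b\,t f'(t)+\int_0^\infty\big(f(te^y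)-f(t)\big)\,\Pi(dy)\right).$$
   Formalization: In (iii) the eigenfunction identity is proved for those q and t for which E is defined at q t^α; this excludes only q t^α ≥ φ(∞) when φ(∞) is finite, where the series diverges and the Mellin–Barnes integral is unavailable. *)

theory Defs
  imports "HOL-Analysis.Analysis"
begin

text \<open>
  Functions on \<open>\<real>\<^sub>+\<close> are functions \<^typ>\<open>real \<Rightarrow> complex\<close> of which only the values on
  \<open>(0,\<infinity>)\<close> (and at \<open>0\<close>, for absolute continuity on \<open>[0,t]\<close>) matter; likewise \<open>m\<close> matters only on
  \<open>(0,1)\<close>. All integrals are Lebesgue integrals.
\<close>

section \<open>The functions and operators attached to a pair \<open>(b,m)\<close>\<close>

definition Phi_dom :: "(real \<Rightarrow> real) \<Rightarrow> complex set" where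
  "Phi_dom m =
     {z. set_integrable lebesgue {0<..<1} (\<lambda>r. complex_of_real r powr (z - 1) * of_real (m r))}"

definition Phi :: "real \<Rightarrow> (real \<Rightarrow> real) \<Rightarrow> complex \<Rightarrow> complex" where
  "Phi b m z = of_real b * z
     + z * (LINT r:{0<..<1}|lebesgue. complex_of_real r powr (z - 1) * of_real (m r))"

definition m_tilt :: "real \<Rightarrow> (real \<Rightarrow> real) \<Rightarrow> real \<Rightarrow> real" where
  "m_tilt \<alpha> m r = r powr (- \<alpha>) * m r"

text \<open>The bold \<open>\<phi>\<close>; at \<open>z = \<alpha>\<close> the quotient is \<open>0/0\<close> and is replaced by its limit within the domain.\<close>

definition bold :: "real \<Rightarrow> (real \<Rightarrow> real) \<Rightarrow> (complex \<Rightarrow> complex) \<Rightarrow> complex \<Rightarrow> complex" where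
  "bold \<alpha> m \<Phi> z =
     (if z = of_real \<alpha>
      then Lim (at (of_real \<alpha>) within Phi_dom (m_tilt \<alpha> m))
             (\<lambda>w. w / (w - of_real \<alpha>) * \<Phi> (w - of_real \<alpha>))
      else z / (z - of_real \<alpha>) * \<Phi> (z - of_real \<alpha>))"

definition dstar :: "real \<Rightarrow> real \<Rightarrow> (real \<Rightarrow> real) \<Rightarrow> (real \<Rightarrow> complex) \<Rightarrow> real \<Rightarrow> complex" where
  "dstar \<alpha> b m f t =
     of_real (t powr (1 - \<alpha>) * b) * vector_derivative f (at t)
     + of_real (t powr (- \<alpha>))
       * (LINT r:{0<..<t}|lebesgue. vector_derivative f (at r) * of_real (m (r / t)))"

text \<open>The formula defining the operator makes sense at \<open>t\<close>, with an absolutely convergent integral.\<close>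

definition dstar_defined :: "(real \<Rightarrow> real) \<Rightarrow> (real \<Rightarrow> complex) \<Rightarrow> real \<Rightarrow> bool" where
  "dstar_defined m f t \<longleftrightarrow>
     (\<forall>r\<in>{0<..t}. f differentiable (at r)) \<and>
     set_integrable lebesgue {0<..<t} (\<lambda>r. vector_derivative f (at r) * of_real (m (r / t)))"

definition AC_on :: "real \<Rightarrow> real \<Rightarrow> (real \<Rightarrow> complex) \<Rightarrow> bool" where
  "AC_on a c f \<longleftrightarrow>
     (\<forall>\<epsilon>>0. \<exists>\<delta>>0. \<forall>(n::nat) u v.
        (\<forall>i<n. a \<le> u i \<and> u i \<le> v i \<and> v i \<le> c) \<longrightarrow>
        disjoint_family_on (\<lambda>i. {u i<..<v i}) {..<n} \<longrightarrow>
        (\<Sum>i<n. v i - u i) < \<delta> \<longrightarrow>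
        (\<Sum>i<n. norm (f (v i) - f (u i))) < \<epsilon>)"

definition dstar_domain :: "(real \<Rightarrow> real) \<Rightarrow> (real \<Rightarrow> complex) set" where
  "dstar_domain m =
     {f. f C1_differentiable_on {0<..} \<and>
         (\<forall>t>0. AC_on 0 t f \<and>
            set_integrable lebesgue {0<..<t} (\<lambda>y. vector_derivative f (at y) * of_real (m (y / t))))}"

definition dil :: "real \<Rightarrow> (real \<Rightarrow> complex) \<Rightarrow> real \<Rightarrow> complex" where
  "dil c f t = f (c * t)"

definition pow_fun :: "complex \<Rightarrow> real \<Rightarrow> complex" where
  "pow_fun z t = complex_of_real t powr z"

section \<open>The classes of Bernstein functions\<close>

text \<open>\<open>\<phi>(u)\<close> for real \<open>u\<close> as an extended real, so that \<open>\<bar>\<phi>(u)\<bar> = \<infinity>\<close> has its literal meaning.\<close>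

definition Phi_ext :: "real \<Rightarrow> (real \<Rightarrow> real) \<Rightarrow> real \<Rightarrow> ereal" where
  "Phi_ext b m u = ereal (b * u)
     + ereal u * enn2ereal (\<integral>\<^sup>+r\<in>{0<..<1}. ennreal (r powr (u - 1) * m r) \<partial>lebesgue)"

definition abscissa :: "(real \<Rightarrow> ereal) \<Rightarrow> ereal" where
  "abscissa g = Sup (ereal ` {u. u \<le> 0 \<and> \<bar>g u\<bar> = \<infinity>})"

text \<open>
  \<open>rep_B \<phi> b m\<close>: \<open>\<phi>\<close>, together with its analytic extension to \<open>Re z > abscissa\<close>, belongs to \<open>B\<close> and has
  representation \<open>(b,m)\<close>. The measure \<open>\<mu>\<close> is \<open>m(dr)\<close>. In accordance with \<open>\<Pi>((y,\<infinity>)) = m(e\<^bsup>-y\<^esup>)\<close>, the integral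
  \<open>\<integral>\<^sub>0\<^sup>r m(ds)\<close> extends over the open interval \<open>(0,r)\<close>. Integrability of \<open>m(r)/r\<close> is finiteness of
  \<open>\<phi>'(0+)\<close>.
\<close>

definition rep_B :: "(complex \<Rightarrow> complex) \<Rightarrow> real \<Rightarrow> (real \<Rightarrow> real) \<Rightarrow> bool" where
  "rep_B \<phi> b m \<longleftrightarrow>
     b \<ge> 0 \<and> (\<forall>r\<in>{0<..<1}. m r \<ge> 0) \<and> mono_on {0<..<1} m \<and>
     (\<exists>\<mu>. sets \<mu> = sets borel \<and>
        (\<forall>r\<in>{0<..<1}. emeasure \<mu> {0<..<r} = ennreal (m r)) \<and>
        (\<integral>\<^sup>+r\<in>{0<..<1}. ennreal (min (- ln r) 1 * r) \<partial>\<mu>) < \<infinity>) \<and>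
     set_integrable lebesgue {0<..<1} (\<lambda>r. m r / r) \<and>
     (\<forall>u\<ge>0. \<phi> (of_real u) = Phi b m (of_real u)) \<and>
     (\<forall>z. ereal (Re z) > abscissa (Phi_ext b m) \<longrightarrow> \<phi> z = Phi b m z) \<and>
     (\<exists>u\<ge>0. \<phi> (of_real u) \<noteq> 0)"

definition class_B :: "(complex \<Rightarrow> complex) set" where
  "class_B = {\<phi>. \<exists>b m. rep_B \<phi> b m}"

definition rep_B_star :: "real \<Rightarrow> (complex \<Rightarrow> complex) \<Rightarrow> real \<Rightarrow> (real \<Rightarrow> real) \<Rightarrow> bool" where
  "rep_B_star \<alpha> \<phi> b m \<longleftrightarrow>
     rep_B \<phi> b m \<and> abscissa (Phi_ext b m) \<le> ereal (- \<alpha>) \<and>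
     (\<exists>L\<le>0. ((\<lambda>u. ereal (u * Re (\<phi> (of_real (u - \<alpha>))))) \<longlongrightarrow> L) (at_right 0))"

definition bernstein_function :: "(real \<Rightarrow> real) \<Rightarrow> bool" where
  "bernstein_function g \<longleftrightarrow>
     (\<forall>u>0. g u \<ge> 0) \<and>
     (\<forall>n. \<forall>u>0. (deriv ^^ n) g differentiable (at u)) \<and>
     (\<forall>n. \<forall>u>0. (- 1) ^ n * (deriv ^^ Suc n) g u \<ge> 0)"

definition at_infty :: "(complex \<Rightarrow> complex) \<Rightarrow> ereal" where
  "at_infty \<phi> = Lim at_top (\<lambda>u::real. ereal (Re (\<phi> (of_real u))))"

definition deriv_0plus :: "(complex \<Rightarrow> complex) \<Rightarrow> real" where
  "deriv_0plus \<psi> = Lim (at_right 0) (deriv (\<lambda>u::real. Re (\<psi> (of_real u))))"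

section \<open>The function \<open>\<E>\<close>\<close>

text \<open>
  \<open>bernstein_gamma \<psi> A W\<close>: \<open>W\<close> is the function \<open>W\<^sub>\<psi>\<close>, meromorphic on \<open>Re z > A\<close>, where \<open>A\<close> is the
  abscissa of \<open>\<psi>\<close>. It is the Mellin transform of a positive measure on \<open>(0,\<infinity>)\<close> where that transform
  converges, i.e. for \<open>Re z > 0\<close> (there is a pole at \<open>0\<close>, as \<open>\<psi>(0) = 0\<close>), and is continued to
  \<open>Re z > A\<close> by the functional equation. The latter is solved for \<open>W z\<close>, because literally
  \<open>W 1 = \<psi> 0 * W 0\<close> would force \<open>W 0 = \<infinity>\<close>: with \<open>x / 0 = 0\<close> a pole of \<open>W\<close> gets the value \<open>0\<close> and the
  equation holds throughout; in particular \<open>1 / W\<close> has the right value \<open>0\<close> at the poles.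
\<close>

definition bernstein_gamma :: "(complex \<Rightarrow> complex) \<Rightarrow> ereal \<Rightarrow> (complex \<Rightarrow> complex) \<Rightarrow> bool" where
  "bernstein_gamma \<psi> A W \<longleftrightarrow>
     (\<exists>\<nu>. sets \<nu> = sets borel \<and> emeasure \<nu> {..0} = 0 \<and>
        (\<forall>z. Re z > 0 \<longrightarrow>
           integrable \<nu> (\<lambda>x. complex_of_real x powr (z - 1)) \<and>
           W z = (LINT x|\<nu>. complex_of_real x powr (z - 1)))) \<and>
     W 1 = 1 \<and>
     (\<forall>z. ereal (Re z) > A \<longrightarrow> W z = W (z + 1) / \<psi> z)"

definition E_series :: "(complex \<Rightarrow> complex) \<Rightarrow> (complex \<Rightarrow> complex) \<Rightarrow> complex \<Rightarrow> complex" where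
  "E_series \<psi> W z =
     1 / of_real (deriv_0plus \<psi>) *
     (\<Sum>n. if n = 0 then of_real (deriv_0plus \<psi>) else z ^ n / (of_nat n * W (of_nat n)))"

text \<open>The contour is \<open>\<xi> = a + \<i>s\<close> with \<open>s\<close> real, so that \<open>d\<xi> = \<i> ds\<close>.\<close>

definition E_mellin_barnes ::
    "(complex \<Rightarrow> complex) \<Rightarrow> (complex \<Rightarrow> complex) \<Rightarrow> real \<Rightarrow> complex \<Rightarrow> complex" where
  "E_mellin_barnes \<psi> W a z =
     - (1 / of_real (deriv_0plus \<psi>)) * (1 / (2 * of_real pi * \<i>)) *
     (LINT s|lebesgue. (let \<xi> = Complex a s in
        \<psi> (- \<xi>) / \<xi> * (Gamma \<xi> * Gamma (1 - \<xi>) / W (1 - \<xi>)) * (- z) powr (- \<xi>) * \<i>))"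

definition E_fun ::
    "(complex \<Rightarrow> complex) \<Rightarrow> (complex \<Rightarrow> complex) \<Rightarrow> real \<Rightarrow> complex \<Rightarrow> complex" where
  "E_fun \<psi> W a z =
     (if ereal (norm z) < at_infty \<psi> then E_series \<psi> W z else E_mellin_barnes \<psi> W a z)"

text \<open>
  Where \<open>\<E>\<close> is defined: the disc of convergence and the sector of the Mellin--Barnes representation
  (the latter being available when the abscissa of \<open>\<psi>\<close> is negative).
\<close>

definition E_dom :: "(complex \<Rightarrow> complex) \<Rightarrow> complex set" where
  "E_dom \<psi> = {z. ereal (norm z) < at_infty \<psi>} \<union> {z. z \<noteq> 0 \<and> \<bar>Arg (- z)\<bar> < pi / 2}"

section \<open>The characteristic operator of the self-similar process\<close>

definition levy_measure :: "(real \<Rightarrow> real) \<Rightarrow> real measure \<Rightarrow> bool" where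
  "levy_measure m Lev \<longleftrightarrow>
     sets Lev = sets borel \<and> emeasure Lev {..0} = 0 \<and>
     (\<forall>y>0. emeasure Lev {y<..} = ennreal (m (exp (- y))))"

definition A_op ::
    "real \<Rightarrow> real \<Rightarrow> real measure \<Rightarrow> (real \<Rightarrow> complex) \<Rightarrow> real \<Rightarrow> complex" where
  "A_op \<alpha> b Lev f t =
     of_real (t powr (- \<alpha>)) *
     (of_real (b * t) * vector_derivative f (at t)
      + (LINT y:{0<..}|Lev. f (t * exp y) - f t))"

definition C_b :: "(real \<Rightarrow> complex) set" where
  "C_b = {f. continuous_on {0<..} f \<and> bounded (f ` {0<..})}"

definition Lam :: "(real \<Rightarrow> complex) \<Rightarrow> real \<Rightarrow> complex" where
  "Lam f = f \<circ> (\<lambda>y. 1 / y)"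

end

theory Submission
  imports Defs "HOL-Probability.Probability" "HOL-Complex_Analysis.Complex_Analysis"
begin

text \<open>
  For power functions everything reduces to the substitution \<open>r \<mapsto> t r\<close>, and (iv) is Fubini's theorem for
  \<open>f (t e\<^sup>y) - f t\<close> written as an integral of \<open>f'\<close>. The sign of the derivatives of \<open>b u + u \<integral> r\<^bsup>u-1\<^esup> m(r) dr\<close>
  is found by comparing the non-decreasing weight \<open>m\<close> with a constant one, for which they vanish.

  Let \<open>\<psi> = \<phi>\<^sub>\<alpha>\<close>. Inside the disc of convergence the eigenfunction equation is termwise, by
  \<open>W(n+1) = \<psi>(n) W(n)\<close>. Outside the disc \<open>\<phi>\<close> is bounded, so that \<open>b = 0\<close>, the Levy measure is finite and
  the exponential functional \<open>I\<close> of the subordinator is a perpetuity: \<open>I = U + R I'\<close> with \<open>U\<close> exponential,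
  \<open>R < 1\<close> and \<open>I'\<close> a copy of \<open>I\<close>, all independent. Its law satisfies
  \<open>E h(I) = E \<integral>\<^sub>0\<^sup>1 I m(r) \<alpha> r\<^bsup>\<alpha>-1\<^esup> h(I r\<^bsup>\<alpha>\<^esup>) dr\<close>. For \<open>h(y) = y\<^bsup>z-1\<^esup>\<close> this is the recursion
  \<open>M(z) = (\<psi>(z) / z) M(z+1)\<close> of the Mellin transform \<open>M\<close> of \<open>I\<close>, whence \<open>W M = \<Gamma>\<close>, and Mellin inversion of
  \<open>e\<^bsup>-x\<^esup>\<close> identifies the Mellin--Barnes integral at \<open>-x\<close> with \<open>E [I\<^bsup>-1\<^esup> e\<^bsup>-x I\<^esup>] / \<psi>'(0+)\<close>. For
  \<open>h(y) = e\<^bsup>-x y\<^esup> / y\<close> it is the eigenfunction equation of the latter function.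
\<close>

section \<open>Perpetuities\<close>

text \<open>The operator at \<open>t\<close> integrates over all of (0,t). So even when the argument
  q t^\<alpha> lies outside the disc, the values of the eigenfunction inside enter, and the series
  and the Mellin-Barnes integral have to be recognised as one and the same function. The common form
  E [I^(-1) e^(-x I)] / psi'(0+) does this, and it has the right value 1 at x = 0 because M(0) =
  psi'(0+) M(1).

  The perpetuity comes from the first jump. A driftless subordinator T with Levy measure of finite
  mass l rests for an exponential time U of rate l and then jumps by some J, so that I, the integral
  of e^(-\<alpha> T_s) over s > 0, splits as U + R I' with R = e^(-\<alpha> J). Only the law of I is
  ever used; hence the process is replaced by an i.i.d. stream of pairs (U, R). The law of U
  disappears from the final identity, which is what makes the Mellin recursion and the eigenfunction
  equation two instances of it.\<close>

primrec perpetuity_sum :: "nat \<Rightarrow> (real \<times> real) stream \<Rightarrow> ennreal" where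
  "perpetuity_sum 0 \<omega> = 0"
| "perpetuity_sum (Suc n) \<omega> =
     ennreal (fst (shd \<omega>)) + ennreal (snd (shd \<omega>)) * perpetuity_sum n (stl \<omega>)"

text \<open>With values in \<open>ennreal\<close> the increasing truncations have a limit for every
  stream; that the limit is finite almost surely is a separate matter, settled through the
  mean.\<close>

definition perpetuity :: "(real \<times> real) stream \<Rightarrow> ennreal" where
  "perpetuity \<omega> = (SUP n. perpetuity_sum n \<omega>)"

lemma perpetuity_sum_mono: "perpetuity_sum n \<omega> \<le> perpetuity_sum (Suc n) \<omega>"
proof (induction n arbitrary: \<omega>)
  case (Suc n)
  show ?case
    using Suc.IH[of "stl \<omega>"] by (simp add: add_left_mono mult_left_mono del: perpetuity_sum.simps(2) add: perpetuity_sum.simps(2)[of n \<omega>] perpetuity_sum.simps(2)[of "Suc n" \<omega>])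
qed simp

lemma incseq_perpetuity_sum: "incseq (\<lambda>n. perpetuity_sum n \<omega>)"
  by (rule incseq_SucI) (rule perpetuity_sum_mono)

text \<open>The truncations unfold at the front of the stream, so one index shift and the continuity
  of affine maps of \<open>ennreal\<close> along suprema give the recursion.\<close>

lemma perpetuity_Stream:
  "perpetuity (x ## \<omega>) = ennreal (fst x) + ennreal (snd x) * perpetuity \<omega>"
proof -
  have "perpetuity (x ## \<omega>) = (SUP n. perpetuity_sum (Suc n) (x ## \<omega>))"
    unfolding perpetuity_def
    by (rule LIMSEQ_unique[OF LIMSEQ_SUP[OF incseq_perpetuity_sum]])
       (rule LIMSEQ_Suc[OF LIMSEQ_SUP[OF incseq_perpetuity_sum], THEN LIMSEQ_unique, THEN subst[where P = "\<lambda>z. _ \<longlonglongrightarrow> z"]],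
        rule LIMSEQ_SUP, rule incseq_SucI, rule perpetuity_sum_mono, rule LIMSEQ_SUP[OF incseq_perpetuity_sum])
  also have "\<dots> = (SUP n. ennreal (fst x) + ennreal (snd x) * perpetuity_sum n \<omega>)"
    by simp
  also have "\<dots> = ennreal (fst x) + ennreal (snd x) * perpetuity \<omega>"
    unfolding perpetuity_def
    by (subst SUP_mult_left_ennreal, subst ennreal_SUP_add_right) auto
  finally show ?thesis .
qed

lemma measurable_perpetuity_sum [measurable]:
  "perpetuity_sum n \<in> borel_measurable (stream_space (borel \<Otimes>\<^sub>M borel))"
  by (induction n) (simp_all, measurable)

lemma measurable_perpetuity [measurable]:
  "perpetuity \<in> borel_measurable (stream_space (borel \<Otimes>\<^sub>M borel))"
  unfolding perpetuity_def[abs_def] by measurable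

text \<open>\<open>K\<close> is the law of the perpetuity of an i.i.d. stream. Since R < 1 almost
  surely, its mean is at most E U / (1 - E R), so it is finite almost surely; splitting off the
  first pair of the stream is the fixed-point equation.\<close>

lemma perpetuity_law_exists:
  fixes U R :: "real measure"
  assumes U: "prob_space U" "sets U = sets borel" and R: "prob_space R" "sets R = sets borel"
    and Upos: "AE u in U. 0 < u" and Umean: "(\<integral>\<^sup>+u. ennreal u \<partial>U) < \<infinity>"
    and R01: "AE r in R. 0 < r \<and> r < 1"
  obtains K :: "real measure" where "prob_space K" "sets K = sets borel" "AE y in K. 0 < y"
    "\<And>h. h \<in> borel_measurable borel \<Longrightarrow>
       (\<integral>\<^sup>+y. h y \<partial>K) = (\<integral>\<^sup>+r. \<integral>\<^sup>+y. \<integral>\<^sup>+u. h (u + r * y) \<partial>U \<partial>K \<partial>R)"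
proof -
  interpret U: prob_space U by fact
  interpret R: prob_space R by fact
  interpret UR: pair_prob_space U R ..
  have M_sets [measurable_cong]: "sets (U \<Otimes>\<^sub>M R) = sets (borel \<Otimes>\<^sub>M borel)"
    using U R by (intro sets_pair_measure_cong)
  define S where "S = stream_space (U \<Otimes>\<^sub>M R)"
  have S_sets [measurable_cong]: "sets S = sets (stream_space (borel \<Otimes>\<^sub>M borel))"
    unfolding S_def by (rule sets_stream_space_cong[OF M_sets])
  interpret S: prob_space S unfolding S_def by (rule UR.prob_space_stream_space)
  have U_sets [measurable_cong]: "sets U = sets borel" and R_sets [measurable_cong]: "sets R = sets borel"
    using U R by auto
  have step: "(\<integral>\<^sup>+\<omega>. f \<omega> \<partial>S) = (\<integral>\<^sup>+u. \<integral>\<^sup>+r. \<integral>\<^sup>+\<omega>. f ((u, r) ## \<omega>) \<partial>S \<partial>R \<partial>U)"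
    if [measurable]: "f \<in> borel_measurable (stream_space (borel \<Otimes>\<^sub>M borel))" for f :: "_ \<Rightarrow> ennreal"
  proof -
    have "f \<in> borel_measurable S" by measurable
    then have "(\<integral>\<^sup>+\<omega>. f \<omega> \<partial>S) = (\<integral>\<^sup>+x. \<integral>\<^sup>+\<omega>. f (x ## \<omega>) \<partial>S \<partial>(U \<Otimes>\<^sub>M R))"
      unfolding S_def by (rule UR.nn_integral_stream_space)
    also have "\<dots> = (\<integral>\<^sup>+u. \<integral>\<^sup>+r. \<integral>\<^sup>+\<omega>. f ((u, r) ## \<omega>) \<partial>S \<partial>R \<partial>U)"
      by (rule R.nn_integral_fst[symmetric]) measurable
    finally show ?thesis .
  qed
  define \<rho> where "\<rho> = (\<integral>\<^sup>+r. ennreal r \<partial>R)"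
  \<comment> \<open>Strictness: if E R = 1, then 1 - R would be a nonnegative function with integral
    0, contradicting R < 1 almost everywhere.\<close>
  have "\<rho> < 1"
  proof -
    have "\<rho> \<le> (\<integral>\<^sup>+r. 1 \<partial>R)" unfolding \<rho>_def
      using R01 by (intro nn_integral_mono_AE) (auto simp: ennreal_le_1)
    then have le: "\<rho> \<le> 1" by (simp add: R.emeasure_space_1)
    have "\<rho> \<noteq> 1"
    proof
      assume "\<rho> = 1"
      then have "(\<integral>\<^sup>+r. 1 - ennreal r \<partial>R) = 0"
        using R01 unfolding \<rho>_def
        by (subst nn_integral_diff)
           (auto simp: R.emeasure_space_1 intro: less_imp_le elim!: eventually_mono
             intro!: eventually_mono[OF R01])
      then have "AE r in R. 1 - ennreal r = 0"
        by (subst (asm) nn_integral_0_iff_AE) auto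
      with R01 have "AE r in R. False"
        by eventually_elim (auto simp: ennreal_less_one_iff diff_eq_0_iff_ennreal)
      then show False by (simp add: R.AE_False)
    qed
    with le show ?thesis by simp
  qed
  define e where "e = (\<integral>\<^sup>+u. ennreal u \<partial>U)"
  define rr where "rr = enn2real \<rho>"
  have rr: "\<rho> = ennreal rr" "0 \<le> rr" "rr < 1"
    using \<open>\<rho> < 1\<close> unfolding rr_def by (cases \<rho>; auto simp: ennreal_less_one_iff)+
  define ee where "ee = enn2real e"
  have ee: "e = ennreal ee" "0 \<le> ee" using Umean unfolding ee_def e_def by auto
  \<comment> \<open>The bound is the fixed point of x = E U + (E R) x, so it reproduces itself under
    the recursion.\<close>
  have bound: "(\<integral>\<^sup>+\<omega>. perpetuity_sum n \<omega> \<partial>S) \<le> ennreal (ee / (1 - rr))" for n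
  proof (induction n)
    case (Suc n)
    have "(\<integral>\<^sup>+\<omega>. perpetuity_sum (Suc n) \<omega> \<partial>S) =
      (\<integral>\<^sup>+u. \<integral>\<^sup>+r. \<integral>\<^sup>+\<omega>. (ennreal u + ennreal r * perpetuity_sum n \<omega>) \<partial>S \<partial>R \<partial>U)"
      by (subst step) auto
    also have "\<dots> = e + \<rho> * (\<integral>\<^sup>+\<omega>. perpetuity_sum n \<omega> \<partial>S)"
      unfolding e_def \<rho>_def
      by (simp add: nn_integral_add nn_integral_cmult nn_integral_multc S.emeasure_space_1 R.emeasure_space_1 U.emeasure_space_1)
    also have "\<dots> \<le> ennreal ee + ennreal rr * ennreal (ee / (1 - rr))"
      unfolding ee rr by (intro add_left_mono mult_left_mono Suc.IH) auto
    also have "\<dots> = ennreal (ee + rr * (ee / (1 - rr)))"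
      using rr ee by (simp add: ennreal_mult[symmetric] ennreal_plus[symmetric] del: ennreal_plus)
    also have "ee + rr * (ee / (1 - rr)) = ee / (1 - rr)"
      using rr by (simp add: field_simps)
    finally show ?case .
  qed simp
  have "(\<integral>\<^sup>+\<omega>. perpetuity \<omega> \<partial>S) = (SUP n. \<integral>\<^sup>+\<omega>. perpetuity_sum n \<omega> \<partial>S)"
    unfolding perpetuity_def
    by (rule nn_integral_monotone_convergence_SUP)
       (auto simp: incseq_def le_fun_def intro!: incseq_perpetuity_sum[THEN incseqD])
  also have "\<dots> \<le> ennreal (ee / (1 - rr))" by (rule SUP_least) (rule bound)
  finally have "(\<integral>\<^sup>+\<omega>. perpetuity \<omega> \<partial>S) < \<infinity>" by (simp add: order_le_less_trans)
  then have fin: "AE \<omega> in S. perpetuity \<omega> \<noteq> \<infinity>"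
    by (intro nn_integral_noteq_infinite) auto
  \<comment> \<open>\<open>enn2real\<close> sends infinity to 0, so \<open>Z\<close> satisfies the
    affine recursion only on the event in \<open>fin\<close>.\<close>
  define Z where "Z = (\<lambda>\<omega>. enn2real (perpetuity \<omega>))"
  have Z [measurable]: "Z \<in> borel_measurable S" unfolding Z_def by measurable
  have Z' [measurable]: "Z \<in> borel_measurable (stream_space (borel \<Otimes>\<^sub>M borel))" unfolding Z_def by measurable
  define K where "K = distr S borel Z"
  have K_sets [measurable_cong]: "sets K = sets borel" by (simp add: K_def)
  interpret K: prob_space K unfolding K_def by (rule S.prob_space_distr) measurable
  have fix_law: "(\<integral>\<^sup>+y. h y \<partial>K) = (\<integral>\<^sup>+r. \<integral>\<^sup>+y. \<integral>\<^sup>+u. h (u + r * y) \<partial>U \<partial>K \<partial>R)"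
    if [measurable]: "h \<in> borel_measurable borel" for h :: "real \<Rightarrow> ennreal"
  proof -
    have "(\<integral>\<^sup>+y. h y \<partial>K) = (\<integral>\<^sup>+\<omega>. h (Z \<omega>) \<partial>S)"
      unfolding K_def by (rule nn_integral_distr) measurable
    also have "\<dots> = (\<integral>\<^sup>+u. \<integral>\<^sup>+r. \<integral>\<^sup>+\<omega>. h (Z ((u, r) ## \<omega>)) \<partial>S \<partial>R \<partial>U)"
      by (rule step) measurable
    also have "\<dots> = (\<integral>\<^sup>+u. \<integral>\<^sup>+r. \<integral>\<^sup>+\<omega>. h (u + r * Z \<omega>) \<partial>S \<partial>R \<partial>U)"
    proof (rule nn_integral_cong_AE, use Upos in eventually_elim)
      case (elim u)
      show ?case
      proof (rule nn_integral_cong_AE, use R01 in eventually_elim)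
        case (elim r)
        show ?case
        proof (rule nn_integral_cong_AE, use fin in eventually_elim)
          case (elim \<omega>)
          then obtain p where p: "perpetuity \<omega> = ennreal p" "0 \<le> p"
            by (cases "perpetuity \<omega>") auto
          have "perpetuity ((u, r) ## \<omega>) = ennreal (u + r * p)"
            using p \<open>0 < u\<close> \<open>0 < r \<and> r < 1\<close>
            by (simp add: perpetuity_Stream ennreal_mult[symmetric] ennreal_plus[symmetric] del: ennreal_plus)
          then have "Z ((u, r) ## \<omega>) = u + r * Z \<omega>"
            using p \<open>0 < u\<close> \<open>0 < r \<and> r < 1\<close> unfolding Z_def by (simp del: ennreal_plus)
          then show ?case by simp
        qed
      qed
    qed
    also have "\<dots> = (\<integral>\<^sup>+u. \<integral>\<^sup>+r. \<integral>\<^sup>+y. h (u + r * y) \<partial>K \<partial>R \<partial>U)"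
      unfolding K_def by (subst nn_integral_distr) auto
    also have "\<dots> = (\<integral>\<^sup>+r. \<integral>\<^sup>+u. \<integral>\<^sup>+y. h (u + r * y) \<partial>K \<partial>U \<partial>R)"
    proof -
      interpret pair_sigma_finite R U ..
      show ?thesis by (rule Fubini') measurable
    qed
    also have "\<dots> = (\<integral>\<^sup>+r. \<integral>\<^sup>+y. \<integral>\<^sup>+u. h (u + r * y) \<partial>U \<partial>K \<partial>R)"
    proof (rule nn_integral_cong)
      fix r
      interpret pair_sigma_finite K U ..
      show "(\<integral>\<^sup>+u. \<integral>\<^sup>+y. h (u + r * y) \<partial>K \<partial>U) = (\<integral>\<^sup>+y. \<integral>\<^sup>+u. h (u + r * y) \<partial>U \<partial>K)"
        by (rule Fubini') measurable
    qed
    finally show ?thesis .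
  qed
  have nonneg: "AE y in K. 0 \<le> y"
    unfolding K_def by (subst AE_distr_iff) (auto simp: Z_def)
  \<comment> \<open>Strict positivity comes out of the fixed-point equation itself: u + r y > 0
    already for y \<ge> 0.\<close>
  have "(\<integral>\<^sup>+y. indicator {..0} y \<partial>K) = (\<integral>\<^sup>+r. \<integral>\<^sup>+y. \<integral>\<^sup>+u. indicator {..0} (u + r * y) \<partial>U \<partial>K \<partial>R)"
    by (rule fix_law) measurable
  also have "\<dots> = (\<integral>\<^sup>+r. \<integral>\<^sup>+y. \<integral>\<^sup>+u. 0 \<partial>U \<partial>K \<partial>R)"
  proof (rule nn_integral_cong_AE, use R01 in eventually_elim)
    case (elim r)
    show ?case
    proof (rule nn_integral_cong_AE, use nonneg in eventually_elim)
      case (elim y)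
      show ?case
      proof (rule nn_integral_cong_AE, use Upos in eventually_elim)
        case (elim u)
        have "0 < u + r * y"
          using \<open>0 < u\<close> \<open>0 \<le> y\<close> \<open>0 < r \<and> r < 1\<close> by (simp add: add_pos_nonneg)
        then show ?case by simp
      qed
    qed
  qed
  finally have "(\<integral>\<^sup>+y. indicator {..0} y \<partial>K) = 0" by simp
  then have "AE y in K. indicator {..0::real} y = (0::ennreal)"
    by (subst (asm) nn_integral_0_iff_AE) auto
  then have "AE y in K. 0 < y"
    by eventually_elim (auto simp: indicator_def split: if_splits)
  with K.prob_space_axioms K_sets fix_law show ?thesis by (intro that)
qed

lemma nn_integral_exponential_lessThan:
  assumes "0 < l"
  shows "(\<integral>\<^sup>+u. ennreal (exponential_density l u) * indicator {..<c} u \<partial>lborel)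
    = (if c \<le> 0 then 0 else ennreal (1 - exp (- (l * c))))"
proof -
  have "(\<integral>\<^sup>+u. ennreal (exponential_density l u) * indicator {..<c} u \<partial>lborel)
      = (\<integral>\<^sup>+u. ennreal (exponential_density l u) * indicator {..c} u \<partial>lborel)"
    by (rule nn_integral_cong_AE, use AE_lborel_singleton[of c] in eventually_elim)
       (auto simp: indicator_def)
  also have "\<dots> = emeasure (density lborel (exponential_density l)) {..c}"
    by (subst emeasure_density) auto
  also have "\<dots> = erlang_CDF 0 l c"
    using assms by (intro emeasure_erlang_density) auto
  also have "\<dots> = (if c \<le> 0 then 0 else ennreal (1 - exp (- (l * c))))"
    by (auto simp: erlang_CDF_def)
  finally show ?thesis .
qed

text \<open>With \<open>U\<close> exponential of rate \<open>l\<close> and \<open>R\<close> distributed as \<open>\<sigma> / l\<close>, the fixed-point equation \<open>Y = U + R Y'\<close> turns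
  into the stated identity by integrating out \<open>U\<close>.\<close>

lemma perpetuity_exponential_exists:
  fixes \<sigma> :: "real measure" and l :: real
  assumes l: "0 < l" and sig: "sets \<sigma> = sets borel" "emeasure \<sigma> UNIV = ennreal l"
    and sig01: "AE r in \<sigma>. 0 < r \<and> r < 1"
  obtains K :: "real measure" where "prob_space K" "sets K = sets borel" "AE y in K. 0 < y"
    "\<And>h. h \<in> borel_measurable borel \<Longrightarrow>
       (\<integral>\<^sup>+y. h y \<partial>K) =
       (\<integral>\<^sup>+y. \<integral>\<^sup>+r. ennreal y * emeasure \<sigma> {..<r} * h (y * r) * indicator {0<..<1} r \<partial>lborel \<partial>K)"
proof -
  have sig_sets [measurable_cong]: "sets \<sigma> = sets borel" by fact
  have space_sig: "space \<sigma> = UNIV" using sets_eq_imp_space_eq[OF sig(1)] by simp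
  interpret sig: finite_measure \<sigma>
    using sig(2) space_sig by (intro finite_measureI) simp
  define U where "U = density lborel (exponential_density l)"
  define R where "R = density \<sigma> (\<lambda>_. ennreal (1 / l))"
  have U_sets [measurable_cong]: "sets U = sets borel" by (simp add: U_def)
  have R_sets [measurable_cong]: "sets R = sets borel" by (simp add: R_def sig)
  have U: "prob_space U" unfolding U_def using l by (rule prob_space_exponential_density)
  have Upos: "AE u in U. 0 < u"
    unfolding U_def
    by (subst AE_density, measurable, use AE_lborel_singleton[of "0::real"] in eventually_elim)
       (auto simp: exponential_density_def)
  have Umean: "(\<integral>\<^sup>+u. ennreal u \<partial>U) < \<infinity>"
  proof -
    have "(\<integral>\<^sup>+u. ennreal u \<partial>U) = (\<integral>\<^sup>+u. ennreal (exponential_density l u) * ennreal (u ^ 1) \<partial>lborel)"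
      unfolding U_def by (subst nn_integral_density) (auto simp: exponential_density_def)
    also have "\<dots> = (\<integral>\<^sup>+u. ennreal (erlang_density 0 l u * u ^ 1) \<partial>lborel)"
      by (intro nn_integral_cong) (auto simp: erlang_density_def ennreal_mult'')
    also have "\<dots> = fact (1 + 0) / (fact 0 * l ^ 1)"
      using nn_integral_erlang_ith_moment[OF l, of 0 1] by (simp add: add.commute)
    finally show ?thesis using l by simp
  qed
  have R: "prob_space R"
  proof
    have "emeasure R (space R) = (\<integral>\<^sup>+r. ennreal (1 / l) \<partial>\<sigma>)"
      unfolding R_def by (subst emeasure_density) (auto simp: space_sig)
    also have "\<dots> = 1" using l by (simp add: space_sig sig ennreal_mult[symmetric])
    finally show "emeasure R (space R) = 1" .
  qed
  have R01: "AE r in R. 0 < r \<and> r < 1"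
    unfolding R_def by (subst AE_density) (auto intro: eventually_mono[OF sig01])
  obtain K :: "real measure" where K: "prob_space K" and K_sets [measurable_cong]: "sets K = sets borel"
    and Kpos: "AE y in K. 0 < y"
    and law: "\<And>h. h \<in> borel_measurable borel \<Longrightarrow>
       (\<integral>\<^sup>+y. h y \<partial>K) = (\<integral>\<^sup>+r. \<integral>\<^sup>+y. \<integral>\<^sup>+u. h (u + r * y) \<partial>U \<partial>K \<partial>R)"
    by (rule perpetuity_law_exists[OF U U_sets R R_sets Upos Umean R01], rule that)
  interpret K: prob_space K by fact
  interpret U: prob_space U by fact
  interpret R: prob_space R by fact
  interpret SK: pair_sigma_finite \<sigma> K ..
  interpret LK: pair_sigma_finite lborel K ..
  interpret KL: pair_sigma_finite K lborel ..
  interpret LS: pair_sigma_finite lborel \<sigma> ..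
  interpret SL: pair_sigma_finite \<sigma> lborel ..
  interpret KS: pair_sigma_finite K \<sigma> ..
  let ?E = "exponential_density l"
  have law': "ennreal l * (\<integral>\<^sup>+y. h y \<partial>K)
      = (\<integral>\<^sup>+r. \<integral>\<^sup>+y. \<integral>\<^sup>+u. ennreal (?E u) * h (u + r * y) \<partial>lborel \<partial>K \<partial>\<sigma>)"
    if [measurable]: "h \<in> borel_measurable borel" for h :: "real \<Rightarrow> ennreal"
  proof -
    have "(\<integral>\<^sup>+y. h y \<partial>K) = (\<integral>\<^sup>+r. ennreal (1 / l) * (\<integral>\<^sup>+y. \<integral>\<^sup>+u. h (u + r * y) \<partial>U \<partial>K) \<partial>\<sigma>)"
      unfolding law[OF that] R_def by (subst nn_integral_density) auto
    also have "\<dots> = ennreal (1 / l) * (\<integral>\<^sup>+r. \<integral>\<^sup>+y. \<integral>\<^sup>+u. h (u + r * y) \<partial>U \<partial>K \<partial>\<sigma>)"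
      by (rule nn_integral_cmult) measurable
    also have "(\<integral>\<^sup>+r. \<integral>\<^sup>+y. \<integral>\<^sup>+u. h (u + r * y) \<partial>U \<partial>K \<partial>\<sigma>)
        = (\<integral>\<^sup>+r. \<integral>\<^sup>+y. \<integral>\<^sup>+u. ennreal (?E u) * h (u + r * y) \<partial>lborel \<partial>K \<partial>\<sigma>)"
      unfolding U_def by (subst nn_integral_density) auto
    finally show ?thesis
      using l by (simp add: mult.assoc[symmetric] ennreal_mult[symmetric])
  qed
  \<comment> \<open>\<open>?G v r y\<close> is the probability that u + r y exceeds v, restricted to
    r y < v; multiplied by \<open>l\<close> it is the density of u + r y at v.\<close>
  let ?G = "\<lambda>v r y. if r * y < v then ennreal (exp (- (l * (v - r * y)))) else 0"
  \<comment> \<open>Adding \<open>l * K {..<v}\<close> to either side gives the mass of the event r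
    y < v under \<sigma> and \<open>K\<close>. On the left, distribution function and tail of U add
    up to 1. On the right, r y \<le> y lets the event split according to y < v or v \<le> y, and
    \<sigma> has mass \<open>l\<close>. The added term is finite and cancels.\<close>
  have key: "(\<integral>\<^sup>+r. \<integral>\<^sup>+y. ?G v r y \<partial>K \<partial>\<sigma>)
     = (\<integral>\<^sup>+r. \<integral>\<^sup>+y. (if r * y < v \<and> v \<le> y then 1 else 0) \<partial>K \<partial>\<sigma>)" for v
  proof -
    have p: "ennreal l * emeasure K {..<v}
        = (\<integral>\<^sup>+r. \<integral>\<^sup>+y. (if v - r * y \<le> 0 then 0 else ennreal (1 - exp (- (l * (v - r * y))))) \<partial>K \<partial>\<sigma>)"
    proof -
      have "ennreal l * emeasure K {..<v} = ennreal l * (\<integral>\<^sup>+y. indicator {..<v} y \<partial>K)"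
        by (subst nn_integral_indicator) (auto simp: K_sets)
      also have "\<dots> = (\<integral>\<^sup>+r. \<integral>\<^sup>+y. \<integral>\<^sup>+u. ennreal (?E u) * indicator {..<v} (u + r * y) \<partial>lborel \<partial>K \<partial>\<sigma>)"
        by (rule law') measurable
      also have "\<dots> = (\<integral>\<^sup>+r. \<integral>\<^sup>+y. \<integral>\<^sup>+u. ennreal (?E u) * indicator {..<v - r * y} u \<partial>lborel \<partial>K \<partial>\<sigma>)"
        by (intro nn_integral_cong) (auto simp: indicator_def)
      finally show ?thesis unfolding nn_integral_exponential_lessThan[OF l] .
    qed
    have fin: "ennreal l * emeasure K {..<v} \<noteq> \<infinity>"
      by (simp add: ennreal_mult_eq_top_iff K.emeasure_finite)
    have "ennreal l * emeasure K {..<v} + (\<integral>\<^sup>+r. \<integral>\<^sup>+y. ?G v r y \<partial>K \<partial>\<sigma>)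
      = (\<integral>\<^sup>+r. \<integral>\<^sup>+y. (if v - r * y \<le> 0 then 0 else ennreal (1 - exp (- (l * (v - r * y))))) + ?G v r y \<partial>K \<partial>\<sigma>)"
      unfolding p by (subst nn_integral_add, simp, measurable, intro nn_integral_cong nn_integral_add[symmetric]) measurable
    also have "\<dots> = (\<integral>\<^sup>+r. \<integral>\<^sup>+y. (if r * y < v then 1 else 0) \<partial>K \<partial>\<sigma>)"
    proof (intro nn_integral_cong)
      fix r y
      show "(if v - r * y \<le> 0 then 0 else ennreal (1 - exp (- (l * (v - r * y))))) + ?G v r y
          = (if r * y < v then 1 else 0)"
        using l by (auto simp: ennreal_plus[symmetric] simp del: ennreal_plus)
    qed
    also have "\<dots> = (\<integral>\<^sup>+r. \<integral>\<^sup>+y. indicator {..<v} y + (if r * y < v \<and> v \<le> y then 1 else 0) \<partial>K \<partial>\<sigma>)"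
    proof (rule nn_integral_cong_AE, use sig01 in eventually_elim)
      case (elim r)
      show ?case
      proof (rule nn_integral_cong_AE, use Kpos in eventually_elim)
        case (elim y)
        have "r * y \<le> 1 * y" using elim \<open>0 < r \<and> r < 1\<close> by (intro mult_right_mono) auto
        then show ?case by (auto simp: indicator_def)
      qed
    qed
    also have "\<dots> = ennreal l * emeasure K {..<v}
        + (\<integral>\<^sup>+r. \<integral>\<^sup>+y. (if r * y < v \<and> v \<le> y then 1 else 0) \<partial>K \<partial>\<sigma>)"
      by (simp add: nn_integral_add sig space_sig K_sets mult.commute)
    finally show ?thesis using fin by (simp add: ennreal_add_left_cancel)
  qed
  \<comment> \<open>By the fixed-point equation \<open>K\<close> has a density, namely the integral
    of \<open>?G v r y\<close> over \<sigma> and \<open>K\<close>. \<open>key\<close> replaces it by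
    the mass of r y < v \<le> y, which is free of the exponential, and the substitution v = y v'
    turns this into the factor y and the tail of \<sigma> at v'.\<close>
  have main: "(\<integral>\<^sup>+y. h y \<partial>K) =
       (\<integral>\<^sup>+y. \<integral>\<^sup>+r. ennreal y * emeasure \<sigma> {..<r} * h (y * r) * indicator {0<..<1} r \<partial>lborel \<partial>K)"
    if h [measurable]: "h \<in> borel_measurable borel" for h :: "real \<Rightarrow> ennreal"
  proof -
    have "ennreal l * (\<integral>\<^sup>+y. h y \<partial>K)
       = (\<integral>\<^sup>+r. \<integral>\<^sup>+y. \<integral>\<^sup>+u. ennreal (?E u) * h (u + r * y) \<partial>lborel \<partial>K \<partial>\<sigma>)" by (rule law') measurable
    also have "\<dots> = (\<integral>\<^sup>+r. \<integral>\<^sup>+y. \<integral>\<^sup>+v. ennreal (?E (v - r * y)) * h v \<partial>lborel \<partial>K \<partial>\<sigma>)"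
    proof -
      have "(\<integral>\<^sup>+u. ennreal (?E u) * h (u + r * y) \<partial>lborel) = (\<integral>\<^sup>+v. ennreal (?E (v - r * y)) * h v \<partial>lborel)" for r y
        by (subst nn_integral_real_affine[where c = 1 and t = "- (r * y)"]) (auto simp: add.commute)
      then show ?thesis by simp
    qed
    also have "\<dots> = (\<integral>\<^sup>+r. \<integral>\<^sup>+y. \<integral>\<^sup>+v. ennreal l * (?G v r y * h v) \<partial>lborel \<partial>K \<partial>\<sigma>)"
    proof -
      have "(\<integral>\<^sup>+v. ennreal (?E (v - r * y)) * h v \<partial>lborel) = (\<integral>\<^sup>+v. ennreal l * (?G v r y * h v) \<partial>lborel)" for r y
        by (rule nn_integral_cong_AE, use AE_lborel_singleton[of "r * y"] in eventually_elim)
           (use l in \<open>auto simp: exponential_density_def ennreal_mult'' mult_ac indicator_def right_diff_distrib\<close>)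
      then show ?thesis by simp
    qed
    also have "\<dots> = ennreal l * (\<integral>\<^sup>+r. \<integral>\<^sup>+y. \<integral>\<^sup>+v. ?G v r y * h v \<partial>lborel \<partial>K \<partial>\<sigma>)"
      by (simp add: nn_integral_cmult)
    finally have "(\<integral>\<^sup>+y. h y \<partial>K) = (\<integral>\<^sup>+r. \<integral>\<^sup>+y. \<integral>\<^sup>+v. ?G v r y * h v \<partial>lborel \<partial>K \<partial>\<sigma>)"
      using l by (simp add: ennreal_mult_cancel_left)
    also have "\<dots> = (\<integral>\<^sup>+r. \<integral>\<^sup>+v. \<integral>\<^sup>+y. ?G v r y * h v \<partial>K \<partial>lborel \<partial>\<sigma>)"
      by (intro nn_integral_cong LK.Fubini') measurable
    also have "\<dots> = (\<integral>\<^sup>+v. \<integral>\<^sup>+r. \<integral>\<^sup>+y. ?G v r y * h v \<partial>K \<partial>\<sigma> \<partial>lborel)"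
      by (rule LS.Fubini') measurable
    also have "\<dots> = (\<integral>\<^sup>+v. (\<integral>\<^sup>+r. \<integral>\<^sup>+y. ?G v r y \<partial>K \<partial>\<sigma>) * h v \<partial>lborel)"
      by (simp add: nn_integral_multc)
    also have "\<dots> = (\<integral>\<^sup>+v. (\<integral>\<^sup>+r. \<integral>\<^sup>+y. (if r * y < v \<and> v \<le> y then 1 else 0) \<partial>K \<partial>\<sigma>) * h v \<partial>lborel)"
      unfolding key ..
    also have "\<dots> = (\<integral>\<^sup>+v. \<integral>\<^sup>+r. \<integral>\<^sup>+y. (if r * y < v \<and> v \<le> y then 1 else 0) * h v \<partial>K \<partial>\<sigma> \<partial>lborel)"
      by (simp add: nn_integral_multc)
    also have "\<dots> = (\<integral>\<^sup>+r. \<integral>\<^sup>+v. \<integral>\<^sup>+y. (if r * y < v \<and> v \<le> y then 1 else 0) * h v \<partial>K \<partial>lborel \<partial>\<sigma>)"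
      by (rule SL.Fubini') measurable
    also have "\<dots> = (\<integral>\<^sup>+r. \<integral>\<^sup>+y. \<integral>\<^sup>+v. (if r * y < v \<and> v \<le> y then 1 else 0) * h v \<partial>lborel \<partial>K \<partial>\<sigma>)"
      by (intro nn_integral_cong KL.Fubini') measurable
    also have "\<dots> = (\<integral>\<^sup>+y. \<integral>\<^sup>+r. \<integral>\<^sup>+v. (if r * y < v \<and> v \<le> y then 1 else 0) * h v \<partial>lborel \<partial>\<sigma> \<partial>K)"
      by (rule KS.Fubini') measurable
    also have "\<dots> = (\<integral>\<^sup>+y. \<integral>\<^sup>+r. \<integral>\<^sup>+v. ennreal y * ((if r < v \<and> v \<le> 1 then 1 else 0) * h (y * v)) \<partial>lborel \<partial>\<sigma> \<partial>K)"
    proof (rule nn_integral_cong_AE, use Kpos in eventually_elim)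
      case (elim y)
      show ?case
      proof (rule nn_integral_cong)
        fix r
        have "(\<integral>\<^sup>+v. (if r * y < v \<and> v \<le> y then 1 else 0) * h v \<partial>lborel)
          = ennreal \<bar>y\<bar> * (\<integral>\<^sup>+v. (if r * y < 0 + y * v \<and> 0 + y * v \<le> y then 1 else 0) * h (0 + y * v) \<partial>lborel)"
          using elim by (intro nn_integral_real_affine) auto
        also have "\<dots> = (\<integral>\<^sup>+v. ennreal y * ((if r < v \<and> v \<le> 1 then 1 else 0) * h (y * v)) \<partial>lborel)"
          using elim by (subst nn_integral_cmult) (auto simp: mult.commute[of r] )
        finally show "(\<integral>\<^sup>+v. (if r * y < v \<and> v \<le> y then 1 else 0) * h v \<partial>lborel)
          = (\<integral>\<^sup>+v. ennreal y * ((if r < v \<and> v \<le> 1 then 1 else 0) * h (y * v)) \<partial>lborel)" .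
      qed
    qed
    also have "\<dots> = (\<integral>\<^sup>+y. \<integral>\<^sup>+v. \<integral>\<^sup>+r. ennreal y * ((if r < v \<and> v \<le> 1 then 1 else 0) * h (y * v)) \<partial>\<sigma> \<partial>lborel \<partial>K)"
      by (intro nn_integral_cong LS.Fubini') measurable
    also have "\<dots> = (\<integral>\<^sup>+y. \<integral>\<^sup>+r. ennreal y * emeasure \<sigma> {..<r} * h (y * r) * indicator {0<..<1} r \<partial>lborel \<partial>K)"
    proof (rule nn_integral_cong)
      fix y
      show "(\<integral>\<^sup>+v. \<integral>\<^sup>+r. ennreal y * ((if r < v \<and> v \<le> 1 then 1 else 0) * h (y * v)) \<partial>\<sigma> \<partial>lborel)
         = (\<integral>\<^sup>+r. ennreal y * emeasure \<sigma> {..<r} * h (y * r) * indicator {0<..<1} r \<partial>lborel)"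
      proof (rule nn_integral_cong_AE, use AE_lborel_singleton[of "1::real"] in eventually_elim)
        case (elim v)
        have "(\<integral>\<^sup>+r. ennreal y * ((if r < v \<and> v \<le> 1 then 1 else 0) * h (y * v)) \<partial>\<sigma>)
           = (\<integral>\<^sup>+r. (ennreal y * (if v \<le> 1 then 1 else 0) * h (y * v)) * indicator {..<v} r \<partial>\<sigma>)"
          by (intro nn_integral_cong) (auto simp: indicator_def)
        also have "\<dots> = (ennreal y * (if v \<le> 1 then 1 else 0) * h (y * v)) * emeasure \<sigma> {..<v}"
          by (rule nn_integral_cmult_indicator) (simp add: sig)
        also have "\<dots> = ennreal y * emeasure \<sigma> {..<v} * h (y * v) * indicator {0<..<1} v"
        proof (cases "0 < v")
          case False
          have "emeasure \<sigma> {..<v} = emeasure \<sigma> {}"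
            by (rule emeasure_eq_AE) (use sig01 False in \<open>auto simp: sig elim!: eventually_mono\<close>)
          then show ?thesis by simp
        qed (use elim in \<open>auto simp: indicator_def mult_ac\<close>)
        finally show ?case .
      qed
    qed
    finally show ?thesis .
  qed
  show ?thesis by (rule that[OF K K_sets Kpos main])
qed

section \<open>Changes of variables on open intervals\<close>

lemma nn_integral_incseq_sets:
  fixes f :: "real \<Rightarrow> ennreal"
  assumes [measurable]: "f \<in> borel_measurable borel" and A: "\<And>n. A n \<in> sets borel" "incseq A"
  shows "(\<integral>\<^sup>+x. f x * indicator (\<Union>n. A n) x \<partial>lborel) = (SUP n. \<integral>\<^sup>+x. f x * indicator (A n) x \<partial>lborel)"
proof -
  have [measurable]: "A n \<in> sets borel" for n by (rule A)
  have "emeasure (density lborel f) (\<Union>n. A n) = (SUP n. emeasure (density lborel f) (A n))"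
    using A by (intro SUP_emeasure_incseq[symmetric]) auto
  then show ?thesis by (simp add: emeasure_density)
qed

text \<open>Substitution on compact intervals, passed to an increasing union. The unions matter
  because the maps used here, r^\<alpha> near 0 and exp on the whole line, have no continuous
  derivative up to the ends of a compact interval.\<close>

lemma nn_integral_substitution_incseq:
  fixes f :: "real \<Rightarrow> ennreal" and a b :: "nat \<Rightarrow> real"
  assumes f [measurable]: "f \<in> borel_measurable borel"
    and der: "\<And>n x. x \<in> {a n..b n} \<Longrightarrow> (g has_real_derivative g' x) (at x)"
    and cont: "\<And>n. continuous_on {a n..b n} g'"
    and nonneg: "\<And>n x. x \<in> {a n..b n} \<Longrightarrow> 0 \<le> g' x"
    and ab: "\<And>n. a n < b n" "incseq (\<lambda>n. {a n..b n})" "incseq (\<lambda>n. {g (a n)..g (b n)})"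
    and meas [measurable]: "g \<in> borel_measurable borel" "g' \<in> borel_measurable borel"
  shows "(\<integral>\<^sup>+x. f x * indicator (\<Union>n. {g (a n)..g (b n)}) x \<partial>lborel)
    = (\<integral>\<^sup>+x. f (g x) * ennreal (g' x) * indicator (\<Union>n. {a n..b n}) x \<partial>lborel)"
proof -
  have "(\<integral>\<^sup>+x. f x * indicator {g (a n)..g (b n)} x \<partial>lborel)
      = (\<integral>\<^sup>+x. f (g x) * ennreal (g' x) * indicator {a n..b n} x \<partial>lborel)" for n
    by (rule nn_integral_substitution_aux[OF f]) (use der cont nonneg ab(1) in auto)
  moreover have "(\<integral>\<^sup>+x. f x * indicator (\<Union>n. {g (a n)..g (b n)}) x \<partial>lborel)
      = (SUP n. \<integral>\<^sup>+x. f x * indicator {g (a n)..g (b n)} x \<partial>lborel)"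
    by (rule nn_integral_incseq_sets) (use ab in auto)
  moreover have "(\<integral>\<^sup>+x. f (g x) * ennreal (g' x) * indicator (\<Union>n. {a n..b n}) x \<partial>lborel)
      = (SUP n. \<integral>\<^sup>+x. f (g x) * ennreal (g' x) * indicator {a n..b n} x \<partial>lborel)"
    by (rule nn_integral_incseq_sets) (use ab in auto)
  ultimately show ?thesis by simp
qed

lemma nn_integral_powr_substitution:
  fixes g :: "real \<Rightarrow> ennreal"
  assumes \<alpha>: "0 < \<alpha>" and g [measurable]: "g \<in> borel_measurable borel"
  shows "(\<integral>\<^sup>+r. g r * indicator {0<..<1} r \<partial>lborel)
    = (\<integral>\<^sup>+r. g (r powr \<alpha>) * ennreal (\<alpha> * r powr (\<alpha> - 1)) * indicator {0<..<1} r \<partial>lborel)"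
proof -
  \<comment> \<open>The shift by 3 makes every interval nondegenerate: already 1/3 < 1 -
    1/3.\<close>
  define a where "a n = 1 / real (n + 3)" for n
  have a: "0 < a n" "a n < 1 - a n" "a (Suc n) \<le> a n" for n by (auto simp: a_def field_simps)
  have a0: "a \<longlonglongrightarrow> 0"
    unfolding a_def using LIMSEQ_ignore_initial_segment[OF lim_1_over_n[where 'a = real], of 3] by simp
  have ex: "\<exists>n. x \<in> {a n..1 - a n}" if "0 < x" "x < 1" for x
  proof -
    have "eventually (\<lambda>n. a n < x \<and> a n < 1 - x) sequentially"
      using that by (intro eventually_conj order_tendstoD(2)[OF a0]) auto
    then show ?thesis by (auto dest!: eventually_happens intro: less_imp_le)
  qed
  have U: "(\<Union>n. {a n..1 - a n}) = {0<..<1}"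
  proof (intro equalityI subsetI)
    fix x assume "x \<in> (\<Union>n. {a n..1 - a n})"
    then obtain n where "a n \<le> x" "x \<le> 1 - a n" by auto
    then show "x \<in> {0<..<1}" using a(1)[of n] by simp
  qed (use ex in auto)
  have lt1: "(1 - a n) powr \<alpha> < 1" for n using a[of n] \<alpha> by (subst powr01_less_one) auto
  have U': "(\<Union>n. {a n powr \<alpha>..(1 - a n) powr \<alpha>}) = {0<..<1}"
  proof (intro equalityI subsetI)
    fix x :: real assume x: "x \<in> {0<..<1}"
    then have "0 < x powr (1 / \<alpha>)" "x powr (1 / \<alpha>) < 1" using \<alpha> by (auto simp: powr01_less_one)
    from ex[OF this] obtain n where n: "a n \<le> x powr (1 / \<alpha>)" "x powr (1 / \<alpha>) \<le> 1 - a n" by auto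
    have "a n powr \<alpha> \<le> (x powr (1 / \<alpha>)) powr \<alpha>" "(x powr (1 / \<alpha>)) powr \<alpha> \<le> (1 - a n) powr \<alpha>"
      using n a(1)[of n] \<alpha> by (auto intro!: powr_mono2)
    then show "x \<in> (\<Union>n. {a n powr \<alpha>..(1 - a n) powr \<alpha>})" using x \<alpha> by (auto simp: powr_powr)
  next
    fix x assume "x \<in> (\<Union>n. {a n powr \<alpha>..(1 - a n) powr \<alpha>})"
    then obtain n where "a n powr \<alpha> \<le> x" "x \<le> (1 - a n) powr \<alpha>" by auto
    moreover have "0 < a n powr \<alpha>" using a(1)[of n] by simp
    ultimately show "x \<in> {0<..<1}" using lt1[of n] by (simp del: powr_gt_zero)
  qed
  have "(\<integral>\<^sup>+r. g r * indicator (\<Union>n. {a n powr \<alpha>..(1 - a n) powr \<alpha>}) r \<partial>lborel)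
    = (\<integral>\<^sup>+r. g (r powr \<alpha>) * ennreal (\<alpha> * r powr (\<alpha> - 1)) * indicator (\<Union>n. {a n..1 - a n}) r \<partial>lborel)"
  proof (rule nn_integral_substitution_incseq)
    show "((\<lambda>r. r powr \<alpha>) has_real_derivative \<alpha> * x powr (\<alpha> - 1)) (at x)" if "x \<in> {a n..1 - a n}" for x n
      using that a(1)[of n] by (intro has_real_derivative_powr) auto
    show "continuous_on {a n..1 - a n} (\<lambda>x. \<alpha> * x powr (\<alpha> - 1))" for n
      using a(1)[of n] by (auto intro!: continuous_intros)
    show "incseq (\<lambda>n. {a n..1 - a n})" using a by (intro incseq_SucI) (simp add: a(3))
    show "incseq (\<lambda>n. {a n powr \<alpha>..(1 - a n) powr \<alpha>})"
    proof (intro incseq_SucI)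
      fix n
      have "a (Suc n) powr \<alpha> \<le> a n powr \<alpha>" "(1 - a n) powr \<alpha> \<le> (1 - a (Suc n)) powr \<alpha>"
        using a[of n] a[of "Suc n"] \<alpha> by (auto intro!: powr_mono2)
      then show "{a n powr \<alpha>..(1 - a n) powr \<alpha>} \<subseteq> {a (Suc n) powr \<alpha>..(1 - a (Suc n)) powr \<alpha>}" by auto
    qed
  qed (use a \<alpha> in auto)
  then show ?thesis unfolding U U' .
qed

text \<open>A point r of \<mu> stands for a jump of size -ln r, so the contraction factor is
  r^\<alpha> and \<sigma> is the image of \<mu> on (0,1) under r^\<alpha>. Since r^\<alpha> is
  increasing, the tail of \<sigma> at r^\<alpha> is \<open>m r\<close>; substituting r^\<alpha> for
  the integration variable gives the stated form.\<close>

lemma bounded_levy_perpetuity_exists: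
  fixes \<mu> :: "real measure" and \<alpha> l :: real and m :: "real \<Rightarrow> real"
  assumes \<alpha>: "0 < \<alpha>" and l: "0 < l" and mu: "sets \<mu> = sets borel"
    and m: "\<And>r. 0 < r \<Longrightarrow> r < 1 \<Longrightarrow> emeasure \<mu> {0<..<r} = ennreal (m r)"
    and total: "emeasure \<mu> {0<..<1} = ennreal l"
  obtains K :: "real measure" where "prob_space K" "sets K = sets borel" "AE y in K. 0 < y"
    "\<And>h. h \<in> borel_measurable borel \<Longrightarrow>
       (\<integral>\<^sup>+y. h y \<partial>K) =
       (\<integral>\<^sup>+y. \<integral>\<^sup>+r. ennreal y * (ennreal (m r) * (ennreal (\<alpha> * r powr (\<alpha> - 1)) * h (y * r powr \<alpha>)))
          * indicator {0<..<1} r \<partial>lborel \<partial>K)"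
proof -
  have mu_sets [measurable_cong]: "sets \<mu> = sets borel" by fact
  define N where "N = density \<mu> (indicator {0<..<1})"
  have N_sets [measurable_cong]: "sets N = sets borel" by (simp add: N_def mu)
  define \<sigma> where "\<sigma> = distr N borel (\<lambda>r. r powr \<alpha>)"
  have sig_sets [measurable_cong]: "sets \<sigma> = sets borel" by (simp add: \<sigma>_def)
  have sigma_eq: "emeasure \<sigma> A = emeasure \<mu> ({0<..<1} \<inter> (\<lambda>r. r powr \<alpha>) -` A)" if A: "A \<in> sets borel" for A
  proof -
    have [measurable]: "(\<lambda>r. r powr \<alpha>) -` A \<in> sets borel"
      using measurable_sets[of "\<lambda>r::real. r powr \<alpha>" borel borel A] A by simp
    have "emeasure \<sigma> A = emeasure N ((\<lambda>r. r powr \<alpha>) -` A)"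
      unfolding \<sigma>_def using A sets_eq_imp_space_eq[OF N_sets] by (subst emeasure_distr) auto
    also have "\<dots> = (\<integral>\<^sup>+r. indicator {0<..<1} r * indicator ((\<lambda>r. r powr \<alpha>) -` A) r \<partial>\<mu>)"
      unfolding N_def by (subst emeasure_density) auto
    also have "\<dots> = (\<integral>\<^sup>+r. indicator ({0<..<1} \<inter> (\<lambda>r. r powr \<alpha>) -` A) r \<partial>\<mu>)"
      by (intro nn_integral_cong) (auto simp: indicator_def)
    finally show ?thesis by simp
  qed
  have tot: "emeasure \<sigma> UNIV = ennreal l" by (subst sigma_eq) (auto simp: total)
  have ae: "AE r in \<sigma>. 0 < r \<and> r < 1"
    unfolding \<sigma>_def
  proof (subst AE_distr_iff)
    show "AE r in N. 0 < r powr \<alpha> \<and> r powr \<alpha> < 1"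
      unfolding N_def using \<alpha>
      by (subst AE_density, measurable) (auto simp: indicator_def powr01_less_one)
  qed measurable
  obtain K :: "real measure" where K: "prob_space K" "sets K = sets borel" "AE y in K. 0 < y"
    and law: "\<And>h. h \<in> borel_measurable borel \<Longrightarrow>
       (\<integral>\<^sup>+y. h y \<partial>K) =
       (\<integral>\<^sup>+y. \<integral>\<^sup>+r. ennreal y * emeasure \<sigma> {..<r} * h (y * r) * indicator {0<..<1} r \<partial>lborel \<partial>K)"
    by (rule perpetuity_exponential_exists[OF l sig_sets tot ae], rule that)
  have space_sig: "space \<sigma> = UNIV" using sets_eq_imp_space_eq[OF sig_sets] by simp
  interpret sig: finite_measure \<sigma> by (rule finite_measureI) (simp add: tot space_sig)
  have tail_meas [measurable]: "(\<lambda>r. emeasure \<sigma> {..<r}) \<in> borel_measurable borel"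
  proof -
    have "emeasure \<sigma> {..<r} = (\<integral>\<^sup>+s. (if s < r then 1 else 0) \<partial>\<sigma>)" for r
    proof -
      have "emeasure \<sigma> {..<r} = (\<integral>\<^sup>+s. indicator {..<r} s \<partial>\<sigma>)" by (simp add: sig_sets)
      also have "\<dots> = (\<integral>\<^sup>+s. (if s < r then 1 else 0) \<partial>\<sigma>)"
        by (intro nn_integral_cong) (auto simp: indicator_def)
      finally show ?thesis .
    qed
    then show ?thesis by simp
  qed
  have tail: "emeasure \<sigma> {..<r powr \<alpha>} = ennreal (m r)" if r: "0 < r" "r < 1" for r
  proof -
    have "{0<..<1} \<inter> (\<lambda>s. s powr \<alpha>) -` {..<r powr \<alpha>} = {0<..<r}"
      using r \<alpha> by (auto simp: powr_less_mono2) (metis less_imp_le linorder_not_less powr_mono2)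
    then show ?thesis using r by (subst sigma_eq) (auto simp: m)
  qed
  have "(\<integral>\<^sup>+y. h y \<partial>K) =
       (\<integral>\<^sup>+y. \<integral>\<^sup>+r. ennreal y * (ennreal (m r) * (ennreal (\<alpha> * r powr (\<alpha> - 1)) * h (y * r powr \<alpha>)))
          * indicator {0<..<1} r \<partial>lborel \<partial>K)" if [measurable]: "h \<in> borel_measurable borel" for h
  proof -
    have "(\<integral>\<^sup>+r. ennreal y * emeasure \<sigma> {..<r} * h (y * r) * indicator {0<..<1} r \<partial>lborel)
      = (\<integral>\<^sup>+r. ennreal y * (ennreal (m r) * (ennreal (\<alpha> * r powr (\<alpha> - 1)) * h (y * r powr \<alpha>)))
          * indicator {0<..<1} r \<partial>lborel)" for y
      by (subst nn_integral_powr_substitution[OF \<alpha>], measurable, intro nn_integral_cong)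
         (auto simp: indicator_def tail mult_ac)
    then show ?thesis unfolding law[OF that] by simp
  qed
  with K show ?thesis by (intro that)
qed

section \<open>Mellin transforms\<close>

text \<open>On a ball the mean value inequality bounds all difference quotients by \<open>g\<close>,
  so dominated convergence applies along sequences. It is stated for a general field because it
  serves both complex parameters (holomorphy) and real ones.\<close>

lemma has_field_derivative_integral_dominated:
  fixes f f' :: "'a::{real_normed_field, banach, second_countable_topology} \<Rightarrow> 'b \<Rightarrow> 'a"
  assumes \<delta>: "0 < \<delta>"
    and int: "\<And>w. w \<in> ball w0 \<delta> \<Longrightarrow> integrable M (f w)"
    and der: "AE x in M. \<forall>w\<in>ball w0 \<delta>. ((\<lambda>w. f w x) has_field_derivative f' w x) (at w)"
    and bound: "AE x in M. \<forall>w\<in>ball w0 \<delta>. norm (f' w x) \<le> g x"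
    and g: "integrable M g" and meas: "f' w0 \<in> borel_measurable M"
  shows "((\<lambda>w. integral\<^sup>L M (f w)) has_field_derivative integral\<^sup>L M (f' w0)) (at w0)"
  unfolding has_field_derivative_iff tendsto_at_iff_sequentially comp_def
proof (intro allI impI)
  fix X :: "nat \<Rightarrow> 'a"
  assume X: "\<forall>i. X i \<in> UNIV - {w0}" and lim: "X \<longlonglongrightarrow> w0"
  obtain N where N: "\<And>n. n \<ge> N \<Longrightarrow> X n \<in> ball w0 \<delta>"
    using tendstoD[OF lim \<delta>] by (auto simp: eventually_sequentially dist_commute)
  have "(\<lambda>n. \<integral>x. (f (X (n + N)) x - f w0 x) / (X (n + N) - w0) \<partial>M) \<longlonglongrightarrow> integral\<^sup>L M (f' w0)"
  proof (rule integral_dominated_convergence)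
    show "AE x in M. (\<lambda>n. (f (X (n + N)) x - f w0 x) / (X (n + N) - w0)) \<longlonglongrightarrow> f' w0 x"
      using der
    proof eventually_elim
      case (elim x)
      then have "((\<lambda>w. f w x) has_field_derivative f' w0 x) (at w0)" using \<delta> by simp
      then have "(\<lambda>n. (f (X n) x - f w0 x) / (X n - w0)) \<longlonglongrightarrow> f' w0 x"
        unfolding has_field_derivative_iff tendsto_at_iff_sequentially comp_def using X lim by blast
      then show ?case by (rule LIMSEQ_ignore_initial_segment)
    qed
    show "AE x in M. norm ((f (X (n + N)) x - f w0 x) / (X (n + N) - w0)) \<le> g x" for n
      using der bound
    proof eventually_elim
      case (elim x)
      have "norm (f (X (n + N)) x - f w0 x) \<le> g x * norm (X (n + N) - w0)"
        by (rule field_differentiable_bound[of "ball w0 \<delta>" "\<lambda>w. f w x" "\<lambda>w. f' w x"])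
           (use elim N[of "n + N"] \<delta> in \<open>auto intro: has_field_derivative_at_within\<close>)
      then show ?case using X by (simp add: norm_divide divide_le_eq)
    qed
    show "(\<lambda>x. (f (X (n + N)) x - f w0 x) / (X (n + N) - w0)) \<in> borel_measurable M" for n
      using int[OF N[of "n + N"]] int[of w0] \<delta> by (auto intro!: borel_measurable_divide borel_measurable_diff)
  qed (use g meas in auto)
  then have "(\<lambda>n. (integral\<^sup>L M (f (X (n + N))) - integral\<^sup>L M (f w0)) / (X (n + N) - w0)) \<longlonglongrightarrow> integral\<^sup>L M (f' w0)"
  proof (rule Lim_transform_eventually, intro always_eventually allI)
    fix n
    show "(\<integral>x. (f (X (n + N)) x - f w0 x) / (X (n + N) - w0) \<partial>M)
       = (integral\<^sup>L M (f (X (n + N))) - integral\<^sup>L M (f w0)) / (X (n + N) - w0)"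
      using int[OF N[of "n + N"]] int[of w0] \<delta> by (simp add: Bochner_Integration.integral_diff)
  qed
  then show "(\<lambda>n. (integral\<^sup>L M (f (X n)) - integral\<^sup>L M (f w0)) / (X n - w0)) \<longlonglongrightarrow> integral\<^sup>L M (f' w0)"
    by (rule LIMSEQ_offset)
qed

text \<open>For |w| < 1 the exponential series may be integrated termwise, the norms summing to the
  series of (n + 1) |w|^n; its value is the derivative of a geometric series. Analytic continuation
  carries the formula from the half disc to the half plane. The extra factor X, compared with the
  plain Laplace transform, is what later gives the Mellin transform on Re z < 2 instead of Re z <
  1.\<close>

lemma laplace_of_factorial_moments:
  fixes X :: "'b \<Rightarrow> real" and w :: complex
  assumes M: "finite_measure M" and X [measurable]: "X \<in> borel_measurable M" and pos: "AE x in M. 0 < X x"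
    and int: "\<And>n. integrable M (\<lambda>x. X x ^ n)" and mom: "\<And>n. (\<integral>x. X x ^ n \<partial>M) = fact n"
    and w: "0 < Re w"
  shows "(\<integral>x. of_real (X x) * exp (- w * of_real (X x)) \<partial>M) = 1 / (1 + w)\<^sup>2"
proof -
  define Q where "Q w = (\<integral>x. of_real (X x) * exp (- w * of_real (X x)) \<partial>M)" for w :: complex
  have int1: "integrable M (\<lambda>x. of_real (X x) ^ k * exp (- w * of_real (X x)))" if "0 \<le> Re w" for w :: complex and k
  proof (rule Bochner_Integration.integrable_bound[OF int[of k]])
    show "AE x in M. norm (of_real (X x) ^ k * exp (- w * of_real (X x))) \<le> norm (X x ^ k)"
      using pos that by (auto elim!: eventually_mono simp: norm_mult norm_power intro!: mult_left_le)
  qed measurable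
  have holo: "Q holomorphic_on {w. 0 < Re w}"
    unfolding holomorphic_on_def
  proof
    fix w0 :: complex assume "w0 \<in> {w. 0 < Re w}"
    then have w0: "0 < Re w0" by simp
    have Re_pos: "0 < Re w" if "w \<in> ball w0 (Re w0)" for w
    proof -
      have "Re w0 - Re w \<le> cmod (w0 - w)" using complex_Re_le_cmod[of "w0 - w"] by simp
      then show ?thesis using that by (simp add: dist_norm)
    qed
    have "((\<lambda>w. integral\<^sup>L M (\<lambda>x. of_real (X x) * exp (- w * of_real (X x)))) has_field_derivative
        integral\<^sup>L M (\<lambda>x. - (of_real (X x) ^ 2 * exp (- w0 * of_real (X x))))) (at w0)"
    proof (rule has_field_derivative_integral_dominated[OF w0])
      show "integrable M (\<lambda>x. of_real (X x) * exp (- w * of_real (X x)))" if "w \<in> ball w0 (Re w0)" for w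
        using int1[of w 1] Re_pos[OF that] by simp
      show "AE x in M. \<forall>w\<in>ball w0 (Re w0). ((\<lambda>w. of_real (X x) * exp (- w * of_real (X x)))
          has_field_derivative - (of_real (X x) ^ 2 * exp (- w * of_real (X x)))) (at w)"
        by (intro always_eventually allI ballI) (auto intro!: derivative_eq_intros simp: power2_eq_square)
      show "AE x in M. \<forall>w\<in>ball w0 (Re w0). cmod (- (of_real (X x) ^ 2 * exp (- w * of_real (X x)))) \<le> X x ^ 2"
        using pos
      proof eventually_elim
        case (elim x)
        show ?case
        proof
          fix w assume "w \<in> ball w0 (Re w0)"
          then have "exp (- (Re w * X x)) \<le> 1" using elim Re_pos by (simp add: less_imp_le)
          then show "cmod (- (of_real (X x) ^ 2 * exp (- w * of_real (X x)))) \<le> X x ^ 2"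
            by (simp add: norm_mult norm_power mult_left_le)
        qed
      qed
    qed (use int[of 2] in auto)
    then show "Q field_differentiable at w0 within {w. 0 < Re w}"
      unfolding Q_def field_differentiable_def by (blast intro: has_field_derivative_at_within)
  qed
  have series: "Q w = 1 / (1 + w)\<^sup>2" if w: "cmod w < 1" for w
  proof -
    have term_int: "integrable M (\<lambda>x. (- w) ^ n / fact n * of_real (X x ^ Suc n))" for n
      using int[of "Suc n"] by (intro integrable_mult_right integrable_of_real)
    have nrm: "(\<integral>x. norm ((- w) ^ n / fact n * of_real (X x ^ Suc n)) \<partial>M) = cmod w ^ n * real (Suc n)" for n
    proof -
      have "(\<integral>x. norm ((- w) ^ n / fact n * of_real (X x ^ Suc n)) \<partial>M)
          = (\<integral>x. cmod w ^ n / fact n * X x ^ Suc n \<partial>M)"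
      proof (rule integral_cong_AE)
        show "AE x in M. norm ((- w) ^ n / fact n * complex_of_real (X x ^ Suc n)) = cmod w ^ n / fact n * X x ^ Suc n"
          using pos by eventually_elim (simp add: norm_mult norm_power norm_divide)
      qed measurable
      also have "\<dots> = cmod w ^ n / fact n * fact (Suc n)" by (simp add: mom del: power_Suc fact_Suc)
      also have "\<dots> = cmod w ^ n * real (Suc n)" by simp
      finally show ?thesis .
    qed
    have "(\<integral>x. (\<Sum>n. (- w) ^ n / fact n * of_real (X x ^ Suc n)) \<partial>M)
        = (\<Sum>n. \<integral>x. (- w) ^ n / fact n * of_real (X x ^ Suc n) \<partial>M)"
    proof (rule integral_suminf[OF term_int])
      show "AE x in M. summable (\<lambda>n. norm ((- w) ^ n / fact n * complex_of_real (X x ^ Suc n)))"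
      proof (intro always_eventually allI)
        fix x
        have "summable (\<lambda>n. inverse (fact n) * (cmod w * \<bar>X x\<bar>) ^ n * \<bar>X x\<bar>)"
          by (intro summable_mult2 summable_exp)
        then show "summable (\<lambda>n. norm ((- w) ^ n / fact n * complex_of_real (X x ^ Suc n)))"
          by (rule summable_cong[THEN iffD1, rotated])
             (auto simp: norm_mult norm_power norm_divide power_mult_distrib field_simps)
      qed
      show "summable (\<lambda>n. \<integral>x. norm ((- w) ^ n / fact n * of_real (X x ^ Suc n)) \<partial>M)"
        unfolding nrm using geometric_deriv_sums[of "cmod w"] w by (simp add: sums_iff mult.commute)
    qed
    also have "(\<lambda>x. \<Sum>n. (- w) ^ n / fact n * complex_of_real (X x ^ Suc n))
       = (\<lambda>x. of_real (X x) * exp (- w * of_real (X x)))"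
    proof
      fix x
      have "(\<lambda>n. of_real (X x) * ((- w * of_real (X x)) ^ n /\<^sub>R fact n)) sums (of_real (X x) * exp (- w * of_real (X x)))"
        by (intro sums_mult exp_converges)
      also have "(\<lambda>n. of_real (X x) * ((- w * of_real (X x)) ^ n /\<^sub>R fact n))
          = (\<lambda>n. (- w) ^ n / fact n * complex_of_real (X x ^ Suc n))"
        by (auto simp: fun_eq_iff scaleR_conv_of_real power_mult_distrib field_simps power_minus' )
      finally show "(\<Sum>n. (- w) ^ n / fact n * complex_of_real (X x ^ Suc n)) = of_real (X x) * exp (- w * of_real (X x))"
        by (simp add: sums_iff)
    qed
    also have "(\<Sum>n. \<integral>x. (- w) ^ n / fact n * complex_of_real (X x ^ Suc n) \<partial>M) = (\<Sum>n. of_nat (Suc n) * (- w) ^ n)"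
    proof (rule suminf_cong)
      fix n
      have "(\<integral>x. (- w) ^ n / fact n * complex_of_real (X x ^ Suc n) \<partial>M) = (- w) ^ n / fact n * of_real (fact (Suc n))"
        using integral_complex_of_real[of M "\<lambda>x. X x ^ Suc n"] by (simp only: integral_mult_right_zero mom)
      then show "(\<integral>x. (- w) ^ n / fact n * complex_of_real (X x ^ Suc n) \<partial>M) = of_nat (Suc n) * (- w) ^ n"
        by (simp add: field_simps)
    qed
    also have "\<dots> = 1 / (1 - (- w))\<^sup>2" using geometric_deriv_sums[of "- w"] w by (simp add: sums_iff)
    finally show ?thesis by (simp add: Q_def)
  qed
  have "Q w = 1 / (1 + w)\<^sup>2"
  proof (rule analytic_continuation_open[of "{w. 0 < Re w} \<inter> ball 0 1" "{w. 0 < Re w}" Q "\<lambda>w. 1 / (1 + w)\<^sup>2"])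
    show "(\<lambda>w. 1 / (1 + w)\<^sup>2) holomorphic_on {w. 0 < Re w}"
      by (intro holomorphic_intros) (auto simp: add_eq_0_iff)
    show "connected {w. 0 < Re w}" by (intro convex_connected convex_halfspace_Re_gt)
    have "1 / 2 \<in> {w. 0 < Re w} \<inter> ball 0 1" by simp
    then show "{w. 0 < Re w} \<inter> ball 0 1 \<noteq> {}" by blast
  qed (use holo series w in \<open>auto intro: open_halfspace_Re_gt\<close>)
  then show ?thesis by (simp add: Q_def)
qed

section \<open>From Laplace transforms to Mellin transforms\<close>

lemma lebesgue_Gamma_integral:
  fixes z :: complex and x :: real
  assumes z: "0 < Re z" and x: "0 < x"
  shows "integrable lborel (\<lambda>w. indicator {0<..} w *\<^sub>R (complex_of_real w powr (z - 1) * of_real (exp (- (w * x)))))"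
    and "(\<integral>w. indicator {0<..} w *\<^sub>R (complex_of_real w powr (z - 1) * of_real (exp (- (w * x)))) \<partial>lborel)
           = Gamma z * of_real x powr (- z)"
proof -
  let ?f = "\<lambda>x w. indicator {0<..} w *\<^sub>R (complex_of_real w powr (z - 1) * of_real (exp (- (w * x))))"
  have meas [measurable]: "?f x \<in> borel_measurable borel" for x by measurable
  have I: "integrable lborel (?f x)" if x: "0 < x" for x
  proof -
    have "set_integrable lebesgue {0<..} (\<lambda>t. complex_of_real t powr (z - 1) / of_real (exp (x * t)))"
      using absolutely_integrable_Gamma_integral[OF z x] .
    then have "integrable lebesgue (?f x)"
      unfolding set_integrable_def by (simp add: exp_minus field_simps mult.commute[of x])
    then show ?thesis by (subst (asm) integrable_completion) auto
  qed
  show "integrable lborel (?f x)" by (rule I[OF x])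
  have base: "(\<integral>w. ?f 1 w \<partial>lborel) = Gamma z"
  proof -
    have "(?f 1 has_integral (\<integral>w. ?f 1 w \<partial>lborel)) UNIV"
      by (rule has_integral_integral_lborel[OF I]) simp
    moreover have "?f 1 = (\<lambda>t. if t \<in> {0<..} then of_real t powr (z - 1) / of_real (exp t) else 0)"
      by (auto simp: fun_eq_iff indicator_def exp_minus field_simps)
    ultimately have "((\<lambda>t. of_real t powr (z - 1) / of_real (exp t)) has_integral (\<integral>w. ?f 1 w \<partial>lborel)) {0<..}"
      by (simp only: has_integral_restrict_UNIV)
    then show ?thesis using z Gamma_integral_complex' has_integral_unique by blast
  qed
  have "(\<integral>w. ?f 1 w \<partial>lborel) = \<bar>x\<bar> *\<^sub>R (\<integral>w. ?f 1 (0 + x * w) \<partial>lborel)"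
    using x by (intro lborel_integral_real_affine) auto
  also have "(\<lambda>w. ?f 1 (0 + x * w)) = (\<lambda>w. of_real x powr (z - 1) * ?f x w)"
    using x by (auto simp: fun_eq_iff indicator_def zero_less_mult_iff powr_times_real mult_ac)
  also have "\<bar>x\<bar> *\<^sub>R (\<integral>w. of_real x powr (z - 1) * ?f x w \<partial>lborel) = of_real x powr z * (\<integral>w. ?f x w \<partial>lborel)"
    using x by (subst integral_mult_right_zero) (simp add: scaleR_conv_of_real powr_diff)
  finally show "(\<integral>w. ?f x w \<partial>lborel) = Gamma z * of_real x powr (- z)"
    using x base by (simp add: powr_minus field_simps)
qed

text \<open>Write x^(z-1) as x times x^(-(2-z)) and the latter as a Gamma integral over w. Thus the
  Mellin transform on Re z < 2 is determined by the function w to E [X e^(-w X)] on w > 0.\<close>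

lemma Gamma_times_mellin_integral:
  fixes X :: "'b \<Rightarrow> real" and z :: complex
  assumes M: "sigma_finite_measure M" and X [measurable]: "X \<in> borel_measurable M" and pos: "AE x in M. 0 < X x"
    and z: "Re z < 2" and int: "integrable M (\<lambda>x. complex_of_real (X x) powr (z - 1))"
  shows "Gamma (2 - z) * (\<integral>x. complex_of_real (X x) powr (z - 1) \<partial>M)
    = (\<integral>w. indicator {0<..} w *\<^sub>R (complex_of_real w powr (1 - z)
        * (\<integral>x. of_real (X x) * exp (- of_real w * of_real (X x)) \<partial>M)) \<partial>lborel)"
proof -
  interpret M: sigma_finite_measure M by fact
  interpret pair_sigma_finite M lborel ..
  let ?f = "\<lambda>x w. of_real (X x) * (indicator {0<..} w *\<^sub>R (complex_of_real w powr ((2 - z) - 1) * of_real (exp (- (w * X x)))))"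
  have meas [measurable]: "(\<lambda>(x, w). ?f x w) \<in> borel_measurable (M \<Otimes>\<^sub>M lborel)" by measurable
  have inner: "(\<integral>w. ?f x w \<partial>lborel) = Gamma (2 - z) * complex_of_real (X x) powr (z - 1)" if "0 < X x" for x
    using lebesgue_Gamma_integral(2)[of "2 - z" "X x"] that z
    by (subst integral_mult_right_zero) (simp add: powr_diff field_simps power2_eq_square)
  have inner_norm: "(\<integral>w. norm (?f x w) \<partial>lborel) = Gamma (2 - Re z) * norm (complex_of_real (X x) powr (z - 1))" if "0 < X x" for x
  proof -
    have "complex_of_real (\<integral>w. norm (?f x w) \<partial>lborel) = (\<integral>w. complex_of_real (norm (?f x w)) \<partial>lborel)"
      by (simp only: integral_complex_of_real)
    also have "\<dots> = (\<integral>w. of_real (X x) * (indicator {0<..} w *\<^sub>R (complex_of_real w powr (of_real (2 - Re z) - 1) * of_real (exp (- (w * X x))))) \<partial>lborel)"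
    proof (rule Bochner_Integration.integral_cong[OF refl])
      fix w
      show "complex_of_real (norm (?f x w)) = of_real (X x) * (indicator {0<..} w *\<^sub>R (complex_of_real w powr (of_real (2 - Re z) - 1) * of_real (exp (- (w * X x)))))"
        using that powr_of_real[of w "1 - Re z"]
        by (cases "0 < w") (simp_all add: norm_mult norm_powr_real_powr)
    qed
    also have "\<dots> = Gamma (of_real (2 - Re z)) * of_real (X x) powr (of_real (Re z - 1))"
      using lebesgue_Gamma_integral(2)[of "of_real (2 - Re z)" "X x"] that z
      by (subst integral_mult_right_zero) (simp add: powr_diff field_simps power2_eq_square)
    also have "\<dots> = complex_of_real (Gamma (2 - Re z) * X x powr (Re z - 1))"
      using that by (simp add: Gamma_complex_of_real[symmetric] powr_of_real[symmetric])
    also have "X x powr (Re z - 1) = norm (complex_of_real (X x) powr (z - 1))"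
      using that by (simp add: norm_powr_real_powr)
    finally show ?thesis by (simp only: of_real_eq_iff)
  qed
  have "integrable (M \<Otimes>\<^sub>M lborel) (\<lambda>(x, w). ?f x w)"
  proof (rule Fubini_integrable)
    have "integrable M (\<lambda>x. Gamma (2 - Re z) * norm (complex_of_real (X x) powr (z - 1)))"
      using int by (intro integrable_mult_right integrable_norm)
    then show "integrable M (\<lambda>x. \<integral>w. norm (case (x, w) of (x, w) \<Rightarrow> ?f x w) \<partial>lborel)"
      by (rule integrable_cong_AE_imp)
         (use pos inner_norm in \<open>auto elim!: eventually_mono simp del: norm_scaleR\<close>)
    show "AE x in M. integrable lborel (\<lambda>w. case (x, w) of (x, w) \<Rightarrow> ?f x w)"
      using pos
    proof eventually_elim
      case (elim x)
      show ?case unfolding prod.case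
        using z elim by (intro integrable_mult_right lebesgue_Gamma_integral(1)) auto
    qed
  qed measurable
  then have "(\<integral>w. \<integral>x. ?f x w \<partial>M \<partial>lborel) = (\<integral>x. \<integral>w. ?f x w \<partial>lborel \<partial>M)" by (rule Fubini_integral)
  also have "\<dots> = (\<integral>x. Gamma (2 - z) * complex_of_real (X x) powr (z - 1) \<partial>M)"
    by (rule integral_cong_AE) (use pos inner in \<open>auto elim!: eventually_mono\<close>)
  also have "\<dots> = Gamma (2 - z) * (\<integral>x. complex_of_real (X x) powr (z - 1) \<partial>M)"
    by simp
  also have "(\<integral>w. \<integral>x. ?f x w \<partial>M \<partial>lborel) = (\<integral>w. indicator {0<..} w *\<^sub>R (complex_of_real w powr (1 - z)
        * (\<integral>x. of_real (X x) * exp (- of_real w * of_real (X x)) \<partial>M)) \<partial>lborel)"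
  proof (rule Bochner_Integration.integral_cong[OF refl])
    fix w
    have "(\<lambda>x. ?f x w) = (\<lambda>x. (indicator {0<..} w *\<^sub>R complex_of_real w powr (1 - z)) * (of_real (X x) * exp (- of_real w * of_real (X x))))"
      by (auto simp: fun_eq_iff exp_of_real[symmetric])
    then show "(\<integral>x. ?f x w \<partial>M) = indicator {0<..} w *\<^sub>R (complex_of_real w powr (1 - z)
        * (\<integral>x. of_real (X x) * exp (- of_real w * of_real (X x)) \<partial>M))"
      by (simp only: integral_mult_right_zero) simp
  qed
  finally show ?thesis by simp
qed

lemma exponential_distribution_moments:
  fixes z :: complex
  defines "E \<equiv> density lborel (exponential_density 1)"
  shows "prob_space E" "AE x in E. 0 < x"
    "integrable E (\<lambda>x. x ^ n)" "(\<integral>x. x ^ n \<partial>E) = fact n"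
    "0 < Re z \<Longrightarrow> integrable E (\<lambda>x. complex_of_real x powr (z - 1))"
    "0 < Re z \<Longrightarrow> (\<integral>x. complex_of_real x powr (z - 1) \<partial>E) = Gamma z"
proof -
  show E: "prob_space E" unfolding E_def by (rule prob_space_exponential_density) simp
  show pos: "AE x in E. 0 < x"
    unfolding E_def
    by (subst AE_density, measurable, use AE_lborel_singleton[of "0::real"] in eventually_elim)
       (auto simp: exponential_density_def)
  have "(\<integral>\<^sup>+x. ennreal (x ^ n) \<partial>E) = (\<integral>\<^sup>+u. ennreal (exponential_density 1 u) * ennreal (u ^ n) \<partial>lborel)"
    unfolding E_def by (rule nn_integral_density) auto
  also have "\<dots> = (\<integral>\<^sup>+u. ennreal (erlang_density 0 1 u * u ^ n) \<partial>lborel)"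
    by (intro nn_integral_cong) (auto simp: erlang_density_def ennreal_mult'')
  also have "\<dots> = ennreal (fact n)"
    using nn_integral_erlang_ith_moment[of 1 0 n] by simp
  finally have nn: "(\<integral>\<^sup>+x. ennreal (x ^ n) \<partial>E) = ennreal (fact n)" .
  have [measurable_cong]: "sets E = sets borel" by (simp add: E_def)
  have ae: "AE x in E. 0 \<le> x ^ n" using pos by (auto elim!: eventually_mono)
  show "integrable E (\<lambda>x. x ^ n)"
    by (rule integrableI_nonneg) (use ae nn in auto)
  show "(\<integral>x. x ^ n \<partial>E) = fact n"
    by (subst integral_eq_nn_integral) (use ae nn in auto)
  assume z: "0 < Re z"
  have eq: "AE x in lborel. exponential_density 1 x *\<^sub>R complex_of_real x powr (z - 1)
      = indicator {0<..} x *\<^sub>R (complex_of_real x powr (z - 1) * of_real (exp (- (x * 1))))"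
    using AE_lborel_singleton[of "0::real"]
    by eventually_elim (auto simp: exponential_density_def indicator_def scaleR_conv_of_real)
  have "integrable lborel (\<lambda>x. exponential_density 1 x *\<^sub>R complex_of_real x powr (z - 1))"
    by (rule integrable_cong_AE_imp[OF lebesgue_Gamma_integral(1)[OF z, of 1]]) (use eq in \<open>auto simp: eq_commute\<close>)
  then show "integrable E (\<lambda>x. complex_of_real x powr (z - 1))"
    unfolding E_def by (subst integrable_density) (auto simp: exponential_density_def)
  have "(\<integral>x. complex_of_real x powr (z - 1) \<partial>E) = (\<integral>x. exponential_density 1 x *\<^sub>R complex_of_real x powr (z - 1) \<partial>lborel)"
    unfolding E_def by (subst integral_density) (auto simp: exponential_density_def)
  also have "\<dots> = (\<integral>x. indicator {0<..} x *\<^sub>R (complex_of_real x powr (z - 1) * of_real (exp (- (x * 1)))) \<partial>lborel)"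
    by (rule integral_cong_AE) (use eq in auto)
  also have "\<dots> = Gamma z" by (subst lebesgue_Gamma_integral(2)[OF z]) auto
  finally show "(\<integral>x. complex_of_real x powr (z - 1) \<partial>E) = Gamma z" .
qed

text \<open>The standard exponential law has the same moments, hence the same E [X e^(-w X)] and,
  after division by Gamma (2 - z), which has no zeros, the same Mellin transform.\<close>

lemma mellin_of_factorial_moments:
  fixes X :: "'b \<Rightarrow> real" and z :: complex
  assumes M: "finite_measure M" and X: "X \<in> borel_measurable M" and pos: "AE x in M. 0 < X x"
    and int: "\<And>n. integrable M (\<lambda>x. X x ^ n)" and mom: "\<And>n. (\<integral>x. X x ^ n \<partial>M) = fact n"
    and z: "0 < Re z" "Re z < 2" and intz: "integrable M (\<lambda>x. complex_of_real (X x) powr (z - 1))"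
  shows "(\<integral>x. complex_of_real (X x) powr (z - 1) \<partial>M) = Gamma z"
proof -
  define E where "E = density lborel (exponential_density 1)"
  note E = exponential_distribution_moments[folded E_def]
  interpret M: finite_measure M by fact
  interpret E: prob_space E by (rule E)
  have [measurable_cong]: "sets E = sets borel" by (simp add: E_def)
  have lap: "(\<integral>x. complex_of_real (X x) * exp (- of_real w * of_real (X x)) \<partial>M)
     = (\<integral>x. complex_of_real x * exp (- of_real w * of_real x) \<partial>E)" if "0 < w" for w :: real
    using laplace_of_factorial_moments[OF M X pos int mom, of "of_real w"]
      laplace_of_factorial_moments[of E "\<lambda>x. x" "of_real w"] E.finite_measure_axioms E that by simp
  have "Gamma (2 - z) * (\<integral>x. complex_of_real (X x) powr (z - 1) \<partial>M)
      = Gamma (2 - z) * (\<integral>x. complex_of_real x powr (z - 1) \<partial>E)"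
    unfolding Gamma_times_mellin_integral[OF M.sigma_finite_measure_axioms X pos z(2) intz]
    by (subst Gamma_times_mellin_integral[of E "\<lambda>x. x"])
       (use z E E.sigma_finite_measure_axioms lap in \<open>auto simp: indicator_def intro!: Bochner_Integration.integral_cong\<close>)
  moreover have "Gamma (2 - z) \<noteq> 0"
  proof
    assume "Gamma (2 - z) = 0"
    then obtain n where "2 - z = of_int n" "n \<le> 0" by (auto simp: Gamma_eq_zero_iff elim!: nonpos_Ints_cases)
    then have "Re (2 - z) \<le> 0" by simp
    then show False using z by simp
  qed
  ultimately show ?thesis using E(6)[OF z(1)] by simp
qed

section \<open>Fourier inversion, and Mellin inversion of the exponential function\<close>

lemma density_exp_distr:
  "distr (density lborel (\<lambda>v. ennreal (exp v))) borel exp = density lborel (indicator {0<..})"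
proof (rule measure_eqI)
  fix A :: "real set" assume "A \<in> sets (distr (density lborel (\<lambda>v. ennreal (exp v))) borel exp)"
  then have A [measurable]: "A \<in> sets borel" by simp
  have U: "(\<Union>n. {- real (Suc n)..real (Suc n)}) = UNIV"
  proof (intro equalityI subsetI)
    fix x :: real
    obtain n where "\<bar>x\<bar> \<le> real n" using real_arch_simple by blast
    then show "x \<in> (\<Union>n. {- real (Suc n)..real (Suc n)})" by (intro UN_I[of n]) auto
  qed simp
  have U': "(\<Union>n. {exp (- real (Suc n))..exp (real (Suc n))}) = {0<..}"
  proof (intro equalityI subsetI)
    fix x :: real assume x: "x \<in> {0<..}"
    obtain n where "ln x \<in> {- real (Suc n)..real (Suc n)}" using U by blast
    then have "exp (- real (Suc n)) \<le> exp (ln x)" "exp (ln x) \<le> exp (real (Suc n))" by auto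
    then have "x \<in> {exp (- real (Suc n))..exp (real (Suc n))}"
      using x by (simp only: exp_ln atLeastAtMost_iff greaterThan_iff)
    then show "x \<in> (\<Union>n. {exp (- real (Suc n))..exp (real (Suc n))})" by blast
  qed (auto intro: order.strict_trans2[OF exp_gt_zero])
  have "(\<integral>\<^sup>+x. indicator A x * indicator (\<Union>n. {exp (- real (Suc n))..exp (real (Suc n))}) x \<partial>lborel)
      = (\<integral>\<^sup>+x. indicator A (exp x) * ennreal (exp x) * indicator (\<Union>n. {- real (Suc n)..real (Suc n)}) x \<partial>lborel)"
    by (rule nn_integral_substitution_incseq)
       (auto intro!: derivative_eq_intros continuous_intros simp: incseq_def)
  then have "(\<integral>\<^sup>+x. indicator A x * indicator {0<..} x \<partial>lborel) = (\<integral>\<^sup>+x. indicator A (exp x) * ennreal (exp x) \<partial>lborel)"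
    unfolding U U' by simp
  moreover have "emeasure (distr (density lborel (\<lambda>v. ennreal (exp v))) borel exp) A
      = (\<integral>\<^sup>+x. indicator A (exp x) * ennreal (exp x) \<partial>lborel)"
  proof -
    have "emeasure (distr (density lborel (\<lambda>v. ennreal (exp v))) borel exp) A
      = (\<integral>\<^sup>+x. indicator A x \<partial>distr (density lborel (\<lambda>v. ennreal (exp v))) borel exp)" by simp
    also have "\<dots> = (\<integral>\<^sup>+x. ennreal (exp x) * indicator A (exp x) \<partial>lborel)"
      by (subst nn_integral_distr, measurable, subst nn_integral_density) auto
    finally show ?thesis by (simp add: mult.commute)
  qed
  moreover have "emeasure (density lborel (indicator {0<..})) A = (\<integral>\<^sup>+x. indicator A x * indicator {0<..} x \<partial>lborel)"
    by (subst emeasure_density) (auto simp: mult.commute)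
  ultimately show "emeasure (distr (density lborel (\<lambda>v. ennreal (exp v))) borel exp) A
    = emeasure (density lborel (indicator {0<..})) A" by simp
qed simp

lemma lborel_integral_exp_substitution:
  fixes f :: "real \<Rightarrow> 'a::{banach, second_countable_topology}"
  assumes [measurable]: "f \<in> borel_measurable borel"
  shows "(\<integral>w. indicator {0<..} w *\<^sub>R f w \<partial>lborel) = (\<integral>v. exp v *\<^sub>R f (exp v) \<partial>lborel)"
    and "integrable lborel (\<lambda>w. indicator {0<..} w *\<^sub>R f w) \<longleftrightarrow> integrable lborel (\<lambda>v. exp v *\<^sub>R f (exp v))"
proof -
  have ind: "density lborel (indicator {0<..}) = density lborel (\<lambda>w. ennreal (indicator {0<..} (w :: real)))"
    by (intro density_cong) (auto simp: indicator_def)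
  have "(\<integral>w. indicator {0<..} w *\<^sub>R f w \<partial>lborel) = (\<integral>w. f w \<partial>density lborel (indicator {0<..}))"
    unfolding ind by (subst integral_density) auto
  also have "\<dots> = (\<integral>v. exp v *\<^sub>R f (exp v) \<partial>lborel)"
    unfolding density_exp_distr[symmetric]
    by (subst integral_distr, measurable, subst integral_density) auto
  finally show "(\<integral>w. indicator {0<..} w *\<^sub>R f w \<partial>lborel) = (\<integral>v. exp v *\<^sub>R f (exp v) \<partial>lborel)" .
  have "integrable lborel (\<lambda>w. indicator {0<..} w *\<^sub>R f w) \<longleftrightarrow> integrable (density lborel (indicator {0<..})) f"
    unfolding ind by (subst integrable_density) auto
  also have "\<dots> \<longleftrightarrow> integrable lborel (\<lambda>v. exp v *\<^sub>R f (exp v))"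
    unfolding density_exp_distr[symmetric]
    by (subst integrable_distr_eq, measurable, subst integrable_density) auto
  finally show "integrable lborel (\<lambda>w. indicator {0<..} w *\<^sub>R f w) \<longleftrightarrow> integrable lborel (\<lambda>v. exp v *\<^sub>R f (exp v))" .
qed

text \<open>This is the characteristic function of the normal distribution, rescaled by
  \<open>n\<close>. As a function of \<open>y\<close> the right side is an approximate identity of
  total mass 2 pi.\<close>

lemma fourier_gaussian:
  fixes y :: real and n :: nat
  assumes n: "0 < n"
  shows "(\<integral>s. iexp (s * y) * of_real (exp (- (s / n)\<^sup>2 / 2)) \<partial>lborel)
    = of_real (2 * pi * n * std_normal_density (n * y))"
proof -
  have "(\<integral>s. iexp (s * y) * of_real (exp (- (s / n)\<^sup>2 / 2)) \<partial>lborel)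
      = \<bar>real n\<bar> *\<^sub>R (\<integral>s. iexp ((0 + n * s) * y) * of_real (exp (- ((0 + n * s) / n)\<^sup>2 / 2)) \<partial>lborel)"
    using n by (intro lborel_integral_real_affine) auto
  also have "(\<integral>s. iexp ((0 + n * s) * y) * of_real (exp (- ((0 + n * s) / n)\<^sup>2 / 2)) \<partial>lborel)
    = (\<integral>s. of_real (sqrt (2 * pi)) * (std_normal_density s *\<^sub>R iexp (n * y * s)) \<partial>lborel)"
    using n by (intro Bochner_Integration.integral_cong)
      (auto simp: std_normal_density_def scaleR_conv_of_real mult_ac)
  also have "\<dots> = of_real (sqrt (2 * pi)) * char std_normal_distribution (n * y)"
    unfolding char_def
    by (subst integral_density) (auto simp: normal_density_nonneg simp flip: integral_mult_right_zero)
  also have "\<dots> = of_real (sqrt (2 * pi) * exp (- (n * y)\<^sup>2 / 2))"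
    by (simp add: char_std_normal_distribution)
  also have "\<bar>real n\<bar> *\<^sub>R \<dots> = of_real (2 * pi * n * std_normal_density (n * y))"
    unfolding std_normal_density_def scaleR_conv_of_real of_real_mult[symmetric] of_real_eq_iff
    using real_sqrt_mult_self[of "2 * pi"] by (simp add: field_simps del: real_sqrt_mult_self)
  finally show ?thesis .
qed

text \<open>Gaussian summation: the damped integrals \<open>I n\<close> converge to the left side
  because the transform is integrable, and by Fubini they are averages of \<open>f\<close> around
  \<open>u\<close> against a Gaussian of width 1/n, which converge to 2 pi f(u) because
  \<open>f\<close> is bounded and continuous.\<close>

lemma fourier_inversion:
  fixes f :: "real \<Rightarrow> complex"
  assumes cont: "continuous_on UNIV f" and bound: "\<And>v. norm (f v) \<le> B" and f: "integrable lborel f"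
    and F: "integrable lborel (\<lambda>s. \<integral>v. f v * iexp (s * v) \<partial>lborel)"
  shows "(\<integral>s. (\<integral>v. f v * iexp (s * v) \<partial>lborel) * iexp (- (s * u)) \<partial>lborel) = 2 * pi * f u"
proof -
  define F where "F s = (\<integral>v. f v * iexp (s * v) \<partial>lborel)" for s :: real
  have F_int: "integrable lborel F" using F by (simp add: F_def[abs_def])
  have f_meas [measurable]: "f \<in> borel_measurable borel"
    using cont by (rule borel_measurable_continuous_onI)
  define I where "I n = (\<integral>s. F s * iexp (- (s * u)) * of_real (exp (- (s / real n)\<^sup>2 / 2)) \<partial>lborel)" for n :: nat
  have lim1: "I \<longlonglongrightarrow> (\<integral>s. F s * iexp (- (s * u)) \<partial>lborel)"
    unfolding I_def
  proof (rule integral_dominated_convergence[where w = "\<lambda>s. norm (F s)"])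
    show "AE s in lborel. (\<lambda>n. F s * iexp (- (s * u)) * of_real (exp (- (s / real n)\<^sup>2 / 2))) \<longlonglongrightarrow> F s * iexp (- (s * u))"
    proof (intro always_eventually allI)
      fix s :: real
      have "(\<lambda>n. s / real n) \<longlonglongrightarrow> 0" by (intro real_tendsto_divide_at_top[OF tendsto_const] filterlim_real_sequentially)
      then have "(\<lambda>n. exp (- (s / real n)\<^sup>2 / 2)) \<longlonglongrightarrow> exp (- 0\<^sup>2 / 2)" by (intro tendsto_intros) auto
      then have "(\<lambda>n. F s * iexp (- (s * u)) * of_real (exp (- (s / real n)\<^sup>2 / 2))) \<longlonglongrightarrow> F s * iexp (- (s * u)) * of_real (exp (- 0\<^sup>2 / 2))"
        by (rule tendsto_mult[OF tendsto_const tendsto_of_real])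
      then show "(\<lambda>n. F s * iexp (- (s * u)) * of_real (exp (- (s / real n)\<^sup>2 / 2))) \<longlonglongrightarrow> F s * iexp (- (s * u))" by simp
    qed
  qed (use F_int in \<open>auto simp: norm_mult intro!: mult_left_le\<close>)
  \<comment> \<open>For n = 0 the division by 0 makes the damping factor constantly 1, so the
    Gaussian formula starts at n = 1.\<close>
  have eqI: "I n = (\<integral>w. 2 * pi * (std_normal_density w *\<^sub>R f (u + w / real n)) \<partial>lborel)" if n: "0 < n" for n
  proof -
    let ?g = "\<lambda>s v. f v * iexp (s * v) * (iexp (- (s * u)) * of_real (exp (- (s / real n)\<^sup>2 / 2)))"
    have gauss_int: "integrable lborel (\<lambda>s. exp (- (s / real n)\<^sup>2 / 2))"
    proof -
      have "integrable lborel (\<lambda>s. sqrt (2 * pi) * std_normal_density (0 + (1 / real n) * s))"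
        using n by (intro integrable_mult_right lborel_integrable_real_affine integrable_normal_density) auto
      then show ?thesis by (simp add: std_normal_density_def)
    qed
    have "integrable (lborel \<Otimes>\<^sub>M lborel) (\<lambda>(s, v). ?g s v)"
    proof (rule lborel_pair.Fubini_integrable)
      have "integrable lborel (\<lambda>s. (\<integral>v. norm (f v) \<partial>lborel) * exp (- (s / real n)\<^sup>2 / 2))"
        using gauss_int by (rule integrable_mult_right)
      then show "integrable lborel (\<lambda>s. \<integral>v. norm (case (s, v) of (s, v) \<Rightarrow> ?g s v) \<partial>lborel)"
        by (simp add: norm_mult)
      show "AE s in lborel. integrable lborel (\<lambda>v. case (s, v) of (s, v) \<Rightarrow> ?g s v)"
      proof (intro always_eventually allI)
        fix s
        show "integrable lborel (\<lambda>v. case (s, v) of (s, v) \<Rightarrow> ?g s v)"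
          by (rule Bochner_Integration.integrable_bound[OF f]) (auto simp: norm_mult intro!: mult_left_le)
      qed
    qed measurable
    then have "(\<integral>v. \<integral>s. ?g s v \<partial>lborel \<partial>lborel) = (\<integral>s. \<integral>v. ?g s v \<partial>lborel \<partial>lborel)" by (rule lborel_pair.Fubini_integral)
    moreover have "(\<integral>v. ?g s v \<partial>lborel) = F s * iexp (- (s * u)) * of_real (exp (- (s / real n)\<^sup>2 / 2))" for s
      unfolding F_def by (subst integral_mult_left_zero) (simp add: mult.assoc)
    moreover have "(\<integral>s. ?g s v \<partial>lborel) = of_real (2 * pi * n * std_normal_density (n * (v - u))) * f v" for v
    proof -
      have "(\<lambda>s. ?g s v) = (\<lambda>s. f v * (iexp (s * (v - u)) * of_real (exp (- (s / real n)\<^sup>2 / 2))))"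
        by (auto simp: fun_eq_iff exp_add[symmetric] algebra_simps)
      then show ?thesis using fourier_gaussian[OF n, of "v - u"] by (simp only: integral_mult_right_zero mult.commute)
    qed
    ultimately have "I n = (\<integral>v. of_real (2 * pi * n * std_normal_density (n * (v - u))) * f v \<partial>lborel)"
      by (simp only: I_def)
    also have "\<dots> = \<bar>1 / real n\<bar> *\<^sub>R (\<integral>w. of_real (2 * pi * n * std_normal_density (n * ((u + (1 / real n) * w) - u))) * f (u + (1 / real n) * w) \<partial>lborel)"
      using n by (intro lborel_integral_real_affine) auto
    also have "\<dots> = (\<integral>w. 2 * pi * (std_normal_density w *\<^sub>R f (u + w / real n)) \<partial>lborel)"
      using n by (subst integral_scaleR_right[symmetric]) (auto intro!: Bochner_Integration.integral_cong simp: scaleR_conv_of_real)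
    finally show ?thesis .
  qed
  have lim2: "(\<lambda>n. \<integral>w. 2 * pi * (std_normal_density w *\<^sub>R f (u + w / real n)) \<partial>lborel)
      \<longlonglongrightarrow> (\<integral>w. 2 * pi * (std_normal_density w *\<^sub>R f u) \<partial>lborel)"
  proof (rule integral_dominated_convergence[where w = "\<lambda>w. 2 * pi * (std_normal_density w * \<bar>B\<bar>)"])
    show "integrable lborel (\<lambda>w. 2 * pi * (std_normal_density w * \<bar>B\<bar>))"
      by (intro integrable_mult_right integrable_mult_left integrable_normal_density) simp
    show "AE w in lborel. (\<lambda>n. 2 * pi * (std_normal_density w *\<^sub>R f (u + w / real n))) \<longlonglongrightarrow> 2 * pi * (std_normal_density w *\<^sub>R f u)"
    proof (intro always_eventually allI tendsto_intros)
      fix w :: real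
      have "(\<lambda>n. u + w / real n) \<longlonglongrightarrow> u + 0"
        by (intro tendsto_intros real_tendsto_divide_at_top[OF tendsto_const] filterlim_real_sequentially)
      then show "(\<lambda>n. f (u + w / real n)) \<longlonglongrightarrow> f u"
        using cont by (intro isCont_tendsto_compose[of u f]) (auto simp: continuous_on_eq_continuous_at)
    qed
    show "AE w in lborel. norm (2 * pi * (std_normal_density w *\<^sub>R f (u + w / real n))) \<le> 2 * pi * (std_normal_density w * \<bar>B\<bar>)" for n
      using order_trans[OF bound abs_ge_self[of B]] by (intro always_eventually allI) (simp add: norm_mult mult_left_mono mult.commute[of "\<bar>B\<bar>"])
  qed measurable
  have "(\<integral>w. 2 * pi * (std_normal_density w *\<^sub>R f u) \<partial>lborel) = 2 * pi * f u"
    using integral_scaleR_left[of "f u" lborel std_normal_density] by (simp add: integrable_normal_density)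
  moreover have "I \<longlonglongrightarrow> (\<integral>w. 2 * pi * (std_normal_density w *\<^sub>R f u) \<partial>lborel)"
    by (rule Lim_transform_eventually[OF lim2]) (auto simp: eqI eventually_sequentially intro!: exI[of _ 1])
  ultimately show ?thesis
    using LIMSEQ_unique[OF lim1] by (simp add: F_def)
qed

lemma norm_Gamma_le:
  assumes "0 < Re z" shows "norm (Gamma z) \<le> Gamma (Re z)"
proof -
  let ?I = "\<integral>w. norm (indicator {0<..} w *\<^sub>R (complex_of_real w powr (z - 1) * of_real (exp (- (w * 1))))) \<partial>lborel"
  have "norm (Gamma z) = norm (\<integral>w. indicator {0<..} w *\<^sub>R (complex_of_real w powr (z - 1) * of_real (exp (- (w * 1)))) \<partial>lborel)"
    by (subst lebesgue_Gamma_integral(2)[OF assms]) auto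
  also have "\<dots> \<le> ?I"
    by (rule integral_norm_bound)
  finally have le: "norm (Gamma z) \<le> ?I" .
  have "complex_of_real ?I = (\<integral>w. of_real (norm (indicator {0<..} w *\<^sub>R (complex_of_real w powr (z - 1) * of_real (exp (- (w * 1)))))) \<partial>lborel)"
    by (simp only: integral_complex_of_real)
  also have "\<dots> = (\<integral>w. indicator {0<..} w *\<^sub>R (complex_of_real w powr (of_real (Re z) - 1) * of_real (exp (- (w * 1)))) \<partial>lborel)"
  proof (rule Bochner_Integration.integral_cong[OF refl])
    fix w :: real
    show "of_real (norm (indicator {0<..} w *\<^sub>R (complex_of_real w powr (z - 1) * of_real (exp (- (w * 1))))))
       = indicator {0<..} w *\<^sub>R (complex_of_real w powr (of_real (Re z) - 1) * of_real (exp (- (w * 1))))"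
      using powr_of_real[of w "Re z - 1"] by (cases "0 < w") (simp_all add: norm_mult norm_powr_real_powr)
  qed
  also have "\<dots> = of_real (Gamma (Re z))"
    using assms by (subst lebesgue_Gamma_integral(2)) (auto simp: Gamma_complex_of_real)
  finally show ?thesis using le by (simp only: of_real_eq_iff)
qed

text \<open>Two steps of the functional equation express Gamma (a + i s) as a bounded function
  divided by z (z + 1), which gives quadratic decay in s.\<close>

lemma integrable_Gamma_vertical:
  assumes a: "0 < a"
  shows "integrable lborel (\<lambda>s. Gamma (Complex a s))"
proof -
  have meas: "(\<lambda>s. Gamma (Complex a s)) \<in> borel_measurable lborel"
  proof -
    have "continuous_on ((\<lambda>s. of_real a + \<i> * of_real s) ` UNIV) (Gamma :: complex \<Rightarrow> complex)"
      using a by (intro continuous_on_Gamma) (auto elim!: nonpos_Ints_cases simp: complex_eq_iff)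
    then have "continuous_on UNIV (\<lambda>s. Gamma (of_real a + \<i> * of_real s))"
      by (rule continuous_on_compose2) (auto intro!: continuous_intros)
    then show ?thesis by (simp add: Complex_eq borel_measurable_continuous_onI)
  qed
  \<comment> \<open>Chosen so that c (1 + s^2) \<le> a^2 + s^2, the squared modulus of a + i
    s.\<close>
  define c where "c = min 1 (a\<^sup>2)"
  have c: "0 < c" using a by (simp add: c_def)
  have "integrable lborel (\<lambda>s. Gamma (a + 2) / c * inverse (1 + s\<^sup>2))"
    using integrable_inverse_1_plus_square by (simp add: set_integrable_def)
  then show ?thesis
  proof (rule Bochner_Integration.integrable_bound[OF _ meas], intro always_eventually allI)
    fix s
    let ?z = "Complex a s"
    have nz: "?z \<noteq> 0" "?z + 1 \<noteq> 0" using a by (auto simp: complex_eq_iff)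
    have "?z \<notin> \<int>\<^sub>\<le>\<^sub>0" "?z + 1 \<notin> \<int>\<^sub>\<le>\<^sub>0" using a by (auto elim!: nonpos_Ints_cases simp: complex_eq_iff)
    then have "Gamma (?z + 2) = (?z + 1) * (?z * Gamma ?z)"
      using Gamma_plus1[of ?z] Gamma_plus1[of "?z + 1"] by (simp add: add.assoc)
    then have eq: "Gamma ?z = Gamma (?z + 2) / ((?z + 1) * ?z)" using nz by simp
    have "c * (1 + s\<^sup>2) \<le> norm ?z * norm ?z"
    proof -
      have "c * (1 + s\<^sup>2) = c + c * s\<^sup>2" by (simp add: algebra_simps)
      also have "\<dots> \<le> a\<^sup>2 + 1 * s\<^sup>2" unfolding c_def by (intro add_mono mult_right_mono) auto
      finally show ?thesis by (simp add: cmod_def)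
    qed
    also have "\<dots> \<le> norm (?z + 1) * norm ?z"
      using a by (intro mult_right_mono) (auto simp: cmod_def power2_eq_square intro!: real_sqrt_le_mono mult_mono)
    finally have "norm (Gamma ?z) \<le> Gamma (a + 2) / (c * (1 + s\<^sup>2))"
      unfolding eq norm_divide norm_mult using norm_Gamma_le[of "?z + 2"] a c
      by (intro frac_le) (auto simp: add_pos_nonneg Gamma_real_pos less_imp_le)
    also have "\<dots> = Gamma (a + 2) / c * inverse (1 + s\<^sup>2)" by (simp add: divide_inverse)
    also have "\<dots> \<le> norm (Gamma (a + 2) / c * inverse (1 + s\<^sup>2))" unfolding real_norm_def by (rule abs_ge_self)
    finally show "norm (Gamma ?z) \<le> norm (Gamma (a + 2) / c * inverse (1 + s\<^sup>2))" .
  qed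
qed

text \<open>The substitution w = e^v in Euler's integral makes Gamma (a + i s) the Fourier transform
  of e^(a v - e^v); inversion at v = ln x, multiplied by x^(-a), is the claim.\<close>

lemma mellin_inversion_exp:
  assumes a: "0 < a" and x: "0 < x"
  shows "(\<integral>s. Gamma (Complex a s) * of_real x powr (- Complex a s) \<partial>lborel) = 2 * pi * of_real (exp (- x))"
proof -
  define f where "f v = complex_of_real (exp (a * v - exp v))" for v :: real
  have four: "(\<integral>v. f v * iexp (s * v) \<partial>lborel) = Gamma (Complex a s)" 
    and f_int: "integrable lborel (\<lambda>v. f v * iexp (s * v))" for s
  proof -
    let ?g = "\<lambda>w. complex_of_real w powr (Complex a s - 1) * of_real (exp (- (w * 1)))"
    have eq: "exp v *\<^sub>R ?g (exp v) = f v * iexp (s * v)" for v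
    proof -
      have "exp v *\<^sub>R ?g (exp v) = exp (of_real v) * (exp ((Complex a s - 1) * of_real v) * exp (- of_real (exp v)))"
        by (simp add: powr_def scaleR_conv_of_real exp_of_real[symmetric] Ln_of_real)
      also have "\<dots> = exp (of_real (a * v - exp v) + \<i> * of_real (s * v))"
        by (simp add: exp_add[symmetric] Complex_eq algebra_simps)
      finally show ?thesis by (simp only: f_def exp_add exp_of_real)
    qed
    have [measurable]: "?g \<in> borel_measurable borel" by measurable
    have "(\<integral>v. exp v *\<^sub>R ?g (exp v) \<partial>lborel) = Gamma (Complex a s)"
      using a lborel_integral_exp_substitution(1)[of ?g] lebesgue_Gamma_integral(2)[of "Complex a s" 1] by simp
    then show "(\<integral>v. f v * iexp (s * v) \<partial>lborel) = Gamma (Complex a s)" by (simp only: eq)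
    have "integrable lborel (\<lambda>v. exp v *\<^sub>R ?g (exp v))"
      using a lebesgue_Gamma_integral(1)[of "Complex a s" 1] lborel_integral_exp_substitution(2)[of ?g] by simp
    then show "integrable lborel (\<lambda>v. f v * iexp (s * v))" by (simp only: eq)
  qed
  \<comment> \<open>The exponent is concave with its maximum at v = ln a. Expanding around that
    point and using t \<le> e^t gives the bound.\<close>
  obtain B where B: "norm (f v) \<le> B" for v
  proof
    fix v :: real
    show "norm (f v) \<le> exp (a * ln a)"
    proof -
      have "a * v - exp v = a * ln a - a * (exp (v - ln a) - (v - ln a))"
        using a by (simp add: exp_diff algebra_simps)
      also have "\<dots> \<le> a * ln a"
      proof -
        have "v - ln a \<le> exp (v - ln a)" using exp_ge_add_one_self[of "v - ln a"] by linarith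
        then show ?thesis using a by simp
      qed
      finally show ?thesis by (simp add: f_def)
    qed
  qed
  have "(\<integral>s. (\<integral>v. f v * iexp (s * v) \<partial>lborel) * iexp (- (s * ln x)) \<partial>lborel) = 2 * pi * f (ln x)"
  proof (rule fourier_inversion[where B = B])
    show "continuous_on UNIV f" unfolding f_def by (intro continuous_intros)
    show "integrable lborel f" using f_int[of 0] by simp
    show "integrable lborel (\<lambda>s. \<integral>v. f v * iexp (s * v) \<partial>lborel)"
      unfolding four by (rule integrable_Gamma_vertical[OF a])
  qed (rule B)
  then have "(\<integral>s. Gamma (Complex a s) * iexp (- (s * ln x)) \<partial>lborel) * of_real (x powr (- a)) = 2 * pi * f (ln x) * of_real (x powr (- a))"
    unfolding four by simp
  also have "2 * pi * f (ln x) * of_real (x powr (- a)) = 2 * pi * of_real (exp (- x))"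
    using x by (simp add: f_def powr_def exp_add[symmetric] exp_diff exp_minus field_simps)
  also have "(\<integral>s. Gamma (Complex a s) * iexp (- (s * ln x)) \<partial>lborel) * of_real (x powr (- a))
     = (\<integral>s. Gamma (Complex a s) * of_real x powr (- Complex a s) \<partial>lborel)"
  proof (subst integral_mult_left_zero[symmetric], rule Bochner_Integration.integral_cong[OF refl])
    fix s
    have "of_real x powr (- Complex a s) = exp (of_real (- a * ln x) + \<i> * of_real (- (s * ln x)))"
      using x by (simp add: powr_def Ln_of_real Complex_eq algebra_simps)
    also have "\<dots> = iexp (- (s * ln x)) * of_real (x powr (- a))"
      using x by (simp add: exp_add powr_def exp_of_real[symmetric] exp_add[symmetric] add.commute)
    finally show "Gamma (Complex a s) * iexp (- (s * ln x)) * of_real (x powr (- a)) = Gamma (Complex a s) * of_real x powr (- Complex a s)"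
      by simp
  qed
  finally show ?thesis .
qed

section \<open>The law of the exponential functional\<close>

text \<open>\<open>K\<close> is the law of the exponential functional and \<open>a\<close> the
  abscissa of the Mellin-Barnes contour. The weight is a Borel function on the whole line here, a
  role taken later by \<open>m\<close> cut off outside (0,1). \<open>fin\<close> says that the
  exponent is finite at -\<alpha> a, i.e. that moments down to order -a - 1 are within reach of the
  recursion.\<close>

locale perpetuity_law =
  fixes \<alpha> a :: real and m :: "real \<Rightarrow> real" and K :: "real measure"
  assumes \<alpha>: "0 < \<alpha>" and a: "0 < a"
    and m_meas [measurable]: "m \<in> borel_measurable borel" and m_nonneg: "\<And>r. 0 \<le> m r"
    and K: "prob_space K" and K_sets [measurable_cong]: "sets K = sets borel" and K_pos: "AE y in K. 0 < y"
    and law: "\<And>h. h \<in> borel_measurable borel \<Longrightarrow>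
       (\<integral>\<^sup>+y. h y \<partial>K) =
       (\<integral>\<^sup>+y. \<integral>\<^sup>+r. ennreal y * (ennreal (m r) * (ennreal (\<alpha> * r powr (\<alpha> - 1)) * h (y * r powr \<alpha>)))
          * indicator {0<..<1} r \<partial>lborel \<partial>K)"
    and fin: "(\<integral>\<^sup>+r. ennreal (\<alpha> * m r * r powr (- (\<alpha> * a) - 1)) * indicator {0<..<1} r \<partial>lborel) < \<infinity>"
begin

interpretation K: prob_space K by (rule K)
interpretation KL: pair_sigma_finite K lborel ..

text \<open>For a driftless exponent this is psi(z) / z, in a form that also makes sense at z = 0,
  where its value is psi'(0+).\<close>

definition weight :: "complex \<Rightarrow> complex" where
  "weight z = (\<integral>r. indicator {0<..<1} r *\<^sub>R (of_real (\<alpha> * m r) * of_real r powr (of_real \<alpha> * z - 1)) \<partial>lborel)"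

definition mellin :: "complex \<Rightarrow> complex" where
  "mellin z = (\<integral>y. complex_of_real y powr (z - 1) \<partial>K)"

text \<open>Together with \<open>moment_nn\<close>, an extended-valued version for real exponents:
  the recursion between these two holds without any integrability and can therefore be used to prove
  that the moments are finite.\<close>

definition weight_nn :: "real \<Rightarrow> ennreal" where
  "weight_nn u = (\<integral>\<^sup>+r. ennreal (\<alpha> * m r * r powr (\<alpha> * u - 1)) * indicator {0<..<1} r \<partial>lborel)"

definition moment_nn :: "real \<Rightarrow> ennreal" where
  "moment_nn u = (\<integral>\<^sup>+y. ennreal (y powr (u - 1)) \<partial>K)"

lemma weight_nn_finite: "- a \<le> u \<Longrightarrow> weight_nn u < \<infinity>"
proof -
  assume "- a \<le> u"
  then have "- (\<alpha> * a) \<le> \<alpha> * u" using \<alpha> mult_left_mono[of "- a" u \<alpha>] by simp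
  then have "weight_nn u \<le> (\<integral>\<^sup>+r. ennreal (\<alpha> * m r * r powr (- (\<alpha> * a) - 1)) * indicator {0<..<1} r \<partial>lborel)"
    unfolding weight_nn_def using \<alpha> m_nonneg
    by (intro nn_integral_mono) (auto simp: indicator_def intro!: ennreal_leI mult_left_mono powr_mono')
  with fin show ?thesis by (rule order.strict_trans1[rotated])
qed

lemma moment_nn_rec: "moment_nn u = weight_nn u * moment_nn (u + 1)"
proof -
  have "moment_nn u = (\<integral>\<^sup>+y. \<integral>\<^sup>+r. ennreal y * (ennreal (m r) * (ennreal (\<alpha> * r powr (\<alpha> - 1)) *
      ennreal ((y * r powr \<alpha>) powr (u - 1)))) * indicator {0<..<1} r \<partial>lborel \<partial>K)"
    unfolding moment_nn_def by (rule law) measurable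
  also have "\<dots> = (\<integral>\<^sup>+y. \<integral>\<^sup>+r. ennreal (y powr u) * (ennreal (\<alpha> * m r * r powr (\<alpha> * u - 1)) * indicator {0<..<1} r) \<partial>lborel \<partial>K)"
  proof (rule nn_integral_cong_AE, use K_pos in eventually_elim)
    case (elim y)
    show ?case
    proof (rule nn_integral_cong)
      fix r
      have "y * (m r * (\<alpha> * r powr (\<alpha> - 1) * (y * r powr \<alpha>) powr (u - 1))) = y powr u * (\<alpha> * m r * r powr (\<alpha> * u - 1))" if "0 < r"
      proof -
        have "r powr (\<alpha> - 1) * (r powr \<alpha>) powr (u - 1) = r powr (\<alpha> * u - 1)"
          by (simp add: powr_powr powr_add[symmetric] algebra_simps)
        moreover have "y * y powr (u - 1) = y powr u" using elim by (simp add: powr_diff)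
        ultimately show ?thesis using elim that by (simp add: powr_mult mult_ac)
      qed
      then show "ennreal y * (ennreal (m r) * (ennreal (\<alpha> * r powr (\<alpha> - 1)) *
          ennreal ((y * r powr \<alpha>) powr (u - 1)))) * indicator {0<..<1} r
        = ennreal (y powr u) * (ennreal (\<alpha> * m r * r powr (\<alpha> * u - 1)) * indicator {0<..<1} r)"
        using elim \<alpha> m_nonneg[of r]
        by (auto simp: indicator_def ennreal_mult[symmetric])
    qed
  qed
  also have "\<dots> = weight_nn u * moment_nn (u + 1)"
    by (simp add: nn_integral_cmult nn_integral_multc weight_nn_def moment_nn_def mult.commute)
  finally show ?thesis .
qed

lemma moment_nn_1: "moment_nn 1 = 1"
proof -
  have "moment_nn 1 = (\<integral>\<^sup>+y. 1 \<partial>K)"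
    unfolding moment_nn_def using K_pos
    by (intro nn_integral_cong_AE) (auto elim!: eventually_mono)
  then show ?thesis by (simp add: K.emeasure_space_1)
qed

text \<open>If the integral vanished for one exponent, \<open>m\<close> would vanish almost
  everywhere on (0,1), hence the integral would vanish for all exponents, and the recursion would
  give the total mass \<open>moment_nn 1\<close> the value 0.\<close>

lemma weight_nn_pos: "0 < weight_nn u"
proof -
  have "weight_nn 0 \<noteq> 0"
  proof
    assume "weight_nn 0 = 0"
    then have "AE r in lborel. ennreal (\<alpha> * m r * r powr (\<alpha> * 0 - 1)) * indicator {0<..<1} r = 0"
      unfolding weight_nn_def by (subst (asm) nn_integral_0_iff_AE) auto
    then have "AE r in lborel. ennreal (\<alpha> * m r * r powr (\<alpha> * 1 - 1)) * indicator {0<..<1} r = 0"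
      by eventually_elim
        (use \<alpha> m_nonneg in \<open>auto simp: indicator_def ennreal_eq_0_iff mult_le_0_iff split: if_splits\<close>)
    then have "weight_nn 1 = 0"
      unfolding weight_nn_def by (subst nn_integral_0_iff_AE) auto
    then have "moment_nn 1 = 0" by (subst moment_nn_rec) simp
    then show False by (simp add: moment_nn_1)
  qed
  show ?thesis
  proof (rule ccontr)
    assume "\<not> 0 < weight_nn u"
    then have "weight_nn u = 0" by simp
    then have "AE r in lborel. ennreal (\<alpha> * m r * r powr (\<alpha> * u - 1)) * indicator {0<..<1} r = 0"
      unfolding weight_nn_def by (subst (asm) nn_integral_0_iff_AE) auto
    then have "AE r in lborel. ennreal (\<alpha> * m r * r powr (\<alpha> * 0 - 1)) * indicator {0<..<1} r = 0"
      by eventually_elim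
        (use \<alpha> m_nonneg in \<open>auto simp: indicator_def ennreal_eq_0_iff mult_le_0_iff split: if_splits\<close>)
    then have "weight_nn 0 = 0"
      unfolding weight_nn_def by (subst nn_integral_0_iff_AE) auto
    with \<open>weight_nn 0 \<noteq> 0\<close> show False ..
  qed
qed

text \<open>The recursion is read in both directions: upwards, dividing by the positive weight, it
  gives finite moments at all positive integers; these dominate every u \<ge> 1; downwards, with
  finite weights, it then reaches every exponent down to -a.\<close>

lemma moment_nn_finite: "- a \<le> u \<Longrightarrow> moment_nn u < \<infinity>"
proof -
  have nat: "moment_nn (real n + 1) < \<infinity>" for n
  proof (induction n)
    case (Suc n)
    have "weight_nn (real n + 1) * moment_nn (real n + 1 + 1) < \<infinity>"
      using Suc moment_nn_rec[of "real n + 1"] by simp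
    then show ?case using weight_nn_pos[of "real n + 1"]
      by (auto simp: ennreal_mult_less_top ennreal_mult_eq_top_iff less_top add_ac)
  qed (simp add: moment_nn_1)
  have ge: "moment_nn u < \<infinity>" if "1 \<le> u" for u
  proof -
    obtain n where n: "u - 1 \<le> real n" using real_arch_simple by blast
    have "moment_nn u \<le> (\<integral>\<^sup>+y. ennreal (y powr (1 - 1)) + ennreal (y powr ((real n + 1) - 1)) \<partial>K)"
      unfolding moment_nn_def
    proof (rule nn_integral_mono_AE, use K_pos in eventually_elim)
      case (elim y)
      have "y powr (u - 1) \<le> y powr 0 + y powr real n"
      proof (cases "1 \<le> y")
        case True
        then have "y powr (u - 1) \<le> y powr real n" using n by (intro powr_mono) auto
        then show ?thesis by (simp add: add_increasing)
      next
        case False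
        then have "y powr (u - 1) \<le> y powr 0" using elim that by (intro powr_mono') auto
        then show ?thesis by (simp add: add_increasing2)
      qed
      then show ?case by (simp add: ennreal_plus[symmetric] del: ennreal_plus)
    qed
    also have "\<dots> = moment_nn 1 + moment_nn (real n + 1)"
      unfolding moment_nn_def by (rule nn_integral_add) auto
    finally show ?thesis using nat[of n] by (simp add: moment_nn_1 order.strict_trans1)
  qed
  have "moment_nn u < \<infinity>" if "1 - real k \<le> u" "- a \<le> u" for k u
    using that
  proof (induction k arbitrary: u)
    case (Suc k)
    have "moment_nn (u + 1) < \<infinity>" using Suc by (intro Suc.IH) auto
    moreover have "weight_nn u < \<infinity>" using Suc by (intro weight_nn_finite)
    ultimately show ?case by (subst moment_nn_rec) (simp add: ennreal_mult_less_top)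
  qed (use ge in auto)
  moreover obtain k where "1 - u \<le> real k" using real_arch_simple by blast
  then have "1 - real k \<le> u" by simp
  ultimately show "- a \<le> u \<Longrightarrow> moment_nn u < \<infinity>" by blast
qed

text \<open>Applied to indicators, \<open>law\<close> exhibits \<open>K\<close> as the image, under
  (y, r) to y r^\<alpha>, of a density on the product of \<open>K\<close> and Lebesgue measure. The
  identity then passes to vector-valued integrals by transport of measure, without splitting into
  parts.\<close>

lemma law_integral:
  fixes h :: "real \<Rightarrow> 'b::{banach, second_countable_topology}"
  assumes h: "integrable K h"
  shows "(\<integral>y. h y \<partial>K) = (\<integral>y. \<integral>r. (indicator {0<..<1} r * (y * (m r * (\<alpha> * r powr (\<alpha> - 1))))) *\<^sub>R h (y * r powr \<alpha>) \<partial>lborel \<partial>K)"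
proof -
  \<comment> \<open>\<open>max 0 y\<close> makes the density nonnegative everywhere; it agrees with
    y almost everywhere under \<open>K\<close>.\<close>
  define w where "w = (\<lambda>(y :: real, r :: real). indicator {0<..<1} r * (max 0 y * (m r * (\<alpha> * r powr (\<alpha> - 1)))))"
  have w [measurable]: "w \<in> borel_measurable (K \<Otimes>\<^sub>M lborel)" unfolding w_def by measurable
  have w_nn: "0 \<le> w x" for x using \<alpha> m_nonneg by (auto simp: w_def split: prod.split)
  define T where "T = (\<lambda>(y :: real, r :: real). y * r powr \<alpha>)"
  have T [measurable]: "T \<in> borel_measurable (K \<Otimes>\<^sub>M lborel)" unfolding T_def by measurable
  have KT: "K = distr (density (K \<Otimes>\<^sub>M lborel) (\<lambda>x. ennreal (w x))) borel T"
  proof (rule measure_eqI)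
    fix A assume "A \<in> sets K"
    then have A [measurable]: "A \<in> sets borel" by (simp add: K_sets)
    have "emeasure K A = (\<integral>\<^sup>+y. indicator A y \<partial>K)" by (simp add: K_sets)
    also have "\<dots> = (\<integral>\<^sup>+y. \<integral>\<^sup>+r. ennreal y * (ennreal (m r) * (ennreal (\<alpha> * r powr (\<alpha> - 1)) * indicator A (y * r powr \<alpha>)))
          * indicator {0<..<1} r \<partial>lborel \<partial>K)" by (rule law) measurable
    also have "\<dots> = (\<integral>\<^sup>+y. \<integral>\<^sup>+r. ennreal (w (y, r)) * indicator A (T (y, r)) \<partial>lborel \<partial>K)"
      using K_pos \<alpha> m_nonneg
      by (intro nn_integral_cong_AE, elim eventually_mono, intro nn_integral_cong)
         (auto simp: w_def T_def indicator_def ennreal_mult[symmetric])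
    also have "\<dots> = (\<integral>\<^sup>+x. ennreal (w x) * indicator A (T x) \<partial>(K \<Otimes>\<^sub>M lborel))"
      by (rule lborel.nn_integral_fst) measurable
    also have "\<dots> = (\<integral>\<^sup>+x. indicator A (T x) \<partial>density (K \<Otimes>\<^sub>M lborel) (\<lambda>x. ennreal (w x)))"
      by (rule nn_integral_density[symmetric]) measurable
    also have "\<dots> = (\<integral>\<^sup>+x. indicator A x \<partial>distr (density (K \<Otimes>\<^sub>M lborel) (\<lambda>x. ennreal (w x))) borel T)"
      by (rule nn_integral_distr[symmetric]) measurable
    finally show "emeasure K A = emeasure (distr (density (K \<Otimes>\<^sub>M lborel) (\<lambda>x. ennreal (w x))) borel T) A"
      by simp
  qed (simp add: K_sets)
  have [measurable]: "h \<in> borel_measurable borel"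
    using borel_measurable_integrable[OF h] measurable_cong_sets[OF K_sets refl] by simp
  have "(\<integral>y. h y \<partial>K) = (\<integral>x. h x \<partial>distr (density (K \<Otimes>\<^sub>M lborel) (\<lambda>x. ennreal (w x))) borel T)"
    using KT by simp
  also have "\<dots> = (\<integral>x. w x *\<^sub>R h (T x) \<partial>(K \<Otimes>\<^sub>M lborel))"
    using w_nn by (subst integral_distr, measurable, subst integral_density) auto
  also have "\<dots> = (\<integral>y. \<integral>r. w (y, r) *\<^sub>R h (T (y, r)) \<partial>lborel \<partial>K)"
  proof (rule KL.integral_fst'[symmetric])
    have "integrable (distr (density (K \<Otimes>\<^sub>M lborel) (\<lambda>x. ennreal (w x))) borel T) h"
      using h KT by simp
    then show "integrable (K \<Otimes>\<^sub>M lborel) (\<lambda>x. w x *\<^sub>R h (T x))"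
      using w_nn by (subst (asm) integrable_distr_eq, measurable, subst (asm) integrable_density) auto
  qed
  also have "\<dots> = (\<integral>y. \<integral>r. (indicator {0<..<1} r * (y * (m r * (\<alpha> * r powr (\<alpha> - 1))))) *\<^sub>R h (y * r powr \<alpha>) \<partial>lborel \<partial>K)"
    by (rule integral_cong_AE, measurable)
       (use K_pos in \<open>auto elim!: eventually_mono simp: w_def T_def\<close>)
  finally show ?thesis .
qed

lemma mellin_integrable: "- a \<le> Re z \<Longrightarrow> integrable K (\<lambda>y. complex_of_real y powr (z - 1))"
proof (rule integrableI_bounded)
  assume "- a \<le> Re z"
  have "(\<integral>\<^sup>+y. ennreal (norm (complex_of_real y powr (z - 1))) \<partial>K) = moment_nn (Re z)"
    unfolding moment_nn_def using K_pos
    by (intro nn_integral_cong_AE) (auto elim!: eventually_mono simp: norm_powr_real_powr)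
  then show "(\<integral>\<^sup>+y. ennreal (norm (complex_of_real y powr (z - 1))) \<partial>K) < \<infinity>"
    using moment_nn_finite[OF \<open>- a \<le> Re z\<close>] by simp
qed measurable

lemma mellin_rec: "- a \<le> Re z \<Longrightarrow> mellin z = weight z * mellin (z + 1)"
proof -
  assume z: "- a \<le> Re z"
  have "mellin z = (\<integral>y. \<integral>r. (indicator {0<..<1} r * (y * (m r * (\<alpha> * r powr (\<alpha> - 1))))) *\<^sub>R complex_of_real (y * r powr \<alpha>) powr (z - 1) \<partial>lborel \<partial>K)"
    unfolding mellin_def by (rule law_integral[OF mellin_integrable[OF z]])
  also have "\<dots> = (\<integral>y. \<integral>r. complex_of_real y powr (z + 1 - 1) * (indicator {0<..<1} r *\<^sub>R (of_real (\<alpha> * m r) * of_real r powr (of_real \<alpha> * z - 1))) \<partial>lborel \<partial>K)"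
  proof (rule integral_cong_AE, measurable, use K_pos in eventually_elim)
    case (elim y)
    show ?case
    proof (rule Bochner_Integration.integral_cong[OF refl])
      fix r
      show "(indicator {0<..<1} r * (y * (m r * (\<alpha> * r powr (\<alpha> - 1))))) *\<^sub>R complex_of_real (y * r powr \<alpha>) powr (z - 1)
        = complex_of_real y powr (z + 1 - 1) * (indicator {0<..<1} r *\<^sub>R (of_real (\<alpha> * m r) * of_real r powr (of_real \<alpha> * z - 1)))"
      proof (cases "0 < r \<and> r < 1")
        case True
        have 1: "complex_of_real (y * r powr \<alpha>) powr (z - 1) = of_real y powr (z - 1) * of_real (r powr \<alpha>) powr (z - 1)"
          using elim True by (simp add: powr_times_real)
        have 2: "of_real (r powr \<alpha>) powr (z - 1) = complex_of_real r powr (of_real \<alpha> * (z - 1))"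
          using True by (simp add: powr_def Ln_of_real exp_of_real[symmetric] ln_powr mult_ac)
        have 3: "complex_of_real (r powr (\<alpha> - 1)) = of_real r powr (of_real \<alpha> - 1)"
          using True powr_of_real[of r "\<alpha> - 1"] by simp
        have 4: "complex_of_real r powr (of_real \<alpha> - 1) * of_real r powr (of_real \<alpha> * (z - 1)) = of_real r powr (of_real \<alpha> * z - 1)"
          by (simp add: powr_add[symmetric] algebra_simps)
        have 5: "complex_of_real y * of_real y powr (z - 1) = of_real y powr z"
          using elim by (simp add: powr_diff)
        show ?thesis
          unfolding 1 2 scaleR_conv_of_real using True by (simp add: 3 4[symmetric] 5[symmetric])
      qed auto
    qed
  qed
  also have "\<dots> = weight z * mellin (z + 1)"
    unfolding mellin_def weight_def by (simp only: integral_mult_right_zero integral_mult_left_zero mult.commute)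
  finally show ?thesis .
qed

lemma mellin_1: "mellin 1 = 1"
proof -
  have "mellin 1 = (\<integral>y. 1 \<partial>K)"
    unfolding mellin_def using K_pos by (intro integral_cong_AE) (auto elim!: eventually_mono)
  then show ?thesis by (simp add: K.prob_space)
qed

section \<open>Laplace transforms of the exponential functional: derivative, equation, series and
  contour integral\<close>

definition recip_laplace :: "real \<Rightarrow> real" where
  "recip_laplace x = (\<integral>y. exp (- (x * y)) / y \<partial>K)"

definition laplace :: "real \<Rightarrow> real" where
  "laplace x = (\<integral>y. exp (- (x * y)) \<partial>K)"

lemma mellin_of_real: "mellin (of_real u) = of_real (\<integral>y. y powr (u - 1) \<partial>K)"
proof -
  have "mellin (of_real u) = (\<integral>y. of_real (y powr (u - 1)) \<partial>K)"
    unfolding mellin_def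
  proof (rule integral_cong_AE, measurable, use K_pos in eventually_elim)
    case (elim y)
    then show ?case using powr_of_real[of y "u - 1"] by simp
  qed
  then show ?thesis by (simp only: integral_complex_of_real)
qed

lemma recip_integrable: "integrable K (\<lambda>y. 1 / y)"
proof -
  have "integrable K (\<lambda>y. norm (complex_of_real y powr (0 - 1)))"
    using a by (intro integrable_norm mellin_integrable) simp
  then show ?thesis
    by (rule integrable_cong_AE_imp)
       (use K_pos in \<open>auto elim!: eventually_mono simp: norm_powr_real_powr powr_minus_divide norm_divide\<close>)
qed

lemma recip_laplace_integrable: "0 \<le> x \<Longrightarrow> integrable K (\<lambda>y. exp (- (x * y)) / y)"
  by (rule Bochner_Integration.integrable_bound[OF recip_integrable])
     (use K_pos in \<open>auto elim!: eventually_mono intro!: divide_right_mono\<close>)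

text \<open>Differentiation cancels the factor 1/y, so the constant 1 dominates as long as the
  parameter stays positive, which the ball of radius \<open>x\<close> ensures.\<close>

lemma recip_laplace_has_derivative:
  assumes x: "0 < x"
  shows "(recip_laplace has_real_derivative - laplace x) (at x)"
proof -
  have "((\<lambda>x. integral\<^sup>L K (\<lambda>y. exp (- (x * y)) / y)) has_field_derivative integral\<^sup>L K (\<lambda>y. - exp (- (x * y)))) (at x)"
  proof (rule has_field_derivative_integral_dominated[OF x, where g = "\<lambda>_. 1"])
    show "integrable K (\<lambda>y. exp (- (w * y)) / y)" if "w \<in> ball x x" for w
      using that by (intro recip_laplace_integrable) (auto simp: dist_real_def)
    show "AE y in K. \<forall>w\<in>ball x x. ((\<lambda>w. exp (- (w * y)) / y) has_field_derivative - exp (- (w * y))) (at w)"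
      using K_pos by eventually_elim (auto intro!: derivative_eq_intros)
    show "AE y in K. \<forall>w\<in>ball x x. norm (- exp (- (w * y))) \<le> 1"
      using K_pos by eventually_elim (auto simp: dist_real_def)
  qed auto
  then show ?thesis unfolding recip_laplace_def[abs_def] laplace_def by simp
qed

text \<open>In the law applied to e^(-x y) / y, the factor y cancels the reciprocal and
  r^(\<alpha>-1) r^(-\<alpha>) leaves 1/r. The exponential is then at most 1, so Fubini rests on the
  integrability of \<alpha> m(r) / r alone.\<close>

lemma recip_laplace_eq_laplace_integral:
  assumes x: "0 \<le> x"
  shows "recip_laplace x = (\<integral>r. indicator {0<..<1} r * (\<alpha> * m r / r * laplace (x * r powr \<alpha>)) \<partial>lborel)"
    and "integrable lborel (\<lambda>r. indicator {0<..<1} r * (\<alpha> * m r / r * laplace (x * r powr \<alpha>)))"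
proof -
  let ?g = "\<lambda>r. indicator {0<..<1} r * (\<alpha> * m r / r) :: real"
  have g_int: "integrable lborel ?g"
  proof (rule integrableI_nonneg)
    have "(\<integral>\<^sup>+r. ennreal (?g r) \<partial>lborel) = weight_nn 0"
      unfolding weight_nn_def
      by (intro nn_integral_cong) (auto simp: indicator_def powr_minus_divide)
    then show "(\<integral>\<^sup>+r. ennreal (?g r) \<partial>lborel) < \<infinity>" using weight_nn_finite[of 0] a by simp
  qed (use \<alpha> m_nonneg in \<open>auto simp: indicator_def\<close>)
  have "recip_laplace x = (\<integral>y. \<integral>r. (indicator {0<..<1} r * (y * (m r * (\<alpha> * r powr (\<alpha> - 1))))) *\<^sub>R (exp (- (x * (y * r powr \<alpha>))) / (y * r powr \<alpha>)) \<partial>lborel \<partial>K)"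
    unfolding recip_laplace_def by (rule law_integral[OF recip_laplace_integrable[OF x]])
  also have "\<dots> = (\<integral>y. \<integral>r. ?g r * exp (- (x * r powr \<alpha> * y)) \<partial>lborel \<partial>K)"
  proof (rule integral_cong_AE, measurable, use K_pos in eventually_elim)
    case (elim y)
    show ?case
      using elim by (intro Bochner_Integration.integral_cong refl)
        (auto simp: indicator_def powr_diff field_simps)
  qed
  also have prod_int: "integrable (K \<Otimes>\<^sub>M lborel) (\<lambda>(y, r). ?g r * exp (- (x * r powr \<alpha> * y)))"
  proof (rule KL.Fubini_integrable)
    have bnd: "AE y in K. (\<forall>r. norm (?g r * exp (- (x * r powr \<alpha> * y))) \<le> norm (?g r))"
      using K_pos
    proof eventually_elim
      case (elim y)
      show ?case
      proof
        fix r
        have "exp (- (x * r powr \<alpha> * y)) \<le> 1" using x elim by simp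
        then show "norm (?g r * exp (- (x * r powr \<alpha> * y))) \<le> norm (?g r)"
          unfolding norm_mult[of "?g r"] by (intro mult_left_le) simp_all
      qed
    qed
    show "AE y in K. integrable lborel (\<lambda>r. case (y, r) of (y, r) \<Rightarrow> ?g r * exp (- (x * r powr \<alpha> * y)))"
      using bnd by eventually_elim
        (auto intro!: Bochner_Integration.integrable_bound[OF g_int])
    show "integrable K (\<lambda>y. \<integral>r. norm (case (y, r) of (y, r) \<Rightarrow> ?g r * exp (- (x * r powr \<alpha> * y))) \<partial>lborel)"
    proof (rule K.integrable_const_bound[where B = "\<integral>r. norm (?g r) \<partial>lborel"])
      show "AE y in K. norm (\<integral>r. norm (case (y, r) of (y, r) \<Rightarrow> ?g r * exp (- (x * r powr \<alpha> * y))) \<partial>lborel) \<le> (\<integral>r. norm (?g r) \<partial>lborel)"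
        using bnd
      proof eventually_elim
        case (elim y)
        have "(\<integral>r. norm (?g r * exp (- (x * r powr \<alpha> * y))) \<partial>lborel) \<le> (\<integral>r. norm (?g r) \<partial>lborel)"
          by (rule integral_mono'[OF integrable_norm[OF g_int]]) (use elim in auto)
        then show ?case by simp
      qed
    qed measurable
  qed measurable
  then have "(\<integral>y. \<integral>r. ?g r * exp (- (x * r powr \<alpha> * y)) \<partial>lborel \<partial>K) = (\<integral>r. \<integral>y. ?g r * exp (- (x * r powr \<alpha> * y)) \<partial>K \<partial>lborel)"
    by (rule KL.Fubini_integral[symmetric])
  also have "\<dots> = (\<integral>r. indicator {0<..<1} r * (\<alpha> * m r / r * laplace (x * r powr \<alpha>)) \<partial>lborel)"
    unfolding laplace_def by (simp add: mult.assoc)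
  finally show "recip_laplace x = (\<integral>r. indicator {0<..<1} r * (\<alpha> * m r / r * laplace (x * r powr \<alpha>)) \<partial>lborel)" .
  have "integrable lborel (\<lambda>r. \<integral>y. ?g r * exp (- (x * r powr \<alpha> * y)) \<partial>K)"
    using prod_int by (rule KL.integrable_snd)
  then show "integrable lborel (\<lambda>r. indicator {0<..<1} r * (\<alpha> * m r / r * laplace (x * r powr \<alpha>)))"
    unfolding laplace_def by (simp add: mult.assoc)
qed

text \<open>The exponential series divided by y, integrated termwise; its n-th term carries y^(n-1),
  whose mean is \<open>mellin n\<close>. The hypothesis is exactly the summability of the integrated
  norms.\<close>

lemma recip_laplace_series:
  assumes x: "0 \<le> x" and sum: "summable (\<lambda>n. x ^ n / fact n * norm (mellin (of_nat n)))"
  shows "of_real (recip_laplace x) = (\<Sum>n. (- of_real x) ^ n / fact n * mellin (of_nat n))"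
proof -
  let ?f = "\<lambda>n y. (- complex_of_real x) ^ n / fact n * of_real y powr (of_nat n - 1)"
  have int: "integrable K (?f n)" for n
    using a by (intro integrable_mult_right mellin_integrable) simp
  have nrm: "(\<integral>y. norm (?f n y) \<partial>K) = x ^ n / fact n * norm (mellin (of_nat n))" for n
  proof -
    have "(\<integral>y. norm (?f n y) \<partial>K) = (\<integral>y. x ^ n / fact n * y powr (real n - 1) \<partial>K)"
    proof (rule integral_cong_AE, measurable, use K_pos in eventually_elim)
      case (elim y)
      then show ?case using x
        by (simp add: norm_mult norm_divide norm_power norm_powr_real_powr)
    qed
    moreover have "0 \<le> (\<integral>y. y powr (real n - 1) \<partial>K)" by (intro Bochner_Integration.integral_nonneg) simp
    then have "norm (mellin (of_nat n)) = (\<integral>y. y powr (real n - 1) \<partial>K)"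
      using mellin_of_real[of "real n"] by simp
    ultimately show ?thesis by simp
  qed
  have pw: "?f n y = of_real (1 / y) * ((of_real (- (x * y))) ^ n /\<^sub>R fact n)" if "0 < y" for n y
    using that by (simp add: powr_diff powr_nat' power_mult_distrib power_minus' scaleR_conv_of_real field_simps)
  have sums_f: "(\<lambda>n. ?f n y) sums of_real (exp (- (x * y)) / y)" if "0 < y" for y
  proof -
    have "(\<lambda>n. complex_of_real (1 / y) * ((of_real (- (x * y))) ^ n /\<^sub>R fact n)) sums (of_real (1 / y) * exp (of_real (- (x * y))))"
      by (intro sums_mult exp_converges)
    moreover have "complex_of_real (1 / y) * exp (of_real (- (x * y))) = of_real (exp (- (x * y)) / y)"
      by (simp only: exp_of_real of_real_mult[symmetric]) simp
    ultimately show ?thesis using pw[OF that] by (simp only:)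
  qed
  have "(\<integral>y. (\<Sum>n. ?f n y) \<partial>K) = (\<Sum>n. \<integral>y. ?f n y \<partial>K)"
  proof (rule integral_suminf[OF int])
    show "AE y in K. summable (\<lambda>n. norm (?f n y))"
      using K_pos
    proof eventually_elim
      case (elim y)
      have "summable (\<lambda>n. norm (complex_of_real (1 / y)) * norm ((complex_of_real (- (x * y))) ^ n /\<^sub>R fact n))"
        by (intro summable_mult summable_norm_exp)
      then show ?case using pw[OF elim] by (simp only: norm_mult)
    qed
    show "summable (\<lambda>n. \<integral>y. norm (?f n y) \<partial>K)" unfolding nrm by (rule sum)
  qed
  moreover have "(\<integral>y. (\<Sum>n. ?f n y) \<partial>K) = (\<integral>y. complex_of_real (exp (- (x * y)) / y) \<partial>K)"
    by (rule integral_cong_AE, measurable)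
       (use K_pos sums_f in \<open>auto elim!: eventually_mono simp: sums_iff\<close>)
  moreover have "(\<integral>y. ?f n y \<partial>K) = (- of_real x) ^ n / fact n * mellin (of_nat n)" for n
    unfolding mellin_def by (simp only: integral_mult_right_zero)
  ultimately show ?thesis by (simp only: recip_laplace_def integral_complex_of_real)
qed

text \<open>Mellin inversion of e^(-x y), divided by y and integrated over \<open>K\<close>. On the
  contour the integrand has modulus |Gamma (a + i s)| y^(-a-1) x^(-a), a product of integrable
  functions of s and of y; the second one is the moment at the left end of the admissible
  range.\<close>

lemma recip_laplace_mellin_barnes:
  assumes x: "0 < x"
  shows "(\<integral>s. Gamma (Complex a s) * mellin (- Complex a s) * of_real x powr (- Complex a s) \<partial>lborel)
    = 2 * of_real pi * of_real (recip_laplace x)"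
proof -
  let ?f = "\<lambda>y s. Gamma (Complex a s) * complex_of_real y powr (- Complex a s - 1) * of_real x powr (- Complex a s)"
  have [measurable]: "(\<lambda>s. Gamma (Complex a s)) \<in> borel_measurable borel"
    using borel_measurable_integrable[OF integrable_Gamma_vertical[OF a]] by simp
  have [measurable]: "(\<lambda>s. Complex a s) \<in> borel_measurable borel"
    by (simp add: Complex_eq)
  have G: "integrable lborel (\<lambda>s. norm (Gamma (Complex a s)))"
    by (rule integrable_norm[OF integrable_Gamma_vertical[OF a]])
  have nrm: "norm (?f y s) = norm (Gamma (Complex a s)) * (y powr (- a - 1) * x powr (- a))" if "0 < y" for y s
    using that x by (simp add: norm_mult norm_powr_real_powr)
  have "integrable (K \<Otimes>\<^sub>M lborel) (\<lambda>(y, s). ?f y s)"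
  proof (rule KL.Fubini_integrable)
    show "AE y in K. integrable lborel (\<lambda>s. case (y, s) of (y, s) \<Rightarrow> ?f y s)"
      using K_pos
    proof eventually_elim
      case (elim y)
      have "integrable lborel (\<lambda>s. norm (Gamma (Complex a s)) * (y powr (- a - 1) * x powr (- a)))"
        using G by (rule integrable_mult_left)
      then show ?case unfolding prod.case
        by (rule Bochner_Integration.integrable_bound, measurable) (auto simp: nrm[OF elim])
    qed
    have "integrable K (\<lambda>y. norm (complex_of_real y powr (of_real (- a) - 1)) * ((\<integral>s. norm (Gamma (Complex a s)) \<partial>lborel) * x powr (- a)))"
      by (intro integrable_mult_left integrable_norm mellin_integrable) simp
    then show "integrable K (\<lambda>y. \<integral>s. norm (case (y, s) of (y, s) \<Rightarrow> ?f y s) \<partial>lborel)"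
      by (rule integrable_cong_AE_imp, measurable)
         (use K_pos in \<open>auto elim!: eventually_mono simp: nrm norm_powr_real_powr\<close>)
  qed measurable
  then have "(\<integral>s. \<integral>y. ?f y s \<partial>K \<partial>lborel) = (\<integral>y. \<integral>s. ?f y s \<partial>lborel \<partial>K)"
    by (rule KL.Fubini_integral)
  also have "\<dots> = (\<integral>y. 2 * of_real pi * complex_of_real (exp (- (x * y)) / y) \<partial>K)"
  proof (rule integral_cong_AE, measurable, use K_pos in eventually_elim)
    case (elim y)
    have "(\<lambda>s. ?f y s) = (\<lambda>s. of_real (1 / y) * (Gamma (Complex a s) * of_real (x * y) powr (- Complex a s)))"
      using elim x by (auto simp: fun_eq_iff powr_diff powr_times_real)
    then have "(\<integral>s. ?f y s \<partial>lborel) = of_real (1 / y) * (\<integral>s. Gamma (Complex a s) * of_real (x * y) powr (- Complex a s) \<partial>lborel)"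
      by (simp only: integral_mult_right_zero)
    then show ?case using mellin_inversion_exp[OF a, of "x * y"] x elim by simp
  qed
  also have "\<dots> = 2 * of_real pi * of_real (recip_laplace x)"
    unfolding recip_laplace_def by (simp only: integral_mult_right_zero integral_complex_of_real)
  also have "(\<integral>s. \<integral>y. ?f y s \<partial>K \<partial>lborel) = (\<integral>s. Gamma (Complex a s) * mellin (- Complex a s) * of_real x powr (- Complex a s) \<partial>lborel)"
    unfolding mellin_def by (simp only: integral_mult_right_zero integral_mult_left_zero)
  finally show ?thesis .
qed

text \<open>The product of independent variables with laws \<open>\<nu>\<close> and \<open>K\<close> has the moments \<open>n!\<close>, so it is exponentially distributed. This identifies \<open>W\<close> without any uniqueness theory for
  Bernstein gamma functions.\<close>

lemma mellin_pair:
  fixes \<nu> :: "real measure" and W :: "complex \<Rightarrow> complex"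
  assumes \<nu>: "sets \<nu> = sets borel" "emeasure \<nu> {..0} = 0"
    and W: "\<And>z. 0 < Re z \<Longrightarrow> integrable \<nu> (\<lambda>x. complex_of_real x powr (z - 1))"
      "\<And>z. 0 < Re z \<Longrightarrow> W z = (\<integral>x. complex_of_real x powr (z - 1) \<partial>\<nu>)"
    and W1: "W 1 = 1" and rec: "\<And>n. 0 < n \<Longrightarrow> W (of_nat n + 1) = of_nat n * weight (of_nat n) * W (of_nat n)"
    and z: "0 < Re z" "Re z < 2"
  shows "W z * mellin z = Gamma z"
proof -
  have nu_sets [measurable_cong]: "sets \<nu> = sets borel" by fact
  have pos: "AE x in \<nu>. 0 < x"
    by (rule AE_I[where N = "{..0}"]) (use \<nu> in auto)
  have fin: "finite_measure \<nu>"
  proof (rule finite_measureI)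
    have "integrable \<nu> (\<lambda>x. 1 :: complex)"
      by (rule integrable_cong_AE_imp[OF W(1)[of 1]]) (use pos in \<open>auto elim!: eventually_mono\<close>)
    then show "emeasure \<nu> (space \<nu>) \<noteq> \<infinity>" by (auto simp: integrable_iff_bounded)
  qed
  interpret \<nu>: finite_measure \<nu> by fact
  interpret nK: pair_sigma_finite \<nu> K ..
  have int: "integrable (\<nu> \<Otimes>\<^sub>M K) (\<lambda>(x, y). complex_of_real x powr (z - 1) * of_real y powr (z - 1))"
    and val: "(\<integral>(x, y). complex_of_real x powr (z - 1) * of_real y powr (z - 1) \<partial>(\<nu> \<Otimes>\<^sub>M K)) = W z * mellin z"
    if z: "0 < Re z" for z
  proof -
    have K_int: "integrable K (\<lambda>y. complex_of_real y powr (z - 1))"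
      using z a by (intro mellin_integrable) simp
    show i: "integrable (\<nu> \<Otimes>\<^sub>M K) (\<lambda>(x, y). complex_of_real x powr (z - 1) * of_real y powr (z - 1))"
    proof (rule nK.Fubini_integrable)
      show "integrable \<nu> (\<lambda>x. \<integral>y. norm (case (x, y) of (x, y) \<Rightarrow> complex_of_real x powr (z - 1) * of_real y powr (z - 1)) \<partial>K)"
        using integrable_norm[OF W(1)[OF z]] by (simp add: norm_mult)
    qed (use K_int in auto)
    have "(\<integral>(x, y). complex_of_real x powr (z - 1) * of_real y powr (z - 1) \<partial>(\<nu> \<Otimes>\<^sub>M K))
       = (\<integral>x. \<integral>y. complex_of_real x powr (z - 1) * of_real y powr (z - 1) \<partial>K \<partial>\<nu>)"
      using i by (rule nK.integral_fst[symmetric])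
    then show "(\<integral>(x, y). complex_of_real x powr (z - 1) * of_real y powr (z - 1) \<partial>(\<nu> \<Otimes>\<^sub>M K)) = W z * mellin z"
      using W(2)[OF z] by (simp add: mellin_def)
  qed
  have ppos: "AE p in \<nu> \<Otimes>\<^sub>M K. 0 < fst p \<and> 0 < snd p"
  proof (rule nK.AE_pair_measure)
    show "{p \<in> space (\<nu> \<Otimes>\<^sub>M K). 0 < fst p \<and> 0 < snd p} \<in> sets (\<nu> \<Otimes>\<^sub>M K)" by measurable
    show "AE x in \<nu>. AE y in K. 0 < fst (x, y) \<and> 0 < snd (x, y)"
      using pos
    proof eventually_elim
      case (elim x)
      show ?case using K_pos by eventually_elim (simp add: elim)
    qed
  qed
  have pw: "AE p in \<nu> \<Otimes>\<^sub>M K. (case p of (x, y) \<Rightarrow> complex_of_real x powr (z - 1) * of_real y powr (z - 1))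
      = of_real (fst p * snd p) powr (z - 1)" for z
    using ppos by eventually_elim (simp add: powr_times_real split_beta)
  \<comment> \<open>The factors \<open>weight n\<close> in the two recursions cancel, leaving the
    recursion of the factorial.\<close>
  have WM: "W (of_nat n + 1) * mellin (of_nat n + 1) = fact n" for n
  proof (induction n)
    case (Suc n)
    have "mellin (of_nat (Suc n)) = weight (of_nat (Suc n)) * mellin (of_nat (Suc n) + 1)"
      using a by (intro mellin_rec) simp
    then have "W (of_nat (Suc n) + 1) * mellin (of_nat (Suc n) + 1) = of_nat (Suc n) * (W (of_nat (Suc n)) * mellin (of_nat (Suc n)))"
      by (subst rec) simp_all
    also have "\<dots> = fact (Suc n)" using Suc by (simp add: add.commute)
    finally show ?case .
  qed (simp add: W1 mellin_1)
  have powi: "AE p in \<nu> \<Otimes>\<^sub>M K. complex_of_real ((fst p * snd p) ^ n) = of_real (fst p * snd p) powr (of_nat n + 1 - 1)" for n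
    using ppos by eventually_elim (simp add: powr_nat')
  have moms: "integrable (\<nu> \<Otimes>\<^sub>M K) (\<lambda>p. (fst p * snd p) ^ n)" "(\<integral>p. (fst p * snd p) ^ n \<partial>(\<nu> \<Otimes>\<^sub>M K)) = fact n" for n
  proof -
    have "integrable (\<nu> \<Otimes>\<^sub>M K) (\<lambda>p. complex_of_real ((fst p * snd p) ^ n))"
      by (rule integrable_cong_AE_imp[OF int[of "of_nat n + 1"]], simp, measurable)
         (use pw[of "of_nat n + 1"] powi[of n] in eventually_elim, simp)
    then show "integrable (\<nu> \<Otimes>\<^sub>M K) (\<lambda>p. (fst p * snd p) ^ n)" by (simp only: complex_of_real_integrable_eq)
    have "complex_of_real (\<integral>p. (fst p * snd p) ^ n \<partial>(\<nu> \<Otimes>\<^sub>M K)) = (\<integral>p. complex_of_real ((fst p * snd p) ^ n) \<partial>(\<nu> \<Otimes>\<^sub>M K))"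
      by (simp only: integral_complex_of_real)
    also have "\<dots> = (\<integral>(x, y). complex_of_real x powr (of_nat n + 1 - 1) * of_real y powr (of_nat n + 1 - 1) \<partial>(\<nu> \<Otimes>\<^sub>M K))"
      by (rule integral_cong_AE, measurable) (use pw[of "of_nat n + 1"] powi[of n] in eventually_elim, simp)
    also have "\<dots> = of_real (fact n)" by (subst val) (simp_all add: WM)
    finally show "(\<integral>p. (fst p * snd p) ^ n \<partial>(\<nu> \<Otimes>\<^sub>M K)) = fact n" by (simp only: of_real_eq_iff)
  qed
  have fin2: "finite_measure (\<nu> \<Otimes>\<^sub>M K)"     by (rule finite_measure_pair_measure) unfold_locales
  have "(\<integral>p. complex_of_real (fst p * snd p) powr (z - 1) \<partial>(\<nu> \<Otimes>\<^sub>M K)) = Gamma z"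
  proof (rule mellin_of_factorial_moments[OF fin2 _ _ moms z])
    show "AE p in \<nu> \<Otimes>\<^sub>M K. 0 < fst p * snd p" using ppos by eventually_elim simp
    show "integrable (\<nu> \<Otimes>\<^sub>M K) (\<lambda>p. complex_of_real (fst p * snd p) powr (z - 1))"
      by (rule integrable_cong_AE_imp[OF int[OF z(1)]], measurable) (use pw[of z] in eventually_elim, simp)
  qed measurable
  also have "(\<integral>p. complex_of_real (fst p * snd p) powr (z - 1) \<partial>(\<nu> \<Otimes>\<^sub>M K))
     = (\<integral>(x, y). complex_of_real x powr (z - 1) * of_real y powr (z - 1) \<partial>(\<nu> \<Otimes>\<^sub>M K))"
    by (rule integral_cong_AE, measurable) (use pw[of z] in eventually_elim, simp)
  finally show ?thesis using val[OF z(1)] by simp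
qed

text \<open>Both sides satisfy the same recursion, so the identity moves to the left from the strip
  0 < Re z < 2 in unit steps; the strip is wide enough for z + 1 to land in it also when Re z = 0.
  The real axis is excluded because there the poles of Gamma and of \<open>W\<close> carry default
  values.\<close>

lemma mellin_eq_Gamma_div:
  assumes base: "\<And>z. 0 < Re z \<Longrightarrow> Re z < 2 \<Longrightarrow> W z * mellin z = Gamma z"
    and rec: "\<And>z. - a \<le> Re z \<Longrightarrow> W z = W (z + 1) / (z * weight z)"
    and z: "- a \<le> Re z" "Re z < 2" "Im z \<noteq> 0"
  shows "mellin z = Gamma z / W z"
proof -
  \<comment> \<open>\<open>k\<close> bounds the number of unit steps; k = 0 is the right half of the
    plane, where \<open>W z\<close> is nonzero because Gamma is.\<close>
  have "mellin z = Gamma z / W z" if "- real k < Re z" "- a \<le> Re z" "Re z < 2" "Im z \<noteq> 0" for k z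
    using that
  proof (induction k arbitrary: z)
    case 0
    then have "z \<notin> \<int>\<^sub>\<le>\<^sub>0" by (auto elim!: nonpos_Ints_cases)
    then have "W z \<noteq> 0" using base[of z] 0 Gamma_eq_zero_iff[of z] by auto
    then show ?case using base[of z] 0 by (simp add: field_simps)
  next
    case (Suc k)
    show ?case
    proof (cases "0 < Re z")
      case False
      have z: "z \<noteq> 0" "z \<notin> \<int>\<^sub>\<le>\<^sub>0" using Suc.prems by (auto elim!: nonpos_Ints_cases)
      have IH: "mellin (z + 1) = Gamma (z + 1) / W (z + 1)" using Suc.prems False by (intro Suc.IH) auto
      have "mellin z = weight z * (Gamma (z + 1) / W (z + 1))" using mellin_rec[OF Suc.prems(2)] IH by simp
      also have "\<dots> = Gamma z * (z * weight z / W (z + 1))" using Gamma_plus1[of z] z by simp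
      also have "\<dots> = Gamma z / W z" by (subst rec) (use Suc.prems in auto)
      finally show ?thesis .
    next
      case True
      have "z \<notin> \<int>\<^sub>\<le>\<^sub>0" using Suc.prems by (auto elim!: nonpos_Ints_cases)
      then have "W z \<noteq> 0" using base[of z] Suc.prems True Gamma_eq_zero_iff[of z] by auto
      then show ?thesis using base[of z] Suc.prems True by (simp add: field_simps)
    qed
  qed
  moreover obtain k where "- Re z < real k" using reals_Archimedean2 by blast
  then have "- real k < Re z" by simp
  ultimately show ?thesis using z by blast
qed

text \<open>With psi(-\<xi>) = -\<xi> weight(-\<xi>) and Gamma(1-\<xi>) / W(1-\<xi>) = M(1-\<xi>),
  the recursion collapses these factors of the integrand, together with 1/\<xi>, to -M(-\<xi>). What
  remains is the contour integral of \<open>recip_laplace_mellin_barnes\<close>.\<close>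

lemma E_mellin_barnes_eq:
  assumes \<psi>: "\<And>z. - a \<le> Re z \<Longrightarrow> \<psi> z = z * weight z"
    and base: "\<And>z. 0 < Re z \<Longrightarrow> Re z < 2 \<Longrightarrow> W z * mellin z = Gamma z"
    and rec: "\<And>z. - a \<le> Re z \<Longrightarrow> W z = W (z + 1) / \<psi> z"
    and x: "0 < x"
  shows "E_mellin_barnes \<psi> W a (- of_real x) = of_real (recip_laplace x) / of_real (deriv_0plus \<psi>)"
proof -
  let ?g = "\<lambda>s. - (\<i> * (Gamma (Complex a s) * mellin (- Complex a s) * of_real x powr (- Complex a s)))"
  let ?h = "\<lambda>s. (let \<xi> = Complex a s in
        \<psi> (- \<xi>) / \<xi> * (Gamma \<xi> * Gamma (1 - \<xi>) / W (1 - \<xi>)) * (- (- of_real x)) powr (- \<xi>) * \<i>)"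
  have [measurable]: "(\<lambda>s. Gamma (Complex a s)) \<in> borel_measurable borel"
    using borel_measurable_integrable[OF integrable_Gamma_vertical[OF a]] by simp
  have [measurable]: "(\<lambda>s. Complex a s) \<in> borel_measurable borel"
    by (simp add: Complex_eq)
  have [measurable]: "(\<lambda>s. mellin (- Complex a s)) \<in> borel_measurable borel"
    unfolding mellin_def by measurable
  have eq: "?h s = ?g s" if "s \<noteq> 0" for s
  proof -
    have "mellin (1 - Complex a s) = Gamma (1 - Complex a s) / W (1 - Complex a s)"
    proof (rule mellin_eq_Gamma_div[OF base])
      show "W z = W (z + 1) / (z * weight z)" if "- a \<le> Re z" for z
        using rec[OF that] \<psi>[OF that] by simp
    qed (use that a in auto)
    moreover have "mellin (- Complex a s) = weight (- Complex a s) * mellin (- Complex a s + 1)"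
      by (rule mellin_rec) simp
    moreover have "Complex a s \<noteq> 0" using a by (auto simp: complex_eq_iff)
    moreover have "\<psi> (- Complex a s) = - Complex a s * weight (- Complex a s)" by (rule \<psi>) simp
    moreover have "- Complex a s + 1 = 1 - Complex a s" by simp
    ultimately show ?thesis unfolding Let_def by simp
  qed
  \<comment> \<open>\<open>W\<close> is not known to be measurable; measurability is borrowed from
    \<open>?g\<close>, which agrees off the single point s = 0 where the contour meets the real
    axis.\<close>
  have h_meas [measurable]: "?h \<in> borel_measurable lborel"
  proof (rule measurable_discrete_difference[where X = "{0}" and f = ?g])
    show "?g \<in> borel_measurable lborel" by measurable
    show "?g s = ?h s" if "s \<in> space lborel" "s \<notin> {0}" for s
      by (rule eq[symmetric]) (use that in simp)
  qed auto
  have "(\<integral>s. ?h s \<partial>lebesgue) = (\<integral>s. ?h s \<partial>lborel)" by (rule integral_completion[OF h_meas])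
  also have "\<dots> = (\<integral>s. ?g s \<partial>lborel)"
  proof (rule integral_cong_AE)
    show "AE s in lborel. ?h s = ?g s"
      using AE_lborel_singleton[of "0::real"] by (rule eventually_mono) (rule eq)
  qed measurable
  also have "\<dots> = - (\<i> * (2 * of_real pi * of_real (recip_laplace x)))"
    unfolding integral_minus integral_mult_right_zero recip_laplace_mellin_barnes[OF x] ..
  finally have I: "(\<integral>s. ?h s \<partial>lebesgue) = - (\<i> * (2 * of_real pi * of_real (recip_laplace x)))" .
  have cancel: "- (1 / d) * (1 / (2 * p * i)) * - (i * (2 * p * R)) = R / d" if "p \<noteq> 0" "i \<noteq> 0"
    for d p i R :: complex
    using that by simp
  have "E_mellin_barnes \<psi> W a (- of_real x) =
    - (1 / of_real (deriv_0plus \<psi>)) * (1 / (2 * of_real pi * \<i>)) * (\<integral>s. ?h s \<partial>lebesgue)"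
    unfolding E_mellin_barnes_def by (rule refl)
  then show ?thesis using I cancel[of "of_real pi" \<i>] by (metis complex_i_not_zero of_real_eq_0_iff pi_neq_zero)
qed

end

section \<open>Linearity, scaling and power functions\<close>

lemma set_lebesgue_integral_scale:
  fixes g :: "real \<Rightarrow> 'b::euclidean_space"
  assumes t: "0 < t"
  shows "set_integrable lebesgue {0<..<t} g \<longleftrightarrow> set_integrable lebesgue {0<..<1} (\<lambda>r. g (t * r))"
    and "(LINT r:{0<..<t}|lebesgue. g r) = t *\<^sub>R (LINT r:{0<..<1}|lebesgue. g (t * r))"
proof -
  let ?h = "\<lambda>r. indicator {0<..<t} r *\<^sub>R g r" and ?k = "\<lambda>r. indicator {0<..<1} r *\<^sub>R g (t * r)"
  have ind: "indicator {0<..<t} (t * r) = (indicator {0<..<1} r :: real)" for r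
    using t by (auto simp: indicator_def zero_less_mult_iff)
  have hk: "?h (t * r) = ?k r" for r unfolding ind ..
  show "set_integrable lebesgue {0<..<t} g \<longleftrightarrow> set_integrable lebesgue {0<..<1} (\<lambda>r. g (t * r))"
    using lebesgue_integrable_real_affine_iff[of t ?h 0] t unfolding set_integrable_def hk add_0 by simp
  show "(LINT r:{0<..<t}|lebesgue. g r) = t *\<^sub>R (LINT r:{0<..<1}|lebesgue. g (t * r))"
    using lebesgue_integral_real_affine[of t ?h 0] t unfolding set_lebesgue_integral_def hk add_0 by simp
qed

text \<open>Substituting t r for r moves the integral of the operator to (0,1), where the weight no
  longer depends on \<open>t\<close>.\<close>

lemma weighted_derivative_scale:
  fixes f :: "real \<Rightarrow> complex"
  assumes t: "0 < t"
  shows "set_integrable lebesgue {0<..<t} (\<lambda>r. f r * of_real (m (r / t)))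
      \<longleftrightarrow> set_integrable lebesgue {0<..<1} (\<lambda>r. f (t * r) * of_real (m r))"
    and "(LINT r:{0<..<t}|lebesgue. f r * of_real (m (r / t)))
      = of_real t * (LINT r:{0<..<1}|lebesgue. f (t * r) * of_real (m r))"
  using set_lebesgue_integral_scale[OF t, of "\<lambda>r. f r * of_real (m (r / t))"] t
  by (simp_all add: scaleR_conv_of_real)

lemma AC_onE:
  assumes "AC_on a c f" "0 < \<epsilon>"
  obtains \<delta> where "0 < \<delta>" "\<And>(n::nat) u v. (\<forall>i<n. a \<le> u i \<and> u i \<le> v i \<and> v i \<le> c) \<Longrightarrow>
        disjoint_family_on (\<lambda>i. {u i<..<v i}) {..<n} \<Longrightarrow> (\<Sum>i<n. v i - u i) < \<delta> \<Longrightarrow>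
        (\<Sum>i<n. norm (f (v i) - f (u i))) < \<epsilon>"
proof -
  obtain \<delta> where d: "0 < \<delta>" and *: "\<forall>(n::nat) u v. (\<forall>i<n. a \<le> u i \<and> u i \<le> v i \<and> v i \<le> c) \<longrightarrow>
        disjoint_family_on (\<lambda>i. {u i<..<v i}) {..<n} \<longrightarrow> (\<Sum>i<n. v i - u i) < \<delta> \<longrightarrow>
        (\<Sum>i<n. norm (f (v i) - f (u i))) < \<epsilon>"
    using assms(1)[unfolded AC_on_def, THEN spec, THEN mp, OF assms(2)] by (elim exE conjE)
  show ?thesis by (rule that[OF d *[THEN spec, THEN spec, THEN spec, THEN mp, THEN mp, THEN mp]])
qed

lemma AC_on_add:
  assumes "AC_on a c f" "AC_on a c g"
  shows "AC_on a c (\<lambda>t. f t + g t)"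
  unfolding AC_on_def
proof (intro allI impI)
  fix \<epsilon> :: real assume "0 < \<epsilon>"
  then have "0 < \<epsilon> / 2" by simp
  obtain \<delta>1 where d1: "0 < \<delta>1" and 1: "\<And>(n::nat) u v. (\<forall>i<n. a \<le> u i \<and> u i \<le> v i \<and> v i \<le> c) \<Longrightarrow>
        disjoint_family_on (\<lambda>i. {u i<..<v i}) {..<n} \<Longrightarrow> (\<Sum>i<n. v i - u i) < \<delta>1 \<Longrightarrow>
        (\<Sum>i<n. norm (f (v i) - f (u i))) < \<epsilon> / 2"
    by (rule AC_onE[OF assms(1) \<open>0 < \<epsilon> / 2\<close>], rule that)
  obtain \<delta>2 where d2: "0 < \<delta>2" and 2: "\<And>(n::nat) u v. (\<forall>i<n. a \<le> u i \<and> u i \<le> v i \<and> v i \<le> c) \<Longrightarrow>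
        disjoint_family_on (\<lambda>i. {u i<..<v i}) {..<n} \<Longrightarrow> (\<Sum>i<n. v i - u i) < \<delta>2 \<Longrightarrow>
        (\<Sum>i<n. norm (g (v i) - g (u i))) < \<epsilon> / 2"
    by (rule AC_onE[OF assms(2) \<open>0 < \<epsilon> / 2\<close>], rule that)
  show "\<exists>\<delta>>0. \<forall>(n::nat) u v.
        (\<forall>i<n. a \<le> u i \<and> u i \<le> v i \<and> v i \<le> c) \<longrightarrow>
        disjoint_family_on (\<lambda>i. {u i<..<v i}) {..<n} \<longrightarrow>
        (\<Sum>i<n. v i - u i) < \<delta> \<longrightarrow>
        (\<Sum>i<n. norm ((f (v i) + g (v i)) - (f (u i) + g (u i)))) < \<epsilon>"
  proof (intro exI[of _ "min \<delta>1 \<delta>2"] conjI allI impI)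
    fix n :: nat and u v
    assume *: "\<forall>i<n. a \<le> u i \<and> u i \<le> v i \<and> v i \<le> c" "disjoint_family_on (\<lambda>i. {u i<..<v i}) {..<n}"
      "(\<Sum>i<n. v i - u i) < min \<delta>1 \<delta>2"
    have "(\<Sum>i<n. norm ((f (v i) + g (v i)) - (f (u i) + g (u i))))
        \<le> (\<Sum>i<n. norm (f (v i) - f (u i)) + norm (g (v i) - g (u i)))"
      by (intro sum_mono) (metis add_diff_add norm_triangle_ineq)
    also have "\<dots> < \<epsilon> / 2 + \<epsilon> / 2"
      unfolding sum.distrib using * by (intro add_strict_mono 1 2) auto
    finally show "(\<Sum>i<n. norm ((f (v i) + g (v i)) - (f (u i) + g (u i)))) < \<epsilon>" by simp
  qed (use d1 d2 in auto)
qed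

lemma AC_on_mult_left:
  assumes "AC_on a c f"
  shows "AC_on a c (\<lambda>t. k * f t)"
  unfolding AC_on_def
proof (intro allI impI)
  fix \<epsilon> :: real assume "0 < \<epsilon>"
  then have pos: "0 < \<epsilon> / (norm k + 1)" by (simp add: add_nonneg_pos)
  obtain \<delta> where d: "0 < \<delta>"
    and 1: "\<And>(n::nat) u v. (\<forall>i<n. a \<le> u i \<and> u i \<le> v i \<and> v i \<le> c) \<Longrightarrow>
        disjoint_family_on (\<lambda>i. {u i<..<v i}) {..<n} \<Longrightarrow> (\<Sum>i<n. v i - u i) < \<delta> \<Longrightarrow>
        (\<Sum>i<n. norm (f (v i) - f (u i))) < \<epsilon> / (norm k + 1)"
    by (rule AC_onE[OF assms pos], rule that)
  show "\<exists>\<delta>>0. \<forall>(n::nat) u v.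
        (\<forall>i<n. a \<le> u i \<and> u i \<le> v i \<and> v i \<le> c) \<longrightarrow>
        disjoint_family_on (\<lambda>i. {u i<..<v i}) {..<n} \<longrightarrow>
        (\<Sum>i<n. v i - u i) < \<delta> \<longrightarrow>
        (\<Sum>i<n. norm (k * f (v i) - k * f (u i))) < \<epsilon>"
  proof (intro exI[of _ \<delta>] conjI allI impI d)
    fix n :: nat and u v
    assume *: "\<forall>i<n. a \<le> u i \<and> u i \<le> v i \<and> v i \<le> c" "disjoint_family_on (\<lambda>i. {u i<..<v i}) {..<n}"
      "(\<Sum>i<n. v i - u i) < \<delta>"
    have "(\<Sum>i<n. norm (k * f (v i) - k * f (u i))) = norm k * (\<Sum>i<n. norm (f (v i) - f (u i)))"
      by (simp add: sum_distrib_left norm_mult[symmetric] right_diff_distrib)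
    also have "\<dots> \<le> (norm k + 1) * (\<Sum>i<n. norm (f (v i) - f (u i)))"
      by (intro mult_right_mono sum_nonneg) auto
    also have "\<dots> < \<epsilon>" using 1[OF *] by (simp add: less_divide_eq add_nonneg_pos mult.commute)
    finally show "(\<Sum>i<n. norm (k * f (v i) - k * f (u i))) < \<epsilon>" .
  qed
qed

lemma AC_on_dil:
  assumes c: "0 < c" and f: "AC_on 0 (c * t) f"
  shows "AC_on 0 t (dil c f)"
  unfolding AC_on_def
proof (intro allI impI)
  fix \<epsilon> :: real assume "0 < \<epsilon>"
  obtain \<delta> where d: "0 < \<delta>"
    and 1: "\<And>(n::nat) u v. (\<forall>i<n. 0 \<le> u i \<and> u i \<le> v i \<and> v i \<le> c * t) \<Longrightarrow>
        disjoint_family_on (\<lambda>i. {u i<..<v i}) {..<n} \<Longrightarrow> (\<Sum>i<n. v i - u i) < \<delta> \<Longrightarrow>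
        (\<Sum>i<n. norm (f (v i) - f (u i))) < \<epsilon>"
    by (rule AC_onE[OF f \<open>0 < \<epsilon>\<close>], rule that)
  show "\<exists>\<delta>>0. \<forall>(n::nat) u v.
        (\<forall>i<n. 0 \<le> u i \<and> u i \<le> v i \<and> v i \<le> t) \<longrightarrow>
        disjoint_family_on (\<lambda>i. {u i<..<v i}) {..<n} \<longrightarrow>
        (\<Sum>i<n. v i - u i) < \<delta> \<longrightarrow>
        (\<Sum>i<n. norm (dil c f (v i) - dil c f (u i))) < \<epsilon>"
  proof (intro exI[of _ "\<delta> / c"] conjI allI impI)
    fix n :: nat and u v
    assume *: "\<forall>i<n. 0 \<le> u i \<and> u i \<le> v i \<and> v i \<le> t" "disjoint_family_on (\<lambda>i. {u i<..<v i}) {..<n}"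
      "(\<Sum>i<n. v i - u i) < \<delta> / c"
    show "(\<Sum>i<n. norm (dil c f (v i) - dil c f (u i))) < \<epsilon>"
      unfolding dil_def
    proof (rule 1)
      show "\<forall>i<n. 0 \<le> c * u i \<and> c * u i \<le> c * v i \<and> c * v i \<le> c * t" using * c by auto
      show "disjoint_family_on (\<lambda>i. {c * u i<..<c * v i}) {..<n}"
        unfolding disjoint_family_on_def
      proof (intro ballI impI equals0I)
        fix i j x assume ij: "i \<in> {..<n}" "j \<in> {..<n}" "i \<noteq> j" and x: "x \<in> {c * u i<..<c * v i} \<inter> {c * u j<..<c * v j}"
        then have "x / c \<in> {u i<..<v i} \<inter> {u j<..<v j}" using c by (auto simp: field_simps)
        then show False using *(2) ij unfolding disjoint_family_on_def by blast
      qed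
      have "(\<Sum>i<n. c * v i - c * u i) = c * (\<Sum>i<n. v i - u i)"
        by (simp add: sum_distrib_left right_diff_distrib)
      then show "(\<Sum>i<n. c * v i - c * u i) < \<delta>" using *(3) c by (simp add: field_simps)
    qed
  qed (use c d in auto)
qed

lemma dstar_domainD:
  assumes "f \<in> dstar_domain m" "0 < t"
  shows "(f has_vector_derivative vector_derivative f (at t)) (at t)"
    "AC_on 0 t f"
    "set_integrable lebesgue {0<..<t} (\<lambda>y. vector_derivative f (at y) * of_real (m (y / t)))"
    "continuous_on {0<..} (\<lambda>x. vector_derivative f (at x))"
  using assms unfolding dstar_domain_def C1_differentiable_on_eq by (auto simp: vector_derivative_works)

lemma zero_in_dstar_domain: "(\<lambda>_. 0) \<in> dstar_domain m"
  unfolding dstar_domain_def C1_differentiable_on_eq by (auto simp: AC_on_def set_integrable_def)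

lemma dstar_linear:
  fixes c d :: complex
  assumes f: "f \<in> dstar_domain m" and g: "g \<in> dstar_domain m"
  shows "(\<lambda>t. c * f t + d * g t) \<in> dstar_domain m"
    and "0 < t \<Longrightarrow> dstar \<alpha> b m (\<lambda>t. c * f t + d * g t) t = c * dstar \<alpha> b m f t + d * dstar \<alpha> b m g t"
proof -
  let ?h = "\<lambda>t. c * f t + d * g t"
  have der: "(?h has_vector_derivative c * vector_derivative f (at t) + d * vector_derivative g (at t)) (at t)" if "0 < t" for t
    using dstar_domainD(1)[OF f that] dstar_domainD(1)[OF g that]
    by (auto intro!: derivative_eq_intros)
  then have vd: "vector_derivative ?h (at t) = c * vector_derivative f (at t) + d * vector_derivative g (at t)" if "0 < t" for t
    using that by (intro vector_derivative_at)
  \<comment> \<open>The indicator is kept inside because \<open>vector_derivative\<close> need not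
    be linear at points where the functions are not differentiable.\<close>
  have cong: "indicator {0<..<t} r *\<^sub>R (vector_derivative ?h (at r) * of_real (m (r / t)))
    = c * (indicator {0<..<t} r *\<^sub>R (vector_derivative f (at r) * of_real (m (r / t))))
    + d * (indicator {0<..<t} r *\<^sub>R (vector_derivative g (at r) * of_real (m (r / t))))" for r t
    by (cases "r \<in> {0<..<t}") (auto simp: vd algebra_simps)
  show "?h \<in> dstar_domain m"
    unfolding dstar_domain_def mem_Collect_eq
  proof (intro conjI allI impI)
    show "?h C1_differentiable_on {0<..}"
      unfolding C1_differentiable_on_def
    proof (intro exI conjI ballI)
      show "continuous_on {0<..} (\<lambda>t. c * vector_derivative f (at t) + d * vector_derivative g (at t))"
        using dstar_domainD(4)[OF f zero_less_one] dstar_domainD(4)[OF g zero_less_one]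
        by (intro continuous_intros)
    qed (use der in auto)
    fix t :: real assume t: "0 < t"
    show "AC_on 0 t ?h"
      using dstar_domainD(2)[OF f t] dstar_domainD(2)[OF g t] by (intro AC_on_add AC_on_mult_left)
    show "set_integrable lebesgue {0<..<t} (\<lambda>y. vector_derivative ?h (at y) * of_real (m (y / t)))"
      using dstar_domainD(3)[OF f t] dstar_domainD(3)[OF g t] unfolding set_integrable_def cong
      by (intro Bochner_Integration.integrable_add integrable_mult_right)
  qed
  assume t: "0 < t"
  have "(LINT r:{0<..<t}|lebesgue. vector_derivative ?h (at r) * of_real (m (r / t)))
    = c * (LINT r:{0<..<t}|lebesgue. vector_derivative f (at r) * of_real (m (r / t)))
    + d * (LINT r:{0<..<t}|lebesgue. vector_derivative g (at r) * of_real (m (r / t)))"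
    using dstar_domainD(3)[OF f t] dstar_domainD(3)[OF g t]
    unfolding set_lebesgue_integral_def set_integrable_def cong
    by (subst Bochner_Integration.integral_add) (auto simp del: mult_scaleR_right)
  then show "dstar \<alpha> b m ?h t = c * dstar \<alpha> b m f t + d * dstar \<alpha> b m g t"
    unfolding dstar_def vd[OF t] by (simp add: algebra_simps)
qed

lemma dstar_dil:
  assumes f: "f \<in> dstar_domain m" and c: "0 < c"
  shows "dil c f \<in> dstar_domain m"
    and "0 < t \<Longrightarrow> dstar \<alpha> b m (dil c f) t = of_real (c powr \<alpha>) * dstar \<alpha> b m f (c * t)"
proof -
  have der: "(dil c f has_vector_derivative c *\<^sub>R vector_derivative f (at (c * t))) (at t)" if "0 < t" for t
  proof -
    have "((\<lambda>t. c * t) has_real_derivative c) (at t)" by (auto intro!: derivative_eq_intros)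
    moreover have "(f has_vector_derivative vector_derivative f (at (c * t))) (at (c * t))"
      using that c by (intro dstar_domainD(1)[OF f]) simp
    ultimately have "(f \<circ> (\<lambda>t. c * t) has_vector_derivative c *\<^sub>R vector_derivative f (at (c * t))) (at t)"
      by (intro vector_diff_chain_at) (auto simp: has_real_derivative_iff_has_vector_derivative)
    then show ?thesis by (simp add: dil_def[abs_def] comp_def)
  qed
  then have vd: "vector_derivative (dil c f) (at t) = of_real c * vector_derivative f (at (c * t))" if "0 < t" for t
    using vector_derivative_at[OF der[OF that]] by (simp add: scaleR_conv_of_real)
  have ind: "indicator {0<..<1} r *\<^sub>R (vector_derivative (dil c f) (at (t * r)) * of_real (m r))
    = of_real c * (indicator {0<..<1} r *\<^sub>R (vector_derivative f (at (c * t * r)) * of_real (m r)))" if "0 < t" for t r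
    using that by (cases "0 < r \<and> r < 1") (auto simp: vd mult.assoc)
  show "dil c f \<in> dstar_domain m"
    unfolding dstar_domain_def mem_Collect_eq
  proof (intro conjI allI impI)
    show "dil c f C1_differentiable_on {0<..}"
      unfolding C1_differentiable_on_def
    proof (intro exI conjI ballI)
      have "continuous_on {0<..} (\<lambda>t. vector_derivative f (at (c * t)))"
        by (rule continuous_on_compose2[OF dstar_domainD(4)[OF f zero_less_one]])
           (use c in \<open>auto intro!: continuous_intros\<close>)
      then show "continuous_on {0<..} (\<lambda>t. c *\<^sub>R vector_derivative f (at (c * t)))"
        by (intro continuous_intros)
    qed (use der in auto)
    fix t :: real assume t: "0 < t"
    then have ct: "0 < c * t" using c by simp
    show "AC_on 0 t (dil c f)"
      using c t by (intro AC_on_dil dstar_domainD(2)[OF f]) auto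
    have "set_integrable lebesgue {0<..<1} (\<lambda>r. vector_derivative f (at (c * t * r)) * of_real (m r))"
      using dstar_domainD(3)[OF f ct] unfolding weighted_derivative_scale(1)[OF ct, where m = m] .
    then show "set_integrable lebesgue {0<..<t} (\<lambda>y. vector_derivative (dil c f) (at y) * of_real (m (y / t)))"
      unfolding weighted_derivative_scale(1)[OF t, where m = m] unfolding set_integrable_def ind[OF t] by (rule integrable_mult_right)
  qed
  assume t: "0 < t"
  have ct: "0 < c * t" using c t by simp
  have "(LINT r:{0<..<t}|lebesgue. vector_derivative (dil c f) (at r) * of_real (m (r / t)))
    = (LINT r:{0<..<c * t}|lebesgue. vector_derivative f (at r) * of_real (m (r / (c * t))))"
    unfolding weighted_derivative_scale(2)[OF t, where m = m] unfolding weighted_derivative_scale(2)[OF ct, where m = m]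
    unfolding set_lebesgue_integral_def ind[OF t] integral_mult_right_zero by simp
  moreover have "t powr (- \<alpha>) = c powr \<alpha> * (c * t) powr (- \<alpha>)"
    using c t by (simp add: powr_mult powr_minus field_simps)
  moreover have "t powr (1 - \<alpha>) * c = c powr \<alpha> * (c * t) powr (1 - \<alpha>)"
    using c t by (simp add: powr_mult powr_diff field_simps)
  then have "complex_of_real (t powr (1 - \<alpha>)) * of_real c = of_real (c powr \<alpha>) * of_real ((c * t) powr (1 - \<alpha>))"
    by (simp only: of_real_mult[symmetric])
  ultimately show "dstar \<alpha> b m (dil c f) t = of_real (c powr \<alpha>) * dstar \<alpha> b m f (c * t)"
    unfolding dstar_def vd[OF t] by (simp add: algebra_simps)
qed

lemma pow_fun_has_vector_derivative:
  assumes "0 < t"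
  shows "(pow_fun z has_vector_derivative z * of_real t powr (z - 1)) (at t)"
proof -
  have "((\<lambda>w. w powr z) has_field_derivative z * of_real t powr (z - 1)) (at (complex_of_real t))"
    using assms by (intro has_field_derivative_powr) (auto simp: complex_nonpos_Reals_iff)
  then show ?thesis
    unfolding pow_fun_def[abs_def] by (rule has_vector_derivative_real_field)
qed

lemma dstar_pow_fun:
  assumes z: "z \<in> Phi_dom m" and t: "0 < t"
  shows "dstar_defined m (pow_fun z) t"
    and "dstar \<alpha> b m (pow_fun z) t = Phi b m z * pow_fun (z - of_real \<alpha>) t"
proof -
  have vd: "vector_derivative (pow_fun z) (at r) = z * of_real r powr (z - 1)" if "0 < r" for r
    using that by (intro vector_derivative_at pow_fun_has_vector_derivative)
  have ind: "indicator {0<..<1} r *\<^sub>R (vector_derivative (pow_fun z) (at (t * r)) * of_real (m r))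
    = z * of_real t powr (z - 1) * (indicator {0<..<1} r *\<^sub>R (of_real r powr (z - 1) * of_real (m r)))" for r
    using t by (cases "0 < r \<and> r < 1") (auto simp: vd powr_times_real)
  show "dstar_defined m (pow_fun z) t"
    unfolding dstar_defined_def
  proof (intro conjI ballI)
    show "pow_fun z differentiable at r" if "r \<in> {0<..t}" for r
      using that pow_fun_has_vector_derivative[of r z] by (auto intro: differentiableI_vector)
    show "set_integrable lebesgue {0<..<t} (\<lambda>r. vector_derivative (pow_fun z) (at r) * of_real (m (r / t)))"
      using z unfolding weighted_derivative_scale(1)[OF t, where m = m] unfolding Phi_dom_def set_integrable_def ind mem_Collect_eq
      by (intro integrable_mult_right)
  qed
  have "(LINT r:{0<..<t}|lebesgue. vector_derivative (pow_fun z) (at r) * of_real (m (r / t)))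
    = of_real t * (z * of_real t powr (z - 1) * (LINT r:{0<..<1}|lebesgue. of_real r powr (z - 1) * of_real (m r)))"
    unfolding weighted_derivative_scale(2)[OF t, where m = m] unfolding set_lebesgue_integral_def ind integral_mult_right_zero by simp
  moreover have "complex_of_real (t powr (1 - \<alpha>)) * of_real t powr (z - 1) = of_real t powr (z - of_real \<alpha>)"
    "complex_of_real (t powr (- \<alpha>)) * (of_real t * of_real t powr (z - 1)) = of_real t powr (z - of_real \<alpha>)"
    using t by (simp_all add: powr_of_real[symmetric] powr_diff powr_minus field_simps)
  ultimately show "dstar \<alpha> b m (pow_fun z) t = Phi b m z * pow_fun (z - of_real \<alpha>) t"
    unfolding dstar_def vd[OF t] Phi_def pow_fun_def by (simp add: algebra_simps)
qed

section \<open>The half plane of convergence of the exponent, and the bold function as the exponent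
  of the tilted weight\<close>

definition Phi_nn :: "(real \<Rightarrow> real) \<Rightarrow> real \<Rightarrow> ennreal" where
  "Phi_nn m u = (\<integral>\<^sup>+r\<in>{0<..<1}. ennreal (r powr (u - 1) * m r) \<partial>lebesgue)"

lemma borel_imp_lebesgue_measurable:
  "f \<in> borel_measurable borel \<Longrightarrow> f \<in> borel_measurable lebesgue"
  by (rule measurable_completion) simp

lemma Phi_integrand_measurable:
  assumes m: "m \<in> borel_measurable (lebesgue_on {0<..<1})"
  shows "(\<lambda>r. indicator {0<..<1} r *\<^sub>R (complex_of_real r powr z * of_real (m r))) \<in> borel_measurable lebesgue"
proof -
  have [measurable]: "(\<lambda>r. indicator {0<..<1} r *\<^sub>R m r) \<in> borel_measurable lebesgue"
    using m by (subst (asm) borel_measurable_restrict_space_iff) (auto simp: mult.commute)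
  have [measurable]: "(\<lambda>r. complex_of_real r powr z) \<in> borel_measurable lebesgue"
    by (rule borel_imp_lebesgue_measurable) measurable
  have "(\<lambda>r. complex_of_real r powr z * of_real (indicator {0<..<1} r *\<^sub>R m r)) \<in> borel_measurable lebesgue"
    by measurable
  then show ?thesis by (simp add: scaleR_conv_of_real mult_ac)
qed

text \<open>The modulus of r^(z-1) depends on Re z only. In this form, membership in the domain and
  finiteness of the exponent become the same inequality for \<open>Phi_nn\<close>, which is monotone
  in the exponent.\<close>

lemma Phi_dom_iff:
  assumes m: "m \<in> borel_measurable (lebesgue_on {0<..<1})" and nn: "\<forall>r\<in>{0<..<1}. 0 \<le> m r"
  shows "z \<in> Phi_dom m \<longleftrightarrow> Phi_nn m (Re z) < \<infinity>"
proof -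
  have "ennreal (norm (indicator {0<..<1} r *\<^sub>R (complex_of_real r powr (z - 1) * of_real (m r))))
     = ennreal (r powr (Re z - 1) * m r) * indicator {0<..<1} r" for r
    using nn by (cases "r \<in> {0<..<1}") (auto simp: norm_mult norm_powr_real_powr)
  then show ?thesis
    using Phi_integrand_measurable[OF m, of "z - 1"]
    unfolding Phi_dom_def set_integrable_def mem_Collect_eq integrable_iff_bounded Phi_nn_def by simp
qed

lemma Phi_nn_mono:
  assumes nn: "\<forall>r\<in>{0<..<1}. 0 \<le> m r" and "u \<le> v"
  shows "Phi_nn m v \<le> Phi_nn m u"
  unfolding Phi_nn_def using assms
  by (intro nn_integral_mono) (auto simp: indicator_def intro!: ennreal_leI mult_right_mono powr_mono')

lemma m_tilt_measurable:
  assumes m: "m \<in> borel_measurable (lebesgue_on {0<..<1})"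
  shows "m_tilt \<alpha> m \<in> borel_measurable (lebesgue_on {0<..<1})"
proof -
  have "(\<lambda>r :: real. r powr (- \<alpha>)) \<in> borel_measurable lebesgue"
    by (rule borel_imp_lebesgue_measurable) measurable
  then have "(\<lambda>r :: real. r powr (- \<alpha>)) \<in> borel_measurable (lebesgue_on {0<..<1})"
    by (rule measurable_restrict_space1)
  then show ?thesis unfolding m_tilt_def[abs_def] using m by (rule borel_measurable_times)
qed

lemma m_tilt_nonneg: "\<forall>r\<in>{0<..<1}. 0 \<le> m r \<Longrightarrow> \<forall>r\<in>{0<..<1}. 0 \<le> m_tilt \<alpha> m r"
  by (auto simp: m_tilt_def)

lemma Phi_nn_tilt: "Phi_nn (m_tilt \<alpha> m) u = Phi_nn m (u - \<alpha>)"
  unfolding Phi_nn_def m_tilt_def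
proof (intro nn_integral_cong)
  fix r :: real
  have "r powr (u - 1) * (r powr (- \<alpha>) * m r) = r powr (u - \<alpha> - 1) * m r"
    using powr_add[of r "u - 1" "- \<alpha>"] by (simp only: mult.assoc[symmetric]) (simp add: algebra_simps)
  then show "ennreal (r powr (u - 1) * (r powr (- \<alpha>) * m r)) * indicator {0<..<1} r
    = ennreal (r powr (u - \<alpha> - 1) * m r) * indicator {0<..<1} r" by (simp only:)
qed

text \<open>The factor z / (z - \<alpha>) trades the outer factor z - \<alpha> of the exponent for
  z, and the shift in the power of r is absorbed by the tilted weight. So away from \<alpha> the
  bold function is the exponent of (b, m_\<alpha>).\<close>

lemma Phi_tilt:
  assumes "z \<noteq> of_real \<alpha>"
  shows "z / (z - of_real \<alpha>) * Phi b m (z - of_real \<alpha>) = Phi b (m_tilt \<alpha> m) z"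
proof -
  have "indicator {0<..<1} r *\<^sub>R (complex_of_real r powr (z - of_real \<alpha> - 1) * of_real (m r))
    = indicator {0<..<1} r *\<^sub>R (complex_of_real r powr (z - 1) * of_real (m_tilt \<alpha> m r))" for r
  proof (cases "r \<in> {0<..<1}")
    case True
    then have "complex_of_real (r powr (- \<alpha>)) = of_real r powr (- of_real \<alpha>)"
      using powr_of_real[of r "- \<alpha>"] by simp
    moreover have "complex_of_real r powr (z - of_real \<alpha> - 1) = of_real r powr (z - 1) * of_real r powr (- of_real \<alpha>)"
      using powr_add[of "complex_of_real r" "z - 1" "- of_real \<alpha>"] by (simp add: algebra_simps)
    ultimately show ?thesis using True by (simp add: m_tilt_def)
  qed simp
  note eq = this
  have "z / (z - of_real \<alpha>) * (B * (z - of_real \<alpha>) + (z - of_real \<alpha>) * I) = B * z + z * I" for B I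
    using assms by (simp add: field_simps)
  then show ?thesis unfolding Phi_def set_lebesgue_integral_def eq .
qed

text \<open>Continuity within the domain is what evaluates the limit hidden in \<open>bold\<close>
  at \<alpha>. It has to hold at boundary points too, since the half plane of convergence may be
  closed.\<close>

lemma Phi_tendsto:
  assumes m: "m \<in> borel_measurable (lebesgue_on {0<..<1})" and nn: "\<forall>r\<in>{0<..<1}. 0 \<le> m r"
    and z: "z \<in> Phi_dom m"
  shows "(Phi b m \<longlongrightarrow> Phi b m z) (at z within Phi_dom m)"
proof -
  \<comment> \<open>The exponent of the dominating function: a point of the domain to the left of z
    if there is one, otherwise Re z itself, to the left of which the filter does not reach.\<close>
  obtain c where c: "Phi_nn m c < \<infinity>" "\<forall>\<^sub>F w in at z within Phi_dom m. c \<le> Re w"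
  proof (cases "\<exists>w\<in>Phi_dom m. Re w < Re z")
    case True
    then obtain w where w: "w \<in> Phi_dom m" "Re w < Re z" by blast
    have "(Re \<longlongrightarrow> Re z) (at z within Phi_dom m)" by (intro tendsto_intros)
    then have "\<forall>\<^sub>F w' in at z within Phi_dom m. Re w < Re w'" using w by (intro order_tendstoD)
    then show ?thesis using w Phi_dom_iff[OF m nn] by (intro that[of "Re w"]) (auto elim!: eventually_mono)
  next
    case False
    then have "\<forall>\<^sub>F w in at z within Phi_dom m. Re z \<le> Re w"
      by (auto simp: eventually_at_filter not_less)
    then show ?thesis using z Phi_dom_iff[OF m nn] by (intro that[of "Re z"]) auto
  qed
  let ?f = "\<lambda>w r. indicator {0<..<1} r *\<^sub>R (complex_of_real r powr (w - 1) * of_real (m r))"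
  have "((\<lambda>w. \<integral>r. ?f w r \<partial>lebesgue) \<longlongrightarrow> (\<integral>r. ?f z r \<partial>lebesgue)) (at z within Phi_dom m)"
    unfolding tendsto_at_iff_sequentially comp_def
  proof (intro allI impI)
    fix X assume X: "\<forall>i. X i \<in> Phi_dom m - {z}" and lim: "X \<longlonglongrightarrow> z"
    have "filterlim X (at z within Phi_dom m) sequentially"
      using X lim by (auto simp: filterlim_at)
    then have "\<forall>\<^sub>F n in sequentially. c \<le> Re (X n)" using c(2) by (rule eventually_compose_filterlim[rotated])
    then obtain N where N: "\<And>n. N \<le> n \<Longrightarrow> c \<le> Re (X n)" by (auto simp: eventually_sequentially)
    have "(\<lambda>n. \<integral>r. ?f (X (n + N)) r \<partial>lebesgue) \<longlonglongrightarrow> (\<integral>r. ?f z r \<partial>lebesgue)"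
    proof (rule integral_dominated_convergence[where w = "\<lambda>r. norm (?f (of_real c) r)"])
      show "integrable lebesgue (\<lambda>r. norm (?f (of_real c) r))"
        using c(1) Phi_dom_iff[OF m nn, of "of_real c"] unfolding Phi_dom_def set_integrable_def
        by (intro integrable_norm) simp
      show "AE r in lebesgue. (\<lambda>n. ?f (X (n + N)) r) \<longlonglongrightarrow> ?f z r"
      proof (intro always_eventually allI)
        fix r
        show "(\<lambda>n. ?f (X (n + N)) r) \<longlonglongrightarrow> ?f z r"
        proof (cases "r \<in> {0<..<1}")
          case True
          have "(\<lambda>n. complex_of_real r powr (X (n + N) - 1)) \<longlonglongrightarrow> of_real r powr (z - 1)"
            using True LIMSEQ_ignore_initial_segment[OF lim, of N]
            by (intro tendsto_powr_complex' tendsto_intros disjI1) (auto simp: complex_nonpos_Reals_iff)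
          then show ?thesis by (intro tendsto_scaleR tendsto_mult tendsto_const)
        qed simp
      qed
      show "AE r in lebesgue. norm (?f (X (n + N)) r) \<le> norm (?f (of_real c) r)" for n
      proof (intro always_eventually allI)
        fix r
        show "norm (?f (X (n + N)) r) \<le> norm (?f (of_real c) r)"
        proof (cases "r \<in> {0<..<1}")
          case True
          then have "r powr (Re (X (n + N)) - 1) \<le> r powr (c - 1)"
            using N[of "n + N"] by (intro powr_mono') auto
          then show ?thesis using True by (simp add: norm_mult norm_powr_real_powr mult_right_mono)
        qed simp
      qed
    qed (use Phi_integrand_measurable[OF m] in auto)
    then show "(\<lambda>n. \<integral>r. ?f (X n) r \<partial>lebesgue) \<longlonglongrightarrow> (\<integral>r. ?f z r \<partial>lebesgue)" by (rule LIMSEQ_offset)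
  qed
  then show ?thesis
    unfolding Phi_def set_lebesgue_integral_def by (intro tendsto_intros)
qed

text \<open>\<Phi> is only required to agree with \<open>Phi\<close> near \<alpha> and, if z differs
  from \<alpha>, at z - \<alpha>, so that the lemma serves both \<open>Phi\<close> itself and a
  \<phi> that is prescribed only to the right of its abscissa.\<close>

lemma bold_eq_Phi:
  assumes m: "m \<in> borel_measurable (lebesgue_on {0<..<1})" and nn: "\<forall>r\<in>{0<..<1}. 0 \<le> m r"
    and z: "z \<in> Phi_dom (m_tilt \<alpha> m)"
    and ev: "\<forall>\<^sub>F w in at (of_real \<alpha>) within Phi_dom (m_tilt \<alpha> m). \<Phi> (w - of_real \<alpha>) = Phi b m (w - of_real \<alpha>)"
    and eq: "z \<noteq> of_real \<alpha> \<Longrightarrow> \<Phi> (z - of_real \<alpha>) = Phi b m (z - of_real \<alpha>)"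
  shows "bold \<alpha> m \<Phi> z = Phi b (m_tilt \<alpha> m) z"
proof (cases "z = of_real \<alpha>")
  case False
  then show ?thesis using eq Phi_tilt[OF False] by (simp add: bold_def)
next
  case True
  let ?S = "Phi_dom (m_tilt \<alpha> m)"
  note mt = m_tilt_measurable[OF m, of \<alpha>] m_tilt_nonneg[OF nn, of \<alpha>]
  \<comment> \<open>\<open>Lim\<close> has a meaning only for a nontrivial filter. The domain
    contains a real half line starting at \<alpha>, so \<alpha> is approached from the
    right.\<close>
  have "of_real \<alpha> islimpt ?S"
    unfolding islimpt_sequential
  proof (intro exI[of _ "\<lambda>n. complex_of_real (\<alpha> + 1 / real (Suc n))"] conjI allI)
    fix n
    have "Phi_nn (m_tilt \<alpha> m) (\<alpha> + 1 / real (Suc n)) \<le> Phi_nn (m_tilt \<alpha> m) \<alpha>"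
      by (rule Phi_nn_mono[OF mt(2)]) simp
    moreover have "Phi_nn (m_tilt \<alpha> m) \<alpha> < \<infinity>"
      using z True Phi_dom_iff[OF mt, of z] by simp
    ultimately have "complex_of_real (\<alpha> + 1 / real (Suc n)) \<in> ?S"
      unfolding Phi_dom_iff[OF mt] by (simp add: order.strict_trans1)
    then show "complex_of_real (\<alpha> + 1 / real (Suc n)) \<in> ?S - {of_real \<alpha>}"
      by (simp del: of_real_add of_nat_Suc)
  next
    have "(\<lambda>n. \<alpha> + 1 / real (Suc n)) \<longlonglongrightarrow> \<alpha> + 0"
      by (intro tendsto_intros LIMSEQ_Suc[OF lim_1_over_n])
    then have "(\<lambda>n. complex_of_real (\<alpha> + 1 / real (Suc n))) \<longlonglongrightarrow> of_real (\<alpha> + 0)" by (rule tendsto_of_real)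
    then show "(\<lambda>n. complex_of_real (\<alpha> + 1 / real (Suc n))) \<longlonglongrightarrow> of_real \<alpha>" by simp
  qed
  then have nontriv: "at (of_real \<alpha>) within ?S \<noteq> bot" by (simp add: trivial_limit_within)
  have "((\<lambda>w. w / (w - of_real \<alpha>) * \<Phi> (w - of_real \<alpha>)) \<longlongrightarrow> Phi b (m_tilt \<alpha> m) z) (at (of_real \<alpha>) within ?S)"
  proof (rule Lim_transform_eventually)
    show "(Phi b (m_tilt \<alpha> m) \<longlongrightarrow> Phi b (m_tilt \<alpha> m) z) (at (of_real \<alpha>) within ?S)"
      using Phi_tendsto[OF mt z] True by simp
    have "\<forall>\<^sub>F w in at (of_real \<alpha>) within ?S. w \<noteq> of_real \<alpha>" by (simp add: eventually_at_filter)
    with ev show "\<forall>\<^sub>F w in at (of_real \<alpha>) within ?S. Phi b (m_tilt \<alpha> m) w = w / (w - of_real \<alpha>) * \<Phi> (w - of_real \<alpha>)"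
      by eventually_elim (simp add: Phi_tilt[symmetric])
  qed
  then show ?thesis unfolding bold_def using True tendsto_Lim[OF nontriv] by simp
qed

text \<open>Not an instance of \<open>dstar_pow_fun\<close>, as 0 may lie outside the domain: here
  the derivative vanishes and with it the integrand, whatever the weight.\<close>

lemma dstar_pow_fun_0:
  assumes t: "0 < t"
  shows "dstar_defined m (pow_fun 0) t" "dstar \<alpha> b m (pow_fun 0) t = 0"
proof -
  have vd: "vector_derivative (pow_fun 0) (at r) = 0" if "0 < r" for r
    using vector_derivative_at[OF pow_fun_has_vector_derivative[OF that, of 0]] by simp
  have ind: "indicator {0<..<t} r *\<^sub>R (vector_derivative (pow_fun 0) (at r) * of_real (m (r / t))) = 0" for r
    by (cases "r \<in> {0<..<t}") (auto simp: vd)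
  show "dstar_defined m (pow_fun 0) t"
    unfolding dstar_defined_def set_integrable_def ind
    using differentiableI_vector[OF pow_fun_has_vector_derivative] by auto
  show "dstar \<alpha> b m (pow_fun 0) t = 0"
    unfolding dstar_def set_lebesgue_integral_def ind vd[OF t] by simp
qed

lemma Phi_ext_eq: "Phi_ext b m u = ereal (b * u) + ereal u * enn2ereal (Phi_nn m u)"
  by (simp add: Phi_ext_def Phi_nn_def)

text \<open>At u = 0 the product of 0 and infinity is 0 for extended reals, so 0 never counts as a
  point where the exponent is infinite.\<close>

lemma Phi_ext_infinite_iff: "\<bar>Phi_ext b m u\<bar> = \<infinity> \<longleftrightarrow> u \<noteq> 0 \<and> Phi_nn m u = \<infinity>"
proof (cases "Phi_nn m u")
  case (real x)
  then show ?thesis by (simp add: Phi_ext_eq enn2ereal_ennreal)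
next
  case top
  then show ?thesis
    by (cases "u = 0"; cases "0 < u") (auto simp: Phi_ext_eq zero_ereal_def[symmetric])
qed

lemma Phi_nn_0_finite:
  assumes "set_integrable lebesgue {0<..<1} (\<lambda>r. m r / r)" and nn: "\<forall>r\<in>{0<..<1}. 0 \<le> m r"
  shows "Phi_nn m 0 < \<infinity>"
proof -
  have "Phi_nn m 0 = (\<integral>\<^sup>+r. ennreal (norm (indicator {0<..<1} r *\<^sub>R (m r / r))) \<partial>lebesgue)"
    unfolding Phi_nn_def using nn
    by (intro nn_integral_cong) (auto simp: indicator_def powr_minus_divide)
  then show ?thesis
    using assms(1) unfolding set_integrable_def integrable_iff_bounded by simp
qed

text \<open>A negative u with infinite integral would belong to the set whose supremum is the
  abscissa. For u \<ge> 0, which that set does not see apart from 0, finiteness comes from the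
  integrability of m(r)/r.\<close>

lemma Phi_nn_finite:
  assumes "set_integrable lebesgue {0<..<1} (\<lambda>r. m r / r)" and nn: "\<forall>r\<in>{0<..<1}. 0 \<le> m r"
    and u: "abscissa (Phi_ext b m) < ereal u"
  shows "Phi_nn m u < \<infinity>"
proof (cases "0 \<le> u")
  case True
  show ?thesis
    using Phi_nn_mono[OF nn True] Phi_nn_0_finite[OF assms(1,2)] by (rule order.strict_trans1)
next
  case False
  show ?thesis
  proof (rule ccontr)
    assume "\<not> Phi_nn m u < \<infinity>"
    then have "Phi_nn m u = \<infinity>" by (simp add: less_top[symmetric])
    then have "\<bar>Phi_ext b m u\<bar> = \<infinity>" using False by (simp add: Phi_ext_infinite_iff)
    then have "ereal u \<le> abscissa (Phi_ext b m)"
      unfolding abscissa_def using False by (intro Sup_upper) auto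
    with u show False by simp
  qed
qed

section \<open>Bernstein functions\<close>

text \<open>The n-th derivative in u of the integral of r^(u-1) m(r).\<close>

definition ln_moment :: "(real \<Rightarrow> real) \<Rightarrow> nat \<Rightarrow> real \<Rightarrow> real" where
  "ln_moment m n u = (\<integral>r. indicator {0<..<1} r * (ln r ^ n * r powr (u - 1) * m r) \<partial>lebesgue)"

text \<open>One term of the exponential series: y^n / n! \<le> e^y with y = -\<epsilon> ln
  r.\<close>

lemma ln_power_powr_bound:
  fixes r \<epsilon> :: real
  assumes "0 < r" "r < 1" "0 < \<epsilon>"
  shows "\<bar>ln r\<bar> ^ n * r powr \<epsilon> \<le> fact n / \<epsilon> ^ n"
proof -
  define y where "y = - \<epsilon> * ln r"
  have y: "0 < y" using assms by (simp add: y_def mult_pos_neg)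
  have "(\<lambda>k. y ^ k /\<^sub>R fact k) sums exp y" by (rule exp_converges)
  then have "(\<Sum>k\<in>{n}. y ^ k /\<^sub>R fact k) \<le> exp y"
    using y unfolding sums_iff by (subst sums_unique[OF exp_converges]) (intro sum_le_suminf, auto)
  then have "y ^ n \<le> fact n * exp y" by (simp add: divide_simps mult.commute)
  then have "y ^ n * exp (- y) \<le> fact n" by (simp add: exp_minus field_simps)
  moreover have "exp (- y) = r powr \<epsilon>" using assms by (simp add: y_def powr_def)
  moreover have "y ^ n = \<epsilon> ^ n * \<bar>ln r\<bar> ^ n" using assms by (simp add: y_def abs_if power_mult_distrib[symmetric])
  ultimately show ?thesis using assms by (simp add: field_simps)
qed

lemma ln_moment_measurable:
  fixes m :: "real \<Rightarrow> real"
  assumes m: "m \<in> borel_measurable (lebesgue_on {0<..<1})"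
  shows "(\<lambda>r. indicator {0<..<1} r * (ln r ^ n * r powr u * m r)) \<in> borel_measurable lebesgue"
proof -
  have [measurable]: "(\<lambda>r. indicator {0<..<1} r *\<^sub>R m r) \<in> borel_measurable lebesgue"
    using m by (subst (asm) borel_measurable_restrict_space_iff) (auto simp: mult.commute)
  have [measurable]: "(\<lambda>r :: real. ln r ^ n * r powr u) \<in> borel_measurable lebesgue"
    by (rule borel_imp_lebesgue_measurable) measurable
  have "(\<lambda>r. ln r ^ n * r powr u * (indicator {0<..<1} r *\<^sub>R m r)) \<in> borel_measurable lebesgue" by measurable
  then show ?thesis by (simp add: mult_ac)
qed

lemma Phi_nn_integrable:
  assumes m: "m \<in> borel_measurable (lebesgue_on {0<..<1})" and nn: "\<forall>r\<in>{0<..<1}. 0 \<le> m r"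
    and c: "Phi_nn m c < \<infinity>"
  shows "integrable lebesgue (\<lambda>r. indicator {0<..<1} r * (r powr (c - 1) * m r))"
proof (rule integrableI_nonneg)
  show "(\<lambda>r. indicator {0<..<1} r * (r powr (c - 1) * m r)) \<in> borel_measurable lebesgue"
    using ln_moment_measurable[OF m, of 0 "c - 1"] by simp
  have "(\<integral>\<^sup>+r. ennreal (indicator {0<..<1} r * (r powr (c - 1) * m r)) \<partial>lebesgue) = Phi_nn m c"
    unfolding Phi_nn_def by (intro nn_integral_cong) (auto simp: indicator_def)
  then show "(\<integral>\<^sup>+r. ennreal (indicator {0<..<1} r * (r powr (c - 1) * m r)) \<partial>lebesgue) < \<infinity>"
    using c by simp
qed (use nn in \<open>auto simp: indicator_def\<close>)

lemma ln_moment_dominated: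
  assumes nn: "\<forall>r\<in>{0<..<1}. 0 \<le> m r" and u: "c + \<epsilon> \<le> u" and \<epsilon>: "0 < \<epsilon>"
  shows "norm (indicator {0<..<1} r * (ln r ^ n * r powr (u - 1) * m r))
    \<le> fact n / \<epsilon> ^ n * (indicator {0<..<1} r * (r powr (c - 1) * m r))"
proof (cases "r \<in> {0<..<1}")
  case True
  have "\<bar>ln r\<bar> ^ n * r powr (u - 1) \<le> \<bar>ln r\<bar> ^ n * (r powr \<epsilon> * r powr (c - 1))"
    using True u by (intro mult_left_mono) (auto simp: powr_add[symmetric] intro!: powr_mono')
  also have "\<dots> = \<bar>ln r\<bar> ^ n * r powr \<epsilon> * r powr (c - 1)" by simp
  also have "\<dots> \<le> fact n / \<epsilon> ^ n * r powr (c - 1)"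
    using True \<epsilon> by (intro mult_right_mono ln_power_powr_bound) auto
  finally have "\<bar>ln r\<bar> ^ n * r powr (u - 1) * m r \<le> fact n / \<epsilon> ^ n * r powr (c - 1) * m r"
    using True nn by (intro mult_right_mono) auto
  then show ?thesis using True nn by (simp add: abs_mult power_abs mult.assoc)
qed simp

lemma ln_moment_integrable:
  assumes m: "m \<in> borel_measurable (lebesgue_on {0<..<1})" and nn: "\<forall>r\<in>{0<..<1}. 0 \<le> m r"
    and c: "Phi_nn m c < \<infinity>" "c < u"
  shows "integrable lebesgue (\<lambda>r. indicator {0<..<1} r * (ln r ^ n * r powr (u - 1) * m r))"
proof (rule Bochner_Integration.integrable_bound)
  show "integrable lebesgue (\<lambda>r. fact n / (u - c) ^ n * (indicator {0<..<1} r * (r powr (c - 1) * m r)))"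
    by (intro integrable_mult_right Phi_nn_integrable[OF m nn c(1)])
  show "AE r in lebesgue. norm (indicator {0<..<1} r * (ln r ^ n * r powr (u - 1) * m r))
      \<le> norm (fact n / (u - c) ^ n * (indicator {0<..<1} r * (r powr (c - 1) * m r)))"
    unfolding real_norm_def
    using ln_moment_dominated[OF nn, of c "u - c" u] c(2)
    by (intro always_eventually allI order.trans[OF _ abs_ge_self]) simp
qed (rule ln_moment_measurable[OF m])

lemma ln_moment_has_derivative:
  assumes m: "m \<in> borel_measurable (lebesgue_on {0<..<1})" and nn: "\<forall>r\<in>{0<..<1}. 0 \<le> m r"
    and c: "Phi_nn m c < \<infinity>" "c < u"
  shows "(ln_moment m n has_real_derivative ln_moment m (Suc n) u) (at u)"
  unfolding ln_moment_def[abs_def]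
proof (rule has_field_derivative_integral_dominated)
  \<comment> \<open>Half of the room is kept as a spare power r^\<delta>, which absorbs the
    logarithms uniformly on the ball.\<close>
  define \<delta> where "\<delta> = (u - c) / 2"
  show "0 < \<delta>" using c by (simp add: \<delta>_def)
  have w: "c + \<delta> < w" if "w \<in> ball u \<delta>" for w
    using that by (auto simp: dist_real_def \<delta>_def abs_if field_simps split: if_splits)
  show "integrable lebesgue (\<lambda>r. indicator {0<..<1} r * (ln r ^ n * r powr (w - 1) * m r))" if "w \<in> ball u \<delta>" for w
    using w[OF that] \<open>0 < \<delta>\<close> by (intro ln_moment_integrable[OF m nn c(1)]) auto
  show "AE r in lebesgue. \<forall>w\<in>ball u \<delta>. ((\<lambda>w. indicator {0<..<1} r * (ln r ^ n * r powr (w - 1) * m r))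
      has_real_derivative indicator {0<..<1} r * (ln r ^ Suc n * r powr (w - 1) * m r)) (at w)"
  proof (intro always_eventually allI ballI)
    fix r w :: real
    show "((\<lambda>w. indicator {0<..<1} r * (ln r ^ n * r powr (w - 1) * m r))
      has_real_derivative indicator {0<..<1} r * (ln r ^ Suc n * r powr (w - 1) * m r)) (at w)"
    proof (cases "r \<in> {0<..<1}")
      case True
      have "((\<lambda>w. ln r ^ n * r powr (w - 1) * m r) has_real_derivative ln r ^ n * (r powr (w - 1) * ln r) * m r) (at w)"
        using True by (auto intro!: derivative_eq_intros)
      then show ?thesis using True by (simp add: mult_ac)
    qed simp
  qed
  show "AE r in lebesgue. \<forall>w\<in>ball u \<delta>. norm (indicator {0<..<1} r * (ln r ^ Suc n * r powr (w - 1) * m r))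
     \<le> fact (Suc n) / \<delta> ^ Suc n * (indicator {0<..<1} r * (r powr (c - 1) * m r))"
    using w \<open>0 < \<delta>\<close> by (intro always_eventually allI ballI ln_moment_dominated[OF nn]) (auto simp: less_imp_le)
  show "integrable lebesgue (\<lambda>r. fact (Suc n) / \<delta> ^ Suc n * (indicator {0<..<1} r * (r powr (c - 1) * m r)))"
    by (intro integrable_mult_right Phi_nn_integrable[OF m nn c(1)])
qed (rule ln_moment_measurable[OF m])

lemma Phi_integral_of_real:
  "(LINT r:{0<..<1}|lebesgue. complex_of_real r powr (of_real u - 1) * of_real (m r)) = of_real (ln_moment m 0 u)"
proof -
  have "indicator {0<..<1} r *\<^sub>R (complex_of_real r powr (of_real u - 1) * of_real (m r))
     = of_real (indicator {0<..<1} r * (ln r ^ 0 * r powr (u - 1) * m r))" for r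
  proof (cases "r \<in> {0<..<1}")
    case True
    then show ?thesis using powr_of_real[of r "u - 1"] by simp
  qed simp
  then show ?thesis
    unfolding set_lebesgue_integral_def ln_moment_def by (simp only: integral_complex_of_real)
qed

lemma Phi_of_real: "Phi b m (of_real u) = of_real (b * u + u * ln_moment m 0 u)"
  unfolding Phi_def Phi_integral_of_real by simp

lemma iterated_deriv_eq:
  fixes f :: "nat \<Rightarrow> real \<Rightarrow> real"
  assumes "\<And>n u. 0 < u \<Longrightarrow> (f n has_real_derivative f (Suc n) u) (at u)"
  shows "0 < u \<Longrightarrow> (deriv ^^ n) (f 0) u = f n u"
    and "0 < u \<Longrightarrow> (deriv ^^ n) (f 0) differentiable (at u)"
proof -
  have 1: "\<forall>u>0. (deriv ^^ n) (f 0) u = f n u" for n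
  proof (induction n)
    case (Suc n)
    show ?case
    proof (intro allI impI)
      fix u :: real assume u: "0 < u"
      have "((deriv ^^ n) (f 0) has_real_derivative f (Suc n) u) (at u)"
        by (rule has_field_derivative_transform_within_open[of "f n" _ _ "{0<..}"]) (use assms[OF u] Suc u in auto)
      then show "(deriv ^^ Suc n) (f 0) u = f (Suc n) u" by (simp add: DERIV_imp_deriv)
    qed
  qed simp
  then show "0 < u \<Longrightarrow> (deriv ^^ n) (f 0) u = f n u" by blast
  assume u: "0 < u"
  have "((deriv ^^ n) (f 0) has_real_derivative f (Suc n) u) (at u)"
    by (rule has_field_derivative_transform_within_open[of "f n" _ _ "{0<..}"]) (use assms[OF u] 1 u in auto)
  then show "(deriv ^^ n) (f 0) differentiable (at u)" by (auto simp: real_differentiable_def)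
qed

text \<open>Leibniz's rule for the n-th derivative of b u + u g(u), where g is the integral; the
  drift survives only for n = 0 and n = 1.\<close>

definition bernstein_deriv :: "real \<Rightarrow> (real \<Rightarrow> real) \<Rightarrow> nat \<Rightarrow> real \<Rightarrow> real" where
  "bernstein_deriv b m n u =
     (case n of 0 \<Rightarrow> b * u + u * ln_moment m 0 u
      | Suc k \<Rightarrow> (if k = 0 then b else 0) + u * ln_moment m n u + real n * ln_moment m k u)"

lemma bernstein_deriv_has_derivative:
  assumes m: "m \<in> borel_measurable (lebesgue_on {0<..<1})" and nn: "\<forall>r\<in>{0<..<1}. 0 \<le> m r"
    and c: "Phi_nn m c < \<infinity>" "c < u"
  shows "(bernstein_deriv b m n has_real_derivative bernstein_deriv b m (Suc n) u) (at u)"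
proof (cases n)
  case 0
  have "((\<lambda>u. b * u + u * ln_moment m 0 u) has_real_derivative b + (1 * ln_moment m 0 u + ln_moment m (Suc 0) u * u)) (at u)"
    by (auto intro!: derivative_eq_intros ln_moment_has_derivative[OF assms])
  then show ?thesis unfolding 0 bernstein_deriv_def[abs_def] by (simp add: algebra_simps)
next
  case (Suc k)
  have "((\<lambda>u. (if k = 0 then b else 0) + u * ln_moment m (Suc k) u + real (Suc k) * ln_moment m k u)
     has_real_derivative (1 * ln_moment m (Suc k) u + ln_moment m (Suc (Suc k)) u * u) + real (Suc k) * ln_moment m (Suc k) u) (at u)"
    by (auto intro!: derivative_eq_intros ln_moment_has_derivative[OF assms])
  then show ?thesis unfolding Suc bernstein_deriv_def[abs_def] by (simp add: algebra_simps)
qed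

lemma Phi_nn_one:
  assumes u: "0 < u" shows "Phi_nn (\<lambda>_. 1) u = ennreal (1 / u)"
proof -
  have "ennreal u * Phi_nn (\<lambda>_. 1) u = (\<integral>\<^sup>+r. ennreal u * (ennreal (r powr (u - 1) * 1) * indicator {0<..<1} r) \<partial>lebesgue)"
    unfolding Phi_nn_def
    by (rule nn_integral_cmult[symmetric]) (rule borel_imp_lebesgue_measurable, measurable)
  also have "\<dots> = (\<integral>\<^sup>+r. ennreal u * (ennreal (r powr (u - 1) * 1) * indicator {0<..<1} r) \<partial>lborel)"
    by (rule nn_integral_completion)
  also have "\<dots> = (\<integral>\<^sup>+r. 1 * ennreal (u * r powr (u - 1)) * indicator {0<..<1} r \<partial>lborel)"
    using u by (intro nn_integral_cong) (auto simp: ennreal_mult indicator_def)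
  also have "\<dots> = (\<integral>\<^sup>+r. 1 * indicator {0<..<1} (r :: real) \<partial>lborel)"
    by (rule nn_integral_powr_substitution[OF u, symmetric, of "\<lambda>_. 1"]) simp
  also have "\<dots> = 1" by simp
  finally have "ennreal (1 / u) * (ennreal u * Phi_nn (\<lambda>_. 1) u) = ennreal (1 / u) * 1" by simp
  then show ?thesis using u by (simp add: mult.assoc[symmetric] ennreal_mult[symmetric])
qed

lemma ln_moment_one: "0 < u \<Longrightarrow> ln_moment (\<lambda>_. 1) 0 u = 1 / u"
  unfolding ln_moment_def
proof (rule integral_eq_nn_integral[THEN trans])
  assume u: "0 < u"
  have "(\<integral>\<^sup>+r. ennreal (indicator {0<..<1} r * (ln r ^ 0 * r powr (u - 1) * 1)) \<partial>lebesgue) = Phi_nn (\<lambda>_. 1) u"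
    unfolding Phi_nn_def by (intro nn_integral_cong) (auto simp: indicator_def)
  then show "enn2real (\<integral>\<^sup>+r. ennreal (indicator {0<..<1} r * (ln r ^ 0 * r powr (u - 1) * 1)) \<partial>lebesgue) = 1 / u"
    using u by (simp add: Phi_nn_one)
qed (use ln_moment_measurable[of "\<lambda>_. 1" 0 "u - 1"] in auto)

text \<open>For the weight 1 the exponent u times 1/u is the constant 1.\<close>

lemma bernstein_deriv_one:
  assumes "0 < u" shows "bernstein_deriv 0 (\<lambda>_. 1) (Suc n) u = 0"
proof -
  have der: "(bernstein_deriv 0 (\<lambda>_. 1) n has_real_derivative bernstein_deriv 0 (\<lambda>_. 1) (Suc n) u) (at u)" if "0 < u" for n u
    by (rule bernstein_deriv_has_derivative[of _ "u / 2"]) (use that in \<open>auto simp: Phi_nn_one\<close>)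
  have base: "bernstein_deriv 0 (\<lambda>_. 1) 0 u = 1" if "0 < u" for u
    using that by (simp add: bernstein_deriv_def ln_moment_one)
  have "\<forall>u>0. bernstein_deriv 0 (\<lambda>_. 1) (Suc n) u = 0" for n
  proof (induction n)
    case 0
    show ?case
    proof (intro allI impI)
      fix u :: real assume u: "0 < u"
      have "(bernstein_deriv 0 (\<lambda>_. 1) 0 has_real_derivative 0) (at u)"
        by (rule has_field_derivative_transform_within_open[of "\<lambda>_. 1" _ _ "{0<..}"]) (use base u in auto)
      then show "bernstein_deriv 0 (\<lambda>_. 1) (Suc 0) u = 0" using DERIV_unique der[OF u] by blast
    qed
  next
    case (Suc n)
    show ?case
    proof (intro allI impI)
      fix u :: real assume u: "0 < u"
      have "(bernstein_deriv 0 (\<lambda>_. 1) (Suc n) has_real_derivative 0) (at u)"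
        by (rule has_field_derivative_transform_within_open[of "\<lambda>_. 0" _ _ "{0<..}"]) (use Suc u in auto)
      then show "bernstein_deriv 0 (\<lambda>_. 1) (Suc (Suc n)) u = 0" using DERIV_unique der[OF u] by blast
    qed
  qed
  then show ?thesis using assms by blast
qed

text \<open>For a constant weight the derivatives vanish; a monotone weight exceeds the constant
  \<open>m r\<^sub>0\<close> exactly where the kernel, which changes sign at \<open>r\<^sub>0\<close>, is positive.\<close>

lemma bernstein_deriv_sign:
  assumes m: "m \<in> borel_measurable (lebesgue_on {0<..<1})" and nn: "\<forall>r\<in>{0<..<1}. 0 \<le> m r"
    and mono: "mono_on {0<..<1} m" and b: "0 \<le> b" and u: "0 < u"
    and c: "Phi_nn m c < \<infinity>" "c < u"
  shows "0 \<le> (- 1) ^ n * bernstein_deriv b m (Suc n) u"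
proof -
  \<comment> \<open>The zero of u ln r + (n + 1), the factor of the kernel that remains when the
    nonnegative (-ln r)^n r^(u-1) is taken out.\<close>
  define r0 where "r0 = exp (- (real (Suc n) / u))"
  have r0: "r0 \<in> {0<..<1}" using u by (auto simp: r0_def)
  define w where "w m r = (- 1) ^ n * (u * (indicator {0<..<1} r * (ln r ^ Suc n * r powr (u - 1) * m r))
     + real (Suc n) * (indicator {0<..<1} r * (ln r ^ n * r powr (u - 1) * m r)))" for m :: "real \<Rightarrow> real" and r
  have one: "Phi_nn (\<lambda>_. 1) (u / 2) < \<infinity>" using u by (simp add: Phi_nn_one)
  have int: "integrable lebesgue (w m)"
    and val: "(\<integral>r. w m r \<partial>lebesgue) = (- 1) ^ n * (u * ln_moment m (Suc n) u + real (Suc n) * ln_moment m n u)"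
    if m: "m \<in> borel_measurable (lebesgue_on {0<..<1})" and nn: "\<forall>r\<in>{0<..<1}. 0 \<le> m r"
      and c: "Phi_nn m c < \<infinity>" "c < u" for m c
  proof -
    note i = ln_moment_integrable[OF m nn c]
    show "integrable lebesgue (w m)" unfolding w_def[abs_def]
      by (intro integrable_mult_right Bochner_Integration.integrable_add i)
    show "(\<integral>r. w m r \<partial>lebesgue) = (- 1) ^ n * (u * ln_moment m (Suc n) u + real (Suc n) * ln_moment m n u)"
      unfolding w_def ln_moment_def
      by (subst integral_mult_right_zero, subst Bochner_Integration.integral_add)
         (intro integrable_mult_right i, intro integrable_mult_right i, simp only: integral_mult_right_zero)
  qed
  have "0 = m r0 * (\<integral>r. w (\<lambda>_. 1) r \<partial>lebesgue)"
    using bernstein_deriv_one[OF u, of n] val[OF _ _ one] u by (simp add: bernstein_deriv_def)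
  also have "\<dots> = (\<integral>r. m r0 * w (\<lambda>_. 1) r \<partial>lebesgue)" by simp
  also have "\<dots> \<le> (\<integral>r. w m r \<partial>lebesgue)"
  proof (rule integral_mono)
    show "integrable lebesgue (\<lambda>r. m r0 * w (\<lambda>_. 1) r)"
      using int[OF _ _ one] u by (intro integrable_mult_right) auto
    show "integrable lebesgue (w m)" by (rule int[OF m nn c])
    fix r
    show "m r0 * w (\<lambda>_. 1) r \<le> w m r"
    proof (cases "r \<in> {0<..<1}")
      case True
      define k where "k = (- 1) ^ n * (ln r ^ n * r powr (u - 1))"
      have "k = (- ln r) ^ n * r powr (u - 1)" by (simp add: k_def power_minus[of "ln r" n])
      then have k: "0 \<le> k" using True by simp
      have w_eq: "w m r = k * (u * ln r + real (Suc n)) * m r" for m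
        unfolding w_def k_def using True by (simp add: algebra_simps)
      have "0 \<le> (u * ln r + real (Suc n)) * (m r - m r0)"
      proof (cases "r0 \<le> r")
        case t: True
        then have "ln r0 \<le> ln r" using r0 True by simp
        then have "0 \<le> u * ln r + real (Suc n)" using u by (simp add: r0_def field_simps)
        moreover have "m r0 \<le> m r" using mono_onD[OF mono r0 True t] .
        ultimately show ?thesis by simp
      next
        case f: False
        then have "ln r \<le> ln r0" using r0 True by simp
        then have "u * ln r + real (Suc n) \<le> 0" using u by (simp add: r0_def field_simps)
        moreover have "m r \<le> m r0" using mono_onD[OF mono True r0] f by simp
        ultimately show ?thesis by (simp add: mult_nonpos_nonpos)
      qed
      then have "0 \<le> k * ((u * ln r + real (Suc n)) * (m r - m r0))" using k by (rule mult_nonneg_nonneg[rotated])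
      then show ?thesis by (simp add: w_eq algebra_simps)
    qed (simp add: w_def)
  qed
  also have "\<dots> = (- 1) ^ n * (u * ln_moment m (Suc n) u + real (Suc n) * ln_moment m n u)" by (rule val[OF m nn c])
  also have "\<dots> \<le> (- 1) ^ n * bernstein_deriv b m (Suc n) u"
    using b by (cases "n = 0") (auto simp: bernstein_deriv_def)
  finally show ?thesis .
qed

lemma bernstein_function_Phi:
  assumes m: "m \<in> borel_measurable (lebesgue_on {0<..<1})" and nn: "\<forall>r\<in>{0<..<1}. 0 \<le> m r"
    and mono: "mono_on {0<..<1} m" and b: "0 \<le> b"
    and fin: "\<And>u. 0 < u \<Longrightarrow> Phi_nn m u < \<infinity>"
  shows "bernstein_function (\<lambda>u. b * u + u * ln_moment m 0 u)"
proof -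
  have der: "(bernstein_deriv b m n has_real_derivative bernstein_deriv b m (Suc n) u) (at u)" if "0 < u" for n u
    using that by (intro bernstein_deriv_has_derivative[OF m nn fin, of "u / 2"]) auto
  have iter: "(deriv ^^ n) (bernstein_deriv b m 0) u = bernstein_deriv b m n u"
    and diff: "(deriv ^^ n) (bernstein_deriv b m 0) differentiable (at u)" if "0 < u" for n u
    by (rule iterated_deriv_eq[of "bernstein_deriv b m"]; use der that in blast)+
  have eq: "(\<lambda>u. b * u + u * ln_moment m 0 u) = bernstein_deriv b m 0" by (simp add: bernstein_deriv_def fun_eq_iff)
  have "0 \<le> ln_moment m 0 u" for u
    unfolding ln_moment_def using nn by (intro Bochner_Integration.integral_nonneg) (auto simp: indicator_def)
  then have "0 \<le> bernstein_deriv b m 0 u" if "0 < u" for u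
    using that b by (simp add: bernstein_deriv_def)
  moreover have "0 \<le> (- 1) ^ n * (deriv ^^ Suc n) (bernstein_deriv b m 0) u" if "0 < u" for n u
    unfolding iter[OF that]
    using that by (intro bernstein_deriv_sign[OF m nn mono b that fin[of "u / 2"]]) auto
  ultimately show ?thesis
    unfolding bernstein_function_def eq
    using diff by blast
qed

section \<open>Stieltjes measure of a monotone function, built from its generalized inverse; the
  inserted 0 keeps the supremum over a nonempty set\<close>

definition monotone_quantile :: "(real \<Rightarrow> real) \<Rightarrow> real \<Rightarrow> real" where
  "monotone_quantile k y = Sup (insert 0 {r \<in> {0<..<1}. k r \<le> y})"

text \<open>Left-continuity, in the form \<open>left\<close>, moves y < k r to a point r' < r, and
  by monotonicity nothing beyond r' contributes to the supremum. This is where the strict inequality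
  comes from.\<close>

lemma monotone_quantile_less_iff:
  assumes mono: "mono_on {0<..<1} k"
    and left: "\<And>r. r \<in> {0<..<1} \<Longrightarrow> y < k r \<Longrightarrow> \<exists>r'. r' \<in> {0<..<r} \<and> y < k r'"
    and r: "r \<in> {0<..<1}"
  shows "monotone_quantile k y < r \<longleftrightarrow> y < k r"
proof
  assume lt: "monotone_quantile k y < r"
  show "y < k r"
  proof (rule ccontr)
    assume "\<not> y < k r"
    then have "r \<le> monotone_quantile k y"
      unfolding monotone_quantile_def using r by (intro cSup_upper bdd_aboveI[of _ 1]) auto
    with lt show False by simp
  qed
next
  assume "y < k r"
  then obtain r' where r': "r' \<in> {0<..<r}" "y < k r'" using left[OF r] by blast
  have "monotone_quantile k y \<le> r'"
    unfolding monotone_quantile_def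
  proof (rule cSup_least)
    fix s assume "s \<in> insert 0 {r \<in> {0<..<1}. k r \<le> y}"
    then show "s \<le> r'"
    proof
      assume s: "s \<in> {r \<in> {0<..<1}. k r \<le> y}"
      show "s \<le> r'"
      proof (rule ccontr)
        assume "\<not> s \<le> r'"
        then have "k r' \<le> k s" using s r r' by (intro mono_onD[OF mono]) auto
        then show False using s r' by simp
      qed
    qed (use r' in simp)
  qed simp
  then show "monotone_quantile k y < r" using r' by simp
qed

lemma monotone_quantile_measurable [measurable]: "monotone_quantile k \<in> borel_measurable borel"
proof (rule borel_measurable_mono, rule monoI)
  fix x y :: real assume "x \<le> y"
  then show "monotone_quantile k x \<le> monotone_quantile k y"
    unfolding monotone_quantile_def by (intro cSup_subset_mono bdd_aboveI[of _ 1]) auto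
qed

text \<open>The image of Lebesgue measure on (0,\<infinity>) under the quantile gives (0,r) the
  length of {y > 0. y < k r}, which is k r; \<open>small\<close> keeps mass away from 0. For the
  last bound, the logarithmic weight at r is at most 1 - r, the length of (r,1), and Fubini turns
  the resulting integral into that of k.\<close>

lemma stieltjes_measure_exists:
  fixes k :: "real \<Rightarrow> real"
  assumes nn: "\<forall>r\<in>{0<..<1}. 0 \<le> k r" and mono: "mono_on {0<..<1} k"
    and left: "\<And>y r. r \<in> {0<..<1} \<Longrightarrow> y < k r \<Longrightarrow> \<exists>r'. r' \<in> {0<..<r} \<and> y < k r'"
    and small: "\<And>y. 0 < y \<Longrightarrow> \<exists>r\<in>{0<..<1}. k r \<le> y"
  obtains \<mu> :: "real measure" where "sets \<mu> = sets borel"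
    "\<forall>r\<in>{0<..<1}. emeasure \<mu> {0<..<r} = ennreal (k r)"
    "(\<integral>\<^sup>+r\<in>{0<..<1}. ennreal (min (- ln r) 1 * r) \<partial>\<mu>) \<le> (\<integral>\<^sup>+r\<in>{0<..<1}. ennreal (k r) \<partial>lborel)"
proof -
  let ?q = "monotone_quantile k"
  have q_less: "?q y < r \<longleftrightarrow> y < k r" if "r \<in> {0<..<1}" for y r
    by (rule monotone_quantile_less_iff[OF mono _ that]) (rule left)
  have q_pos: "0 < ?q y" if y: "0 < y" for y
  proof -
    obtain r where r: "r \<in> {0<..<1}" "k r \<le> y" using small[OF y] by blast
    then have "r \<le> ?q y"
      unfolding monotone_quantile_def by (intro cSup_upper bdd_aboveI[of _ 1]) auto
    then show ?thesis using r by simp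
  qed
  define N where "N = density lborel (indicator {0<..} :: real \<Rightarrow> ennreal)"
  have [measurable_cong]: "sets N = sets borel" by (simp add: N_def)
  define \<mu> where "\<mu> = distr N borel ?q"
  have sets: "sets \<mu> = sets borel" by (simp add: \<mu>_def)
  have em: "emeasure \<mu> {0<..<r} = ennreal (k r)" if r: "r \<in> {0<..<1}" for r
  proof -
    have "emeasure \<mu> {0<..<r} = (\<integral>\<^sup>+y. indicator {0<..<r} y \<partial>\<mu>)" by (simp add: sets)
    also have "\<dots> = (\<integral>\<^sup>+y. indicator {0<..} y * indicator {0<..<r} (?q y) \<partial>lborel)"
      unfolding \<mu>_def by (subst nn_integral_distr, measurable) (simp add: N_def nn_integral_density)
    also have "\<dots> = (\<integral>\<^sup>+y. indicator {0<..<k r} y \<partial>lborel)"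
      using q_pos q_less[OF r] by (intro nn_integral_cong) (auto simp: indicator_def)
    finally show ?thesis using nn r by simp
  qed
  have bnd: "min (- ln r) 1 * r \<le> 1 - r" if "0 < r" "r < 1" for r :: real
  proof -
    have "- ln r \<le> 1 / r - 1" using ln_le_minus_one[of "1 / r"] that by (simp add: ln_div)
    then have "- ln r * r \<le> (1 / r - 1) * r" using that by (intro mult_right_mono) auto
    moreover have "min (- ln r) 1 * r \<le> - ln r * r" using that by (intro mult_right_mono) auto
    ultimately show ?thesis using that by (simp add: left_diff_distrib)
  qed
  have "(\<integral>\<^sup>+r\<in>{0<..<1}. ennreal (min (- ln r) 1 * r) \<partial>\<mu>)
    = (\<integral>\<^sup>+y. indicator {0<..} y * (ennreal (min (- ln (?q y)) 1 * ?q y) * indicator {0<..<1} (?q y)) \<partial>lborel)"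
    unfolding \<mu>_def by (subst nn_integral_distr, measurable) (simp add: N_def nn_integral_density)
  also have "\<dots> \<le> (\<integral>\<^sup>+y. \<integral>\<^sup>+s. (if 0 < y \<and> 0 < ?q y \<and> ?q y < s \<and> s < 1 then 1 else 0) \<partial>lborel \<partial>lborel)"
  proof (intro nn_integral_mono)
    fix y
    show "indicator {0<..} y * (ennreal (min (- ln (?q y)) 1 * ?q y) * indicator {0<..<1} (?q y))
      \<le> (\<integral>\<^sup>+s. (if 0 < y \<and> 0 < ?q y \<and> ?q y < s \<and> s < 1 then 1 else 0) \<partial>lborel)"
    proof (cases "0 < y \<and> 0 < ?q y \<and> ?q y < 1")
      case True
      have "ennreal (min (- ln (?q y)) 1 * ?q y) \<le> ennreal (1 - ?q y)"
        using True by (intro ennreal_leI bnd) auto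
      also have "\<dots> = (\<integral>\<^sup>+s. indicator {?q y<..<1} s \<partial>lborel)" using True by simp
      also have "\<dots> = (\<integral>\<^sup>+s. (if 0 < y \<and> 0 < ?q y \<and> ?q y < s \<and> s < 1 then 1 else 0) \<partial>lborel)"
        using True by (intro nn_integral_cong) (auto simp: indicator_def)
      finally show ?thesis using True by simp
    qed (auto simp: indicator_def)
  qed
  also have "\<dots> = (\<integral>\<^sup>+s. \<integral>\<^sup>+y. (if 0 < y \<and> 0 < ?q y \<and> ?q y < s \<and> s < 1 then 1 else 0) \<partial>lborel \<partial>lborel)"
    by (rule lborel_pair.Fubini') measurable
  also have "\<dots> \<le> (\<integral>\<^sup>+s\<in>{0<..<1}. ennreal (k s) \<partial>lborel)"
  proof (rule nn_integral_mono)
    fix s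
    show "(\<integral>\<^sup>+y. (if 0 < y \<and> 0 < ?q y \<and> ?q y < s \<and> s < 1 then 1 else 0) \<partial>lborel) \<le> ennreal (k s) * indicator {0<..<1} s"
    proof (cases "s \<in> {0<..<1}")
      case True
      have "(\<integral>\<^sup>+y. (if 0 < y \<and> 0 < ?q y \<and> ?q y < s \<and> s < 1 then 1 else 0) \<partial>lborel) \<le> (\<integral>\<^sup>+y. indicator {0<..<k s} y \<partial>lborel)"
        using q_less[OF True] by (intro nn_integral_mono) (auto simp: indicator_def)
      then show ?thesis using True nn by simp
    next
      case False
      then have "(\<integral>\<^sup>+y. (if 0 < y \<and> 0 < ?q y \<and> ?q y < s \<and> s < 1 then 1 else 0) \<partial>lborel) = (\<integral>\<^sup>+(y::real). (0 :: ennreal) \<partial>lborel)"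
        by (intro nn_integral_cong) auto
      then show ?thesis by simp
    qed
  qed
  finally show ?thesis using sets em by (intro that[of \<mu>]) auto
qed

text \<open>\<open>m r\<close> is the mass of an open interval (0,r), hence left-continuous by
  continuity of measures from below; the power of r in the tilt is continuous.\<close>

lemma rep_B_left_continuous:
  assumes rep: "rep_B \<phi> b m" and r: "r \<in> {0<..<1}" and y: "y < m_tilt \<alpha> m r"
  shows "\<exists>r'. r' \<in> {0<..<r} \<and> y < m_tilt \<alpha> m r'"
proof -
  from rep obtain \<mu> where sets: "sets \<mu> = sets borel"
    and em: "\<And>r. r \<in> {0<..<1} \<Longrightarrow> emeasure \<mu> {0<..<r} = ennreal (m r)"
    and nn: "\<forall>r\<in>{0<..<1}. 0 \<le> m r"
    unfolding rep_B_def by blast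
  \<comment> \<open>With n + 2 in the denominator the sequence starts at r/2, inside the
    interval.\<close>
  define s where "s n = r - r / real (n + 2)" for n
  have s: "0 < s n" "s n < r" "s n \<le> s (Suc n)" for n
    using r by (auto simp: s_def field_simps add_pos_nonneg)
  have "(\<lambda>n. r - r / real (n + 2)) \<longlonglongrightarrow> r - 0"
    by (intro tendsto_intros LIMSEQ_ignore_initial_segment[of "\<lambda>n. r / real n"] lim_const_over_n)
  then have s_lim: "s \<longlonglongrightarrow> r" by (simp add: s_def[abs_def])
  have U: "(\<Union>n. {0<..<s n}) = {0<..<r}"
  proof (intro equalityI subsetI)
    fix x assume x: "x \<in> {0<..<r}"
    then obtain n where "x < s n" using order_tendstoD(1)[OF s_lim, of x] by (auto dest: eventually_happens)
    then show "x \<in> (\<Union>n. {0<..<s n})" using x by auto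
  qed (use s in \<open>auto intro: order.strict_trans\<close>)
  have "(\<lambda>n. emeasure \<mu> {0<..<s n}) \<longlonglongrightarrow> emeasure \<mu> (\<Union>n. {0<..<s n})"
  proof (intro Lim_emeasure_incseq incseq_SucI subsetI)
    show "x \<in> {0<..<s (Suc n)}" if "x \<in> {0<..<s n}" for x n using that s(3)[of n] by auto
  qed (auto simp: sets)
  then have "(\<lambda>n. ennreal (m (s n))) \<longlonglongrightarrow> ennreal (m r)"
    unfolding U using em[OF r] em[of "s _"] s r order.strict_trans[OF s(2)] by simp
  then have "(\<lambda>n. m (s n)) \<longlonglongrightarrow> m r"
    using nn r s order.strict_trans[OF s(2)] by (subst (asm) tendsto_ennreal_iff) (auto intro!: always_eventually)
  then have "(\<lambda>n. m_tilt \<alpha> m (s n)) \<longlonglongrightarrow> m_tilt \<alpha> m r"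
    unfolding m_tilt_def using r by (intro tendsto_intros s_lim) auto
  then obtain n where "y < m_tilt \<alpha> m (s n)"
    using order_tendstoD(1)[OF _ y] eventually_happens[of _ sequentially] by (metis trivial_limit_sequentially)
  then show ?thesis using s by auto
qed

text \<open>If k stayed above y > 0, comparison with a constant weight would give y/u \<le>
  \<open>Phi_nn k 0\<close> for every u > 0.\<close>

lemma Phi_nn_0_finite_imp_small:
  assumes nn: "\<forall>r\<in>{0<..<1}. 0 \<le> k r" and fin: "Phi_nn k 0 < \<infinity>" and y: "0 < y"
  shows "\<exists>r\<in>{0<..<1}. k r \<le> y"
proof (rule ccontr)
  assume "\<not> (\<exists>r\<in>{0<..<1}. k r \<le> y)"
  then have big: "\<And>r. r \<in> {0<..<1} \<Longrightarrow> y \<le> k r" by force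
  obtain x where x: "Phi_nn k 0 = ennreal x" "0 \<le> x" using fin by (cases "Phi_nn k 0") auto
  \<comment> \<open>This choice makes y/u equal to x + 1, contradicting the bound x.\<close>
  define u where "u = y / (x + 1)"
  have u: "0 < u" using x y by (simp add: u_def)
  have "ennreal y * Phi_nn (\<lambda>_. 1) u = (\<integral>\<^sup>+r. ennreal y * (ennreal (r powr (u - 1) * 1) * indicator {0<..<1} r) \<partial>lebesgue)"
    unfolding Phi_nn_def
    by (rule nn_integral_cmult[symmetric]) (rule borel_imp_lebesgue_measurable, measurable)
  also have "\<dots> \<le> Phi_nn k u"
    unfolding Phi_nn_def
  proof (rule nn_integral_mono)
    fix r
    show "ennreal y * (ennreal (r powr (u - 1) * 1) * indicator {0<..<1} r) \<le> ennreal (r powr (u - 1) * k r) * indicator {0<..<1} r"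
    proof (cases "r \<in> {0<..<1}")
      case True
      then have "r powr (u - 1) * y \<le> r powr (u - 1) * k r" using big by (intro mult_left_mono) auto
      then show ?thesis using True y by (auto simp: ennreal_mult[symmetric] mult.commute intro: ennreal_leI)
    qed simp
  qed
  also have "\<dots> \<le> Phi_nn k 0" by (rule Phi_nn_mono[OF nn]) (use u in simp)
  finally have "ennreal (y * (1 / u)) \<le> ennreal x" using u y by (simp add: Phi_nn_one ennreal_mult[symmetric] x)
  then have "y * (1 / u) \<le> x" using x by (subst (asm) ennreal_le_iff) auto
  then show False using x y by (simp add: u_def)
qed

text \<open>Tilting shifts the points of infinite value to the right by \<alpha>, but an abscissa
  sees only nonpositive points. The hypothesis \<open>neg\<close> puts all of them below -\<alpha>,
  so none is lost by the shift.\<close>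

lemma abscissa_tilt_less:
  assumes z: "abscissa (Phi_ext b (m_tilt \<alpha> m)) < ereal x" and neg: "abscissa (Phi_ext b m) < ereal (- \<alpha>)"
  shows "abscissa (Phi_ext b m) < ereal (x - \<alpha>)"
proof -
  \<comment> \<open>A supremum yields only weak inequalities; the intermediate point restores
    strictness.\<close>
  obtain y where y: "abscissa (Phi_ext b (m_tilt \<alpha> m)) < ereal y" and "ereal y < ereal x"
    using ereal_dense2[OF z] by (elim exE conjE)
  then have yx: "y < x" by simp
  have "abscissa (Phi_ext b m) \<le> ereal (y - \<alpha>)"
    unfolding abscissa_def[of "Phi_ext b m"]
  proof (rule Sup_least)
    fix e assume "e \<in> ereal ` {u. u \<le> 0 \<and> \<bar>Phi_ext b m u\<bar> = \<infinity>}"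
    then obtain v where e: "e = ereal v" and v: "v \<le> 0" "\<bar>Phi_ext b m v\<bar> = \<infinity>"
      by (elim imageE CollectE conjE)
    have "ereal v \<le> abscissa (Phi_ext b m)" unfolding abscissa_def using v by (intro Sup_upper imageI CollectI conjI)
    with neg have "ereal v < ereal (- \<alpha>)" by (rule order.strict_trans1[rotated])
    then have lt: "v + \<alpha> < 0" by simp
    have "Phi_nn m v = \<infinity>" using v(2) unfolding Phi_ext_infinite_iff by (rule conjunct2)
    then have "Phi_nn (m_tilt \<alpha> m) (v + \<alpha>) = \<infinity>" by (simp only: Phi_nn_tilt add_diff_cancel_right')
    then have "\<bar>Phi_ext b (m_tilt \<alpha> m) (v + \<alpha>)\<bar> = \<infinity>"
      using lt unfolding Phi_ext_infinite_iff by (intro conjI) simp_all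
    then have "ereal (v + \<alpha>) \<le> abscissa (Phi_ext b (m_tilt \<alpha> m))"
      unfolding abscissa_def using lt by (intro Sup_upper imageI CollectI conjI) simp_all
    with y have "ereal (v + \<alpha>) < ereal y" by (rule order.strict_trans1[rotated])
    then show "e \<le> ereal (y - \<alpha>)" by (simp add: e)
  qed
  also have "\<dots> < ereal (x - \<alpha>)" using yx by simp
  finally show ?thesis .
qed

text \<open>Points w close to \<alpha> > 0 have Re w > 0, so w - \<alpha> lies strictly to the right
  of -\<alpha> and hence of the abscissa, where \<phi> is given by its integral.\<close>

lemma bold_eq_Phi_rep:
  assumes \<alpha>: "0 < \<alpha>" and m: "m \<in> borel_measurable (lebesgue_on {0<..<1})"
    and rep: "rep_B_star \<alpha> \<phi> b m" and z: "abscissa (Phi_ext b m) < ereal (Re z - \<alpha>)"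
  shows "bold \<alpha> m \<phi> z = Phi b (m_tilt \<alpha> m) z"
proof -
  have nn: "\<forall>r\<in>{0<..<1}. 0 \<le> m r" and int: "set_integrable lebesgue {0<..<1} (\<lambda>r. m r / r)"
    and ext: "\<And>z. abscissa (Phi_ext b m) < ereal (Re z) \<Longrightarrow> \<phi> z = Phi b m z"
    and ab: "abscissa (Phi_ext b m) \<le> ereal (- \<alpha>)"
    using rep unfolding rep_B_star_def rep_B_def by auto
  show ?thesis
  proof (rule bold_eq_Phi[OF m nn])
    show "z \<in> Phi_dom (m_tilt \<alpha> m)"
      unfolding Phi_dom_iff[OF m_tilt_measurable[OF m] m_tilt_nonneg[OF nn]] Phi_nn_tilt
      by (rule Phi_nn_finite[OF int nn z])
    have "(Re \<longlongrightarrow> Re (of_real \<alpha>)) (at (of_real \<alpha>) within Phi_dom (m_tilt \<alpha> m))" by (intro tendsto_intros)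
    then have "\<forall>\<^sub>F w in at (of_real \<alpha>) within Phi_dom (m_tilt \<alpha> m). 0 < Re w" using \<alpha> by (intro order_tendstoD) auto
    then show "\<forall>\<^sub>F w in at (of_real \<alpha>) within Phi_dom (m_tilt \<alpha> m). \<phi> (w - of_real \<alpha>) = Phi b m (w - of_real \<alpha>)"
    proof eventually_elim
      case (elim w)
      show ?case by (rule ext, rule order.strict_trans1[OF ab]) (use elim in simp)
    qed
    show "\<phi> (z - of_real \<alpha>) = Phi b m (z - of_real \<alpha>)" by (rule ext) (use z in simp)
  qed
qed

lemma bold_bernstein:
  assumes \<alpha>: "0 < \<alpha>" and m: "m \<in> borel_measurable (lebesgue_on {0<..<1})"
    and rep: "rep_B_star \<alpha> \<phi> b m" and mono: "mono_on {0<..<1} (m_tilt \<alpha> m)"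
  shows "\<exists>g. bernstein_function g \<and> (\<forall>u>0. bold \<alpha> m \<phi> (of_real u) = of_real (g u))"
proof (intro exI conjI allI impI)
  have nn: "\<forall>r\<in>{0<..<1}. 0 \<le> m r" and int: "set_integrable lebesgue {0<..<1} (\<lambda>r. m r / r)"
    and b: "0 \<le> b" and ab: "abscissa (Phi_ext b m) \<le> ereal (- \<alpha>)"
    using rep unfolding rep_B_star_def rep_B_def by auto
  have lt: "abscissa (Phi_ext b m) < ereal (u - \<alpha>)" if "0 < u" for u
    by (rule order.strict_trans1[OF ab]) (use that in simp)
  show "bernstein_function (\<lambda>u. b * u + u * ln_moment (m_tilt \<alpha> m) 0 u)"
  proof (rule bernstein_function_Phi[OF m_tilt_measurable[OF m] m_tilt_nonneg[OF nn] mono b])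
    show "Phi_nn (m_tilt \<alpha> m) u < \<infinity>" if "0 < u" for u
      unfolding Phi_nn_tilt by (rule Phi_nn_finite[OF int nn lt[OF that]])
  qed
  show "bold \<alpha> m \<phi> (of_real u) = of_real (b * u + u * ln_moment (m_tilt \<alpha> m) 0 u)" if "0 < u" for u
    using bold_eq_Phi_rep[OF \<alpha> m rep, of "of_real u"] lt[OF that] by (simp add: Phi_of_real)
qed

text \<open>The strict inequality for the abscissa makes the integral finite at -\<alpha>, that is,
  m_\<alpha>(r)/r is integrable: this is the finite mean of the new function, and it also forces
  m_\<alpha> to become arbitrarily small near 0, as the construction of its measure needs.\<close>

lemma bold_in_class_B:
  assumes \<alpha>: "0 < \<alpha>" and m: "m \<in> borel_measurable (lebesgue_on {0<..<1})"
    and rep: "rep_B_star \<alpha> \<phi> b m" and mono: "mono_on {0<..<1} (m_tilt \<alpha> m)"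
    and ab: "abscissa (Phi_ext b m) < ereal (- \<alpha>)"
  shows "bold \<alpha> m \<phi> \<in> class_B"
proof -
  let ?k = "m_tilt \<alpha> m"
  have repB: "rep_B \<phi> b m" using rep unfolding rep_B_star_def by blast
  have nn: "\<forall>r\<in>{0<..<1}. 0 \<le> m r" and int: "set_integrable lebesgue {0<..<1} (\<lambda>r. m r / r)"
    and b: "0 \<le> b" and eq: "\<And>u. 0 \<le> u \<Longrightarrow> \<phi> (of_real u) = Phi b m (of_real u)"
    and nz: "\<exists>u\<ge>0. \<phi> (of_real u) \<noteq> 0"
    using repB unfolding rep_B_def by auto
  note k_nn = m_tilt_nonneg[OF nn, of \<alpha>] and k_m = m_tilt_measurable[OF m, of \<alpha>]
  have fin: "Phi_nn ?k u < \<infinity>" if "0 \<le> u" for u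
    unfolding Phi_nn_tilt
    by (rule Phi_nn_finite[OF int nn], rule order.strict_trans2[OF ab]) (use that in simp)
  obtain \<mu> where \<mu>: "sets \<mu> = sets borel" "\<forall>r\<in>{0<..<1}. emeasure \<mu> {0<..<r} = ennreal (?k r)"
    "(\<integral>\<^sup>+r\<in>{0<..<1}. ennreal (min (- ln r) 1 * r) \<partial>\<mu>) \<le> (\<integral>\<^sup>+r\<in>{0<..<1}. ennreal (?k r) \<partial>lborel)"
    by (rule stieltjes_measure_exists[OF k_nn mono rep_B_left_continuous[OF repB] Phi_nn_0_finite_imp_small[OF k_nn fin]]) auto
  have "(\<lambda>r. ennreal (?k r) * indicator {0<..<1} r) \<in> borel_measurable borel"
    using measurable_compose[OF borel_measurable_mono_on_fnc[OF mono] measurable_ennreal]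
    by (subst (asm) borel_measurable_restrict_space_iff_ennreal) auto
  then have "(\<integral>\<^sup>+r\<in>{0<..<1}. ennreal (?k r) \<partial>lborel) = (\<integral>\<^sup>+r\<in>{0<..<1}. ennreal (?k r) \<partial>lebesgue)"
    by (intro nn_integral_completion[symmetric])
  also have "\<dots> = Phi_nn ?k 1"
    unfolding Phi_nn_def by (intro nn_integral_cong) (auto simp: indicator_def)
  finally have \<mu>3: "(\<integral>\<^sup>+r\<in>{0<..<1}. ennreal (min (- ln r) 1 * r) \<partial>\<mu>) < \<infinity>"
    using \<mu>(3) fin[of 1] by (simp add: order.strict_trans1)
  have "rep_B (bold \<alpha> m \<phi>) b ?k"
    unfolding rep_B_def
  proof (intro conjI)
    show "\<exists>\<mu>. sets \<mu> = sets borel \<and> (\<forall>r\<in>{0<..<1}. emeasure \<mu> {0<..<r} = ennreal (?k r)) \<and>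
        (\<integral>\<^sup>+r\<in>{0<..<1}. ennreal (min (- ln r) 1 * r) \<partial>\<mu>) < \<infinity>"
      using \<mu>(1,2) \<mu>3 by blast
    have "integrable lebesgue (\<lambda>r. indicator {0<..<1} r * (r powr (0 - 1) * ?k r))"
      by (rule Phi_nn_integrable[OF k_m k_nn fin]) simp
    then show "set_integrable lebesgue {0<..<1} (\<lambda>r. ?k r / r)"
      unfolding set_integrable_def
      by (rule Bochner_Integration.integrable_cong[OF refl, THEN iffD1, rotated])
        (simp add: indicator_def powr_minus_divide)
    show "\<forall>u\<ge>0. bold \<alpha> m \<phi> (of_real u) = Phi b ?k (of_real u)"
    proof (intro allI impI)
      fix u :: real assume "0 \<le> u"
      then show "bold \<alpha> m \<phi> (of_real u) = Phi b ?k (of_real u)"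
        by (intro bold_eq_Phi_rep[OF \<alpha> m rep] order.strict_trans2[OF ab]) simp
    qed
    show "\<forall>z. abscissa (Phi_ext b ?k) < ereal (Re z) \<longrightarrow> bold \<alpha> m \<phi> z = Phi b ?k z"
      by (intro allI impI bold_eq_Phi_rep[OF \<alpha> m rep] abscissa_tilt_less[OF _ ab])
    \<comment> \<open>A point where \<phi> does not vanish, shifted by \<alpha>, is one where the
      bold function does not vanish.\<close>
    obtain u where u: "0 \<le> u" "\<phi> (of_real u) \<noteq> 0" using nz by blast
    have "u \<noteq> 0" using u eq[of 0] by (auto simp: Phi_def)
    then have "bold \<alpha> m \<phi> (of_real (u + \<alpha>)) \<noteq> 0"
    proof -
      have "complex_of_real (u + \<alpha>) - of_real \<alpha> = of_real u" by simp
      moreover have "complex_of_real (u + \<alpha>) \<noteq> of_real \<alpha>" "complex_of_real (u + \<alpha>) \<noteq> 0"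
        using \<open>u \<noteq> 0\<close> u \<alpha> unfolding of_real_eq_iff of_real_eq_0_iff by auto
      ultimately show ?thesis using u(2) by (simp only: bold_def if_False mult_eq_0_iff divide_eq_0_iff eq_iff_diff_eq_0[of "complex_of_real (u + \<alpha>)" "of_real \<alpha>"]) simp
    qed
    then show "\<exists>u\<ge>0. bold \<alpha> m \<phi> (of_real u) \<noteq> 0" using u \<alpha> by (intro exI[of _ "u + \<alpha>"]) auto
  qed (use b k_nn mono in auto)
  then show ?thesis unfolding class_B_def by blast
qed

section \<open>Inversion of the time variable\<close>

lemma levy_sigma_finite:
  assumes lev: "levy_measure m Lev"
  shows "sigma_finite_measure Lev"
proof
  have sets: "sets Lev = sets borel" and zero: "emeasure Lev {..0} = 0"
    and tail: "\<And>y. 0 < y \<Longrightarrow> emeasure Lev {y<..} = ennreal (m (exp (- y)))"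
    using lev unfolding levy_measure_def by auto
  have space: "space Lev = UNIV" using sets_eq_imp_space_eq[OF sets] by simp
  show "\<exists>A. countable A \<and> A \<subseteq> sets Lev \<and> \<Union> A = space Lev \<and> (\<forall>a\<in>A. emeasure Lev a \<noteq> \<infinity>)"
  proof (intro exI conjI)
    let ?A = "insert {..0} (range (\<lambda>n. {1 / real (Suc n)<..}))"
    show "countable ?A" by simp
    show "?A \<subseteq> sets Lev" unfolding sets by auto
    show "\<forall>a\<in>?A. emeasure Lev a \<noteq> \<infinity>"
    proof
      fix a assume "a \<in> ?A"
      then consider "a = {..0}" | n where "a = {1 / real (Suc n)<..}" by blast
      then show "emeasure Lev a \<noteq> \<infinity>"
      proof cases
        case (2 n)
        then show ?thesis using tail[of "1 / real (Suc n)"] by simp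
      qed (simp add: zero)
    qed
    have "x \<in> \<Union> ?A" for x :: real
    proof (cases "x \<le> 0")
      case False
      then obtain n where "inverse (real (Suc n)) < x" using reals_Archimedean[of x] by auto
      then show ?thesis by (auto simp: inverse_eq_divide)
    qed auto
    then show "\<Union> ?A = space Lev" unfolding space by blast
  qed
qed

text \<open>The increment is written as an integral over e^(-y) < r < 1 by following f along x/r. In
  these variables the section over a fixed r is y > -ln r, whose Levy mass is m(r). The exchange is
  justified by the boundedness of s f'(s) and the integrability of m(r)/r.\<close>

lemma levy_increment_integral:
  fixes f :: "real \<Rightarrow> complex"
  assumes lev: "levy_measure m Lev" and m: "m \<in> borel_measurable (lebesgue_on {0<..<1})"
    and nn: "\<forall>r\<in>{0<..<1}. 0 \<le> m r" and int: "set_integrable lebesgue {0<..<1} (\<lambda>r. m r / r)"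
    and der': "\<forall>s>0. (f has_vector_derivative f' s) (at s)"
    and cont: "continuous_on {0<..} (\<lambda>s. of_real s * f' s)" and bnd': "\<forall>s>0. norm (of_real s * f' s) \<le> B"
    and x: "0 < x"
  shows "set_integrable Lev {0<..} (\<lambda>y. f (x * exp y) - f x)"
    and "set_integrable lebesgue {0<..<1} (\<lambda>r. of_real (x / r) * f' (x / r) / of_real r * of_real (m r))"
    and "(LINT y:{0<..}|Lev. f (x * exp y) - f x)
      = (LINT r:{0<..<1}|lebesgue. of_real (x / r) * f' (x / r) / of_real r * of_real (m r))"
proof -
  note der = der'[rule_format] and bnd = bnd'[rule_format]
  have sets [measurable_cong]: "sets Lev = sets borel"
    and tail: "\<And>y. 0 < y \<Longrightarrow> emeasure Lev {y<..} = ennreal (m (exp (- y)))"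
    using lev unfolding levy_measure_def by auto
  interpret Lev: sigma_finite_measure Lev by (rule levy_sigma_finite[OF lev])
  interpret LB: pair_sigma_finite Lev lborel ..
  \<comment> \<open>Extension by 0 makes s f'(s) Borel measurable on the whole line, where the
    derivative of f need not be.\<close>
  define g where "g s = indicator {0<..} s *\<^sub>R (of_real s * f' s)" for s
  have g [measurable]: "g \<in> borel_measurable borel"
    unfolding g_def[abs_def] by (rule borel_measurable_continuous_on_indicator) (use cont in auto)
  have g_bnd: "norm (g s) \<le> \<bar>B\<bar>" for s
    using bnd[of s] by (auto simp: g_def indicator_def)
  define h where "h y r = (if 0 < y \<and> exp (- y) < r \<and> r < 1 then g (x / r) / of_real r else 0)" for y r :: real
  have h [measurable]: "(\<lambda>(y, r). h y r) \<in> borel_measurable (Lev \<Otimes>\<^sub>M lborel)"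
    unfolding h_def by measurable
  have slice: "indicator {0<..<1} r *\<^sub>R (g (x / r) / of_real r * of_real (m r)) = (\<integral>y. h y r \<partial>Lev)"
    and slice_nn: "(\<integral>\<^sup>+y. norm (h y r) \<partial>Lev) \<le> ennreal (\<bar>B\<bar>) * ennreal (norm (indicator {0<..<1} r *\<^sub>R (m r / r)))" for r
  proof -
    have "(\<integral>y. h y r \<partial>Lev) = indicator {0<..<1} r *\<^sub>R (g (x / r) / of_real r * of_real (m r))
      \<and> (\<integral>\<^sup>+y. norm (h y r) \<partial>Lev) \<le> ennreal (\<bar>B\<bar>) * ennreal (norm (indicator {0<..<1} r *\<^sub>R (m r / r)))"
    proof (cases "r \<in> {0<..<1}")
      case True
      have hr: "h y r = indicator {- ln r<..} y *\<^sub>R (g (x / r) / of_real r)" for y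
      proof -
        have "exp (- y) < r \<longleftrightarrow> - ln r < y"
          using True ln_less_cancel_iff[of "exp (- y)" r] by auto
        moreover have "0 < - ln r" using True by simp
        ultimately have "(0 < y \<and> exp (- y) < r \<and> r < 1) \<longleftrightarrow> y \<in> {- ln r<..}"
          using True by (metis greaterThanLessThan_iff greaterThan_iff order.strict_trans)
        then show ?thesis unfolding h_def by (simp only: indicator_def) simp
      qed
      have tl: "emeasure Lev {- ln r<..} = ennreal (m r)" using tail[of "- ln r"] True by simp
      have "(\<integral>y. h y r \<partial>Lev) = measure Lev {- ln r<..} *\<^sub>R (g (x / r) / of_real r)"
        unfolding hr using tl by (subst integral_scaleR_left) (auto simp: sets)
      also have "measure Lev {- ln r<..} = m r" using tl nn True by (simp add: measure_def)
      finally have 1: "(\<integral>y. h y r \<partial>Lev) = m r *\<^sub>R (g (x / r) / of_real r)" .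
      have "(\<integral>\<^sup>+y. norm (h y r) \<partial>Lev) = (\<integral>\<^sup>+y. ennreal (norm (g (x / r) / of_real r)) * indicator {- ln r<..} y \<partial>Lev)"
        unfolding hr by (intro nn_integral_cong) (auto simp: indicator_def)
      also have "\<dots> = ennreal (norm (g (x / r) / of_real r)) * ennreal (m r)"
        using tl by (subst nn_integral_cmult_indicator) (auto simp: sets)
      also have "\<dots> = ennreal (norm (g (x / r)) * (m r / r))"
        using True nn by (simp add: ennreal_mult[symmetric] norm_divide)
      also have "\<dots> \<le> ennreal (\<bar>B\<bar> * (m r / r))"
        using True nn g_bnd by (intro ennreal_leI mult_right_mono) auto
      also have "\<dots> = ennreal (\<bar>B\<bar>) * ennreal (norm (indicator {0<..<1} r *\<^sub>R (m r / r)))"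
        using True nn by (subst ennreal_mult[symmetric]) auto
      finally have 2: "(\<integral>\<^sup>+y. norm (h y r) \<partial>Lev)
        \<le> ennreal (\<bar>B\<bar>) * ennreal (norm (indicator {0<..<1} r *\<^sub>R (m r / r)))" .
      have "indicator {0<..<1} r *\<^sub>R (g (x / r) / of_real r * of_real (m r)) = m r *\<^sub>R (g (x / r) / of_real r)"
        using True by (simp add: scaleR_conv_of_real)
      with 1 2 show ?thesis by (simp only: simp_thms)
    next
      case False
      have "h y r = 0" for y using False exp_gt_zero[of "- y"] by (auto simp: h_def simp del: exp_gt_zero)
      then show ?thesis using False by simp
    qed
    then show "indicator {0<..<1} r *\<^sub>R (g (x / r) / of_real r * of_real (m r)) = (\<integral>y. h y r \<partial>Lev)"
      and "(\<integral>\<^sup>+y. norm (h y r) \<partial>Lev) \<le> ennreal (\<bar>B\<bar>) * ennreal (norm (indicator {0<..<1} r *\<^sub>R (m r / r)))" by auto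
  qed
  have h_int: "integrable (Lev \<Otimes>\<^sub>M lborel) (\<lambda>(y, r). h y r)"
  proof (rule integrableI_bounded)
    have "(\<integral>\<^sup>+p. ennreal (norm (case p of (y, r) \<Rightarrow> h y r)) \<partial>(Lev \<Otimes>\<^sub>M lborel)) = (\<integral>\<^sup>+r. \<integral>\<^sup>+y. norm (h y r) \<partial>Lev \<partial>lborel)"
      by (subst LB.nn_integral_snd[symmetric]) auto
    also have "\<dots> = (\<integral>\<^sup>+r. \<integral>\<^sup>+y. norm (h y r) \<partial>Lev \<partial>lebesgue)"
      by (rule nn_integral_completion[symmetric])
    also have "\<dots> \<le> (\<integral>\<^sup>+r. ennreal (\<bar>B\<bar>) * ennreal (norm (indicator {0<..<1} r *\<^sub>R (m r / r))) \<partial>lebesgue)"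
      by (intro nn_integral_mono slice_nn)
    also have "\<dots> = ennreal (\<bar>B\<bar>) * (\<integral>\<^sup>+r. ennreal (norm (indicator {0<..<1} r *\<^sub>R (m r / r))) \<partial>lebesgue)"
      using measurable_compose[OF borel_measurable_integrable[OF int[unfolded set_integrable_def]]
          measurable_compose[OF borel_measurable_norm measurable_ennreal]]
      by (rule nn_integral_cmult)
    also have "\<dots> < \<infinity>"
      using int unfolding set_integrable_def integrable_iff_bounded by (simp add: ennreal_mult_less_top)
    finally show "(\<integral>\<^sup>+p. ennreal (norm (case p of (y, r) \<Rightarrow> h y r)) \<partial>(Lev \<Otimes>\<^sub>M lborel)) < \<infinity>" .
  qed measurable
  have ftc: "(\<integral>r. h y r \<partial>lborel) = indicator {0<..} y *\<^sub>R (f (x * exp y) - f x)" for y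
  proof (cases "0 < y")
    case True
    let ?e = "exp (- y)"
    have pos: "0 < r" if "?e \<le> r" for r using that exp_gt_zero[of "- y"] by linarith
    \<comment> \<open>The antiderivative in r is -f(x/r); at r = 1 and r = e^(-y) it takes the
      values -f(x) and -f(x e^y).\<close>
    have "has_bochner_integral lborel (\<lambda>r. indicator {?e..1} r *\<^sub>R (g (x / r) / of_real r)) (- f (x / 1) - (- f (x / ?e)))"
    proof (rule has_bochner_integral_FTC_Icc)
      show "?e \<le> 1" using True by simp
      show "((\<lambda>r. - f (x / r)) has_vector_derivative g (x / r) / of_real r) (at r within {?e..1})"
        if r: "?e \<le> r" "r \<le> 1" for r
      proof -
        have "((\<lambda>r. x / r) has_real_derivative - (x / r\<^sup>2)) (at r)"
          using pos[OF r(1)] by (auto intro!: derivative_eq_intros simp: power2_eq_square field_simps)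
        then have "(f \<circ> (\<lambda>r. x / r) has_vector_derivative - (x / r\<^sup>2) *\<^sub>R f' (x / r)) (at r)"
          using pos[OF r(1)] x
          by (intro vector_diff_chain_at der) (auto simp: has_real_derivative_iff_has_vector_derivative)
        then have "((\<lambda>r. - f (x / r)) has_vector_derivative - (- (x / r\<^sup>2) *\<^sub>R f' (x / r))) (at r)"
          unfolding comp_def by (rule has_vector_derivative_minus)
        also have "- (- (x / r\<^sup>2) *\<^sub>R f' (x / r)) = g (x / r) / of_real r"
          using pos[OF r(1)] x by (simp add: g_def scaleR_conv_of_real power2_eq_square)
        finally show ?thesis by (rule has_vector_derivative_at_within)
      qed
      have "continuous_on {?e..1} (\<lambda>r. of_real (x / r) * f' (x / r))"
        by (rule continuous_on_compose2[OF cont])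
           (use x pos in \<open>auto intro!: continuous_intros dest!: pos\<close>)
      then have "continuous_on {?e..1} (\<lambda>r. of_real (x / r) * f' (x / r) / of_real r)"
        by (rule continuous_on_divide) (auto intro!: continuous_intros dest: pos)
      then show "continuous_on {?e..1} (\<lambda>r. g (x / r) / of_real r)"
        by (rule continuous_on_cong[THEN iffD1, rotated -1]) (use x in \<open>auto simp: g_def dest: pos\<close>)
    qed
    then have "(\<integral>r. indicator {?e..1} r *\<^sub>R (g (x / r) / of_real r) \<partial>lborel) = f (x * exp y) - f x"
      by (simp add: has_bochner_integral_integral_eq exp_minus field_simps)
    moreover have "(\<integral>r. h y r \<partial>lborel) = (\<integral>r. indicator {?e..1} r *\<^sub>R (g (x / r) / of_real r) \<partial>lborel)"
    proof (rule integral_cong_AE)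
      show "AE r in lborel. h y r = indicator {?e..1} r *\<^sub>R (g (x / r) / of_real r)"
        using AE_lborel_singleton[of ?e] AE_lborel_singleton[of "1::real"]
        by eventually_elim (use True in \<open>auto simp: h_def indicator_def\<close>)
    qed (unfold h_def, measurable)
    ultimately show ?thesis using True by simp
  next
    case False
    then show ?thesis by (simp add: h_def)
  qed
  have "integrable Lev (\<lambda>y. \<integral>r. h y r \<partial>lborel)" using h_int by (rule LB.integrable_fst)
  then show "set_integrable Lev {0<..} (\<lambda>y. f (x * exp y) - f x)" unfolding ftc set_integrable_def .
  have gm: "indicator {0<..<1} r *\<^sub>R (g (x / r) / of_real r * of_real (m r))
      = indicator {0<..<1} r *\<^sub>R (of_real (x / r) * f' (x / r) / of_real r * of_real (m r))" for r
    using x by (cases "r \<in> {0<..<1}") (auto simp: g_def)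
  have i2: "integrable lborel (\<lambda>r. \<integral>y. h y r \<partial>Lev)" using h_int by (rule LB.integrable_snd)
  then have "integrable lebesgue (\<lambda>r. \<integral>y. h y r \<partial>Lev)" by (subst integrable_completion) auto
  then show "set_integrable lebesgue {0<..<1} (\<lambda>r. of_real (x / r) * f' (x / r) / of_real r * of_real (m r))"
    unfolding set_integrable_def slice[symmetric] gm .
  have "(LINT y:{0<..}|Lev. f (x * exp y) - f x) = (\<integral>y. \<integral>r. h y r \<partial>lborel \<partial>Lev)"
    unfolding ftc set_lebesgue_integral_def ..
  also have "\<dots> = (\<integral>r. \<integral>y. h y r \<partial>Lev \<partial>lborel)" using LB.Fubini_integral[OF h_int] by simp
  also have "\<dots> = (\<integral>r. \<integral>y. h y r \<partial>Lev \<partial>lebesgue)"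
    using i2 by (intro integral_completion[symmetric]) auto
  finally show "(LINT y:{0<..}|Lev. f (x * exp y) - f x)
      = (LINT r:{0<..<1}|lebesgue. of_real (x / r) * f' (x / r) / of_real r * of_real (m r))"
    unfolding set_lebesgue_integral_def slice[symmetric] gm .
qed

text \<open>The chain rule contributes -1/r^2, and at the point t r this is exactly the integrand of
  the increment formula for x = 1/t, up to the factor -1/t. The outer power is t^(-2 \<alpha>) times
  (1/t)^(-\<alpha>), the latter coming from the prefactor of \<open>A_op\<close> at 1/t.\<close>

lemma dstar_Lam:
  fixes f :: "real \<Rightarrow> complex"
  assumes m: "m \<in> borel_measurable (lebesgue_on {0<..<1})" and rep: "rep_B \<phi> b m" and lev: "levy_measure m Lev"
    and diff: "\<And>t. 0 < t \<Longrightarrow> f differentiable (at t)"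
    and C_b: "(\<lambda>t. of_real t * vector_derivative f (at t)) \<in> C_b" and t: "0 < t"
  shows "dstar_defined m (Lam f) t"
    and "set_integrable Lev {0<..} (\<lambda>y. f (1 / t * exp y) - f (1 / t))"
    and "dstar \<alpha> b m (Lam f) t = - of_real (t powr (- (2 * \<alpha>))) * Lam (A_op \<alpha> b Lev f) t"
proof -
  let ?f' = "\<lambda>s. vector_derivative f (at s)"
  have nn: "\<forall>r\<in>{0<..<1}. 0 \<le> m r" and int: "set_integrable lebesgue {0<..<1} (\<lambda>r. m r / r)"
    using rep unfolding rep_B_def by auto
  have der: "\<forall>s>0. (f has_vector_derivative ?f' s) (at s)"
    using diff by (auto simp: vector_derivative_works[symmetric])
  obtain B where B: "\<forall>s>0. norm (of_real s * ?f' s) \<le> B"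
    using C_b unfolding C_b_def bounded_iff by auto
  have cont: "continuous_on {0<..} (\<lambda>s. of_real s * ?f' s)" using C_b unfolding C_b_def by auto
  have x: "0 < 1 / t" using t by simp
  note inc = levy_increment_integral[OF lev m nn int der cont B x]
  have L_der: "(Lam f has_vector_derivative - (1 / r\<^sup>2) *\<^sub>R ?f' (1 / r)) (at r)" if r: "0 < r" for r
  proof -
    have "((\<lambda>r. 1 / r) has_real_derivative - (1 / r\<^sup>2)) (at r)"
      using r by (auto intro!: derivative_eq_intros simp: power2_eq_square field_simps)
    then show ?thesis
      unfolding Lam_def using r
      by (intro vector_diff_chain_at der[rule_format]) (auto simp: has_real_derivative_iff_has_vector_derivative)
  qed
  then have vd: "vector_derivative (Lam f) (at r) = - of_real (1 / r\<^sup>2) * ?f' (1 / r)" if "0 < r" for r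
    using vector_derivative_at[OF L_der[OF that]] by (simp add: scaleR_conv_of_real)
  have ind: "indicator {0<..<1} r *\<^sub>R (vector_derivative (Lam f) (at (t * r)) * of_real (m r))
    = - of_real (1 / t) * (indicator {0<..<1} r *\<^sub>R (of_real (1 / t / r) * ?f' (1 / t / r) / of_real r * of_real (m r)))" for r
    using t by (cases "r \<in> {0<..<1}") (auto simp: vd power2_eq_square divide_simps)
  show "set_integrable Lev {0<..} (\<lambda>y. f (1 / t * exp y) - f (1 / t))" by (rule inc(1))
  show "dstar_defined m (Lam f) t"
    unfolding dstar_defined_def
  proof (intro conjI ballI)
    show "Lam f differentiable at r" if "r \<in> {0<..t}" for r
      using L_der[of r] that by (auto intro: differentiableI_vector)
    show "set_integrable lebesgue {0<..<t} (\<lambda>r. vector_derivative (Lam f) (at r) * of_real (m (r / t)))"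
      unfolding weighted_derivative_scale(1)[OF t, where m = m] unfolding set_integrable_def ind
      using inc(2) unfolding set_integrable_def by (intro integrable_mult_right)
  qed
  have "(LINT r:{0<..<t}|lebesgue. vector_derivative (Lam f) (at r) * of_real (m (r / t)))
    = of_real t * (- of_real (1 / t) * (LINT y:{0<..}|Lev. f (1 / t * exp y) - f (1 / t)))"
    unfolding weighted_derivative_scale(2)[OF t, where m = m] inc(3)
    unfolding set_lebesgue_integral_def ind integral_mult_right_zero ..
  also have "\<dots> = - (LINT y:{0<..}|Lev. f (1 / t * exp y) - f (1 / t))" using t by simp
  finally have I: "(LINT r:{0<..<t}|lebesgue. vector_derivative (Lam f) (at r) * of_real (m (r / t)))
    = - (LINT y:{0<..}|Lev. f (1 / t * exp y) - f (1 / t))" .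
  have "t powr (1 - \<alpha>) = t powr (- \<alpha>) * t" using t by (simp add: powr_diff powr_minus field_simps)
  moreover have "t powr (- (2 * \<alpha>)) * (1 / t) powr (- \<alpha>) = t powr (- \<alpha>)"
    using t by (simp add: powr_minus powr_divide powr_add[symmetric] field_simps)
  then have "complex_of_real (t powr (- (2 * \<alpha>))) * of_real ((1 / t) powr (- \<alpha>)) = of_real (t powr (- \<alpha>))"
    by (simp only: of_real_mult[symmetric])
  ultimately show "dstar \<alpha> b m (Lam f) t = - of_real (t powr (- (2 * \<alpha>))) * Lam (A_op \<alpha> b Lev f) t"
    using t unfolding dstar_def I vd[OF t]
    by (simp add: Lam_def A_op_def mult.assoc[symmetric] power2_eq_square) (simp add: algebra_simps)
qed

lemma Lam_Lam: "Lam (Lam f) = f"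
  by (simp add: Lam_def comp_def)

section \<open>Eigenfunctions\<close>

lemma abscissa_le_0: "abscissa g \<le> 0"
  unfolding abscissa_def by (rule Sup_least) (auto simp: zero_ereal_def)

lemma abscissa_scale_less:
  assumes \<alpha>: "0 < \<alpha>" and x: "abscissa (\<lambda>u. Phi_ext b m (\<alpha> * u)) < ereal x"
  shows "abscissa (Phi_ext b m) < ereal (\<alpha> * x)"
proof -
  obtain y where y: "abscissa (\<lambda>u. Phi_ext b m (\<alpha> * u)) < ereal y" and "ereal y < ereal x"
    using ereal_dense2[OF x] by (elim exE conjE)
  then have yx: "y < x" by simp
  have "abscissa (Phi_ext b m) \<le> ereal (\<alpha> * y)"
    unfolding abscissa_def[of "Phi_ext b m"]
  proof (rule Sup_least)
    fix e assume "e \<in> ereal ` {u. u \<le> 0 \<and> \<bar>Phi_ext b m u\<bar> = \<infinity>}"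
    then obtain v where e: "e = ereal v" and v: "v \<le> 0" "\<bar>Phi_ext b m v\<bar> = \<infinity>"
      by (elim imageE CollectE conjE)
    have "\<alpha> * (v / \<alpha>) = v" "v / \<alpha> \<le> 0" using \<alpha> v by (auto simp: divide_le_0_iff)
    then have "ereal (v / \<alpha>) \<le> abscissa (\<lambda>u. Phi_ext b m (\<alpha> * u))"
      unfolding abscissa_def using v by (intro Sup_upper imageI CollectI conjI) simp_all
    with y have "ereal (v / \<alpha>) < ereal y" by (rule order.strict_trans1[rotated])
    then show "e \<le> ereal (\<alpha> * y)" using \<alpha> by (simp add: e divide_less_eq mult.commute)
  qed
  also have "\<dots> < ereal (\<alpha> * x)" using yx \<alpha> by simp
  finally show ?thesis .
qed

lemma ln_moment_0_nonneg: "\<forall>r\<in>{0<..<1}. 0 \<le> m r \<Longrightarrow> 0 \<le> ln_moment m 0 u"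
  unfolding ln_moment_def by (intro Bochner_Integration.integral_nonneg) (auto simp: indicator_def)

text \<open>The right side does not mention u: the integral vanishes at every admissible exponent or
  at none.\<close>

lemma ln_moment_0_zero_iff:
  assumes m: "m \<in> borel_measurable (lebesgue_on {0<..<1})" and nn: "\<forall>r\<in>{0<..<1}. 0 \<le> m r"
    and u: "Phi_nn m u < \<infinity>"
  shows "ln_moment m 0 u = 0 \<longleftrightarrow> (AE r in lebesgue. r \<in> {0<..<1} \<longrightarrow> m r = 0)"
proof -
  have int: "integrable lebesgue (\<lambda>r. indicator {0<..<1} r * (r powr (u - 1) * m r))"
    by (rule Phi_nn_integrable[OF m nn u])
  have "ln_moment m 0 u = 0 \<longleftrightarrow> (AE r in lebesgue. indicator {0<..<1} r * (r powr (u - 1) * m r) = 0)"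
    unfolding ln_moment_def power_0 mult_1
    by (rule integral_nonneg_eq_0_iff_AE[OF int]) (use nn in \<open>auto simp: indicator_def\<close>)
  also have "\<dots> \<longleftrightarrow> (AE r in lebesgue. r \<in> {0<..<1} \<longrightarrow> m r = 0)"
    by (rule AE_cong) (auto simp: indicator_def)
  finally show ?thesis .
qed

text \<open>The term v ln r r^(v-1) m(r) must be dominated as a whole, because ln r m(r)/r need not
  be integrable: v |ln r| r^v \<le> 1 uniformly in v, so twice m(r)/r dominates the
  integrand.\<close>

lemma bernstein_deriv_1_tendsto:
  assumes m: "m \<in> borel_measurable (lebesgue_on {0<..<1})" and nn: "\<forall>r\<in>{0<..<1}. 0 \<le> m r"
    and fin: "Phi_nn m 0 < \<infinity>"
  shows "(bernstein_deriv b m 1 \<longlongrightarrow> b + ln_moment m 0 0) (at_right 0)"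
  unfolding tendsto_at_iff_sequentially comp_def
proof (intro allI impI)
  fix X :: "nat \<Rightarrow> real" assume X: "\<forall>i. X i \<in> {0<..} - {0}" and lim: "X \<longlonglongrightarrow> 0"
  let ?f = "\<lambda>v r. v * (indicator {0<..<1} r * (ln r ^ 1 * r powr (v - 1) * m r)) + indicator {0<..<1} r * (ln r ^ 0 * r powr (v - 1) * m r)"
  have eq: "bernstein_deriv b m 1 (X n) = b + (\<integral>r. ?f (X n) r \<partial>lebesgue)" for n
  proof -
    note i = ln_moment_integrable[OF m nn fin, of "X n"]
    have "0 < X n" using X by auto
    then show ?thesis
      by (subst Bochner_Integration.integral_add) (use i[of 0] i[of 1] in \<open>auto simp: bernstein_deriv_def ln_moment_def\<close>)
  qed
  have "(\<lambda>n. \<integral>r. ?f (X n) r \<partial>lebesgue) \<longlonglongrightarrow> (\<integral>r. indicator {0<..<1} r * (ln r ^ 0 * r powr (0 - 1) * m r) \<partial>lebesgue)"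
  proof (rule integral_dominated_convergence[where w = "\<lambda>r. 2 * (indicator {0<..<1} r * (r powr (0 - 1) * m r))"])
    show "integrable lebesgue (\<lambda>r. 2 * (indicator {0<..<1} r * (r powr (0 - 1) * m r)))"
      by (intro integrable_mult_right Phi_nn_integrable[OF m nn fin])
    show "AE r in lebesgue. (\<lambda>n. ?f (X n) r) \<longlonglongrightarrow> indicator {0<..<1} r * (ln r ^ 0 * r powr (0 - 1) * m r)"
    proof (intro always_eventually allI)
      fix r
      show "(\<lambda>n. ?f (X n) r) \<longlonglongrightarrow> indicator {0<..<1} r * (ln r ^ 0 * r powr (0 - 1) * m r)"
      proof (cases "r \<in> {0<..<1}")
        case True
        have p: "(\<lambda>n. r powr (X n - 1)) \<longlonglongrightarrow> r powr (0 - 1)"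
          using True lim by (intro tendsto_powr tendsto_intros) auto
        have "(\<lambda>n. X n * (ln r * r powr (X n - 1) * m r) + r powr (X n - 1) * m r)
          \<longlonglongrightarrow> 0 * (ln r * r powr (0 - 1) * m r) + r powr (0 - 1) * m r"
          by (intro tendsto_add tendsto_mult lim p tendsto_const)
        then show ?thesis using True by simp
      qed simp
    qed
    show "AE r in lebesgue. norm (?f (X n) r) \<le> 2 * (indicator {0<..<1} r * (r powr (0 - 1) * m r))" for n
    proof (intro always_eventually allI)
      fix r
      have X0: "0 < X n" using X by auto
      show "norm (?f (X n) r) \<le> 2 * (indicator {0<..<1} r * (r powr (0 - 1) * m r))"
      proof (cases "r \<in> {0<..<1}")
        case True
        have "norm (?f (X n) r) \<le> X n * norm (indicator {0<..<1} r * (ln r ^ 1 * r powr (X n - 1) * m r)) + norm (indicator {0<..<1} r * (ln r ^ 0 * r powr (X n - 1) * m r))"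
          using X0 by (intro norm_triangle_le) (simp add: abs_mult)
        also have "\<dots> \<le> X n * (fact 1 / X n ^ 1 * (indicator {0<..<1} r * (r powr (0 - 1) * m r))) + fact 0 / X n ^ 0 * (indicator {0<..<1} r * (r powr (0 - 1) * m r))"
          using X0 by (intro add_mono mult_left_mono ln_moment_dominated[OF nn]) auto
        also have "\<dots> = 2 * (indicator {0<..<1} r * (r powr (0 - 1) * m r))" using X0 by simp
        finally show ?thesis .
      qed simp
    qed
  qed (intro borel_measurable_add borel_measurable_times borel_measurable_const ln_moment_measurable[OF m] | rule ln_moment_measurable[OF m])+
  then have "(\<lambda>n. b + (\<integral>r. ?f (X n) r \<partial>lebesgue)) \<longlonglongrightarrow> b + ln_moment m 0 0"
    unfolding ln_moment_def by (intro tendsto_intros)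
  then show "(\<lambda>n. bernstein_deriv b m 1 (X n)) \<longlonglongrightarrow> b + ln_moment m 0 0" unfolding eq .
qed

lemma dstar_of_derivative:
  assumes t: "0 < t" and der: "\<forall>s\<in>{0<..t}. (F has_vector_derivative F' s) (at s)"
    and int: "integrable lebesgue (\<lambda>r. indicator {0<..<1} r *\<^sub>R (F' (t * r) * of_real (k r)))"
    and val: "(\<integral>r. indicator {0<..<1} r *\<^sub>R (F' (t * r) * of_real (k r)) \<partial>lebesgue) = J"
  shows "dstar_defined k F t"
    and "dstar \<alpha> b k F t = of_real (t powr (1 - \<alpha>)) * (of_real b * F' t + J)"
proof -
  have vd: "vector_derivative F (at s) = F' s" if "s \<in> {0<..t}" for s
    using der that by (intro vector_derivative_at) auto
  have ind: "indicator {0<..<1} r *\<^sub>R (vector_derivative F (at (t * r)) * of_real (k r))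
    = indicator {0<..<1} r *\<^sub>R (F' (t * r) * of_real (k r))" for r
    using t by (cases "r \<in> {0<..<1}") (auto simp: vd)
  show "dstar_defined k F t"
    unfolding dstar_defined_def
  proof (intro conjI ballI)
    show "F differentiable at s" if "s \<in> {0<..t}" for s
      using der that by (auto intro: differentiableI_vector)
    show "set_integrable lebesgue {0<..<t} (\<lambda>r. vector_derivative F (at r) * of_real (k (r / t)))"
      unfolding weighted_derivative_scale(1)[OF t, where m = k] unfolding set_integrable_def ind by (rule int)
  qed
  have I: "(LINT r:{0<..<t}|lebesgue. vector_derivative F (at r) * of_real (k (r / t))) = of_real t * J"
    unfolding weighted_derivative_scale(2)[OF t, where m = k] unfolding set_lebesgue_integral_def ind val ..
  have "t powr (1 - \<alpha>) = t powr (- \<alpha>) * t" using t by (simp add: powr_diff powr_minus field_simps)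
  then show "dstar \<alpha> b k F t = of_real (t powr (1 - \<alpha>)) * (of_real b * F' t + J)"
    using t unfolding dstar_def I vd[of t] by (simp add: vd algebra_simps)
qed

section \<open>The exponent \<open>psi\<close> = \<phi>_\<alpha> on the half line, its slope at 0,
  and the power series of the eigenfunction\<close>

locale bernstein_rep =
  fixes \<alpha> b :: real and m :: "real \<Rightarrow> real" and \<phi> :: "complex \<Rightarrow> complex"
  assumes \<alpha>: "0 < \<alpha>" and m: "m \<in> borel_measurable (lebesgue_on {0<..<1})" and rep: "rep_B \<phi> b m"
begin

lemma b_nonneg: "0 \<le> b" and m_nonneg: "\<forall>r\<in>{0<..<1}. 0 \<le> m r" and m_mono: "mono_on {0<..<1} m"
  and m_int: "set_integrable lebesgue {0<..<1} (\<lambda>r. m r / r)"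
  and phi_real: "0 \<le> u \<Longrightarrow> \<phi> (of_real u) = Phi b m (of_real u)"
  and phi_ext: "abscissa (Phi_ext b m) < ereal (Re z) \<Longrightarrow> \<phi> z = Phi b m z"
  and phi_nonzero: "\<exists>u\<ge>0. \<phi> (of_real u) \<noteq> 0"
  using rep unfolding rep_B_def by auto

lemma Phi_nn_fin: "0 \<le> u \<Longrightarrow> Phi_nn m u < \<infinity>"
  using Phi_nn_mono[OF m_nonneg] Phi_nn_0_finite[OF m_int m_nonneg] by (blast intro: order.strict_trans1)

definition psi :: "complex \<Rightarrow> complex" where "psi z = \<phi> (of_real \<alpha> * z)"

definition psi_real :: "real \<Rightarrow> real" where "psi_real u = bernstein_deriv b m 0 (\<alpha> * u)"

definition slope :: real where "slope = \<alpha> * (b + ln_moment m 0 0)"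

lemma psi_real_eq: "psi_real u = \<alpha> * u * (b + ln_moment m 0 (\<alpha> * u))"
  by (simp add: psi_real_def bernstein_deriv_def algebra_simps)

lemma psi_of_real: "0 \<le> u \<Longrightarrow> psi (of_real u) = of_real (psi_real u)"
  using phi_real[of "\<alpha> * u"] \<alpha> Phi_of_real[of b m "\<alpha> * u"]
  by (simp add: psi_def psi_real_def bernstein_deriv_def)

text \<open>If \<phi> is nonzero at some point, then either b > 0 or m is not almost everywhere 0,
  and this makes the sum positive at every exponent, including 0.\<close>

lemma coeff_pos: "0 \<le> u \<Longrightarrow> 0 < b + ln_moment m 0 u"
proof -
  assume u: "0 \<le> u"
  obtain w where w: "0 \<le> w" "\<phi> (of_real w) \<noteq> 0" using phi_nonzero by blast
  then have "b * w + w * ln_moment m 0 w \<noteq> 0"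
    using phi_real Phi_of_real[of b m w] by (metis of_real_0)
  then have "b \<noteq> 0 \<or> ln_moment m 0 w \<noteq> 0" by auto
  then have "b \<noteq> 0 \<or> ln_moment m 0 u \<noteq> 0"
    using ln_moment_0_zero_iff[OF m m_nonneg Phi_nn_fin] u w by blast
  then show ?thesis using b_nonneg ln_moment_0_nonneg[OF m_nonneg, of u] by linarith
qed

lemma slope_pos: "0 < slope"
  using coeff_pos[of 0] \<alpha> by (simp add: slope_def)

lemma psi_real_pos: "0 < u \<Longrightarrow> 0 < psi_real u"
  unfolding psi_real_eq using coeff_pos[of "\<alpha> * u"] \<alpha> by simp

lemma psi_real_has_derivative:
  "0 < u \<Longrightarrow> (psi_real has_real_derivative \<alpha> * bernstein_deriv b m 1 (\<alpha> * u)) (at u)"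
proof -
  assume u: "0 < u"
  have "(bernstein_deriv b m 0 has_real_derivative bernstein_deriv b m (Suc 0) (\<alpha> * u)) (at (\<alpha> * u))"
    by (rule bernstein_deriv_has_derivative[OF m m_nonneg Phi_nn_fin[of 0]]) (use u \<alpha> in auto)
  moreover have "((\<lambda>u. \<alpha> * u) has_real_derivative \<alpha>) (at u)" by (auto intro!: derivative_eq_intros)
  ultimately have "((\<lambda>u. bernstein_deriv b m 0 (\<alpha> * u)) has_real_derivative bernstein_deriv b m (Suc 0) (\<alpha> * u) * \<alpha>) (at u)"
    by (rule DERIV_chain2)
  then show ?thesis by (simp add: psi_real_def[abs_def] mult.commute)
qed

lemma psi_real_mono:
  assumes u: "0 < u" and uv: "u \<le> v"
  shows "psi_real u \<le> psi_real v"
proof (rule DERIV_nonneg_imp_nondecreasing[OF uv])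
  fix x assume "u \<le> x" "x \<le> v"
  then have x: "0 < x" using u by simp
  have "0 \<le> (- 1) ^ 0 * bernstein_deriv b m (Suc 0) (\<alpha> * x)"
    by (rule bernstein_deriv_sign[OF m m_nonneg m_mono b_nonneg _ Phi_nn_fin[of 0]]) (use x \<alpha> in auto)
  then show "\<exists>y. (psi_real has_real_derivative y) (at x) \<and> 0 \<le> y"
    using psi_real_has_derivative[OF x] \<alpha>
      by (intro exI[of _ "\<alpha> * bernstein_deriv b m 1 (\<alpha> * x)"] conjI) auto
qed

lemma deriv_0plus_psi: "deriv_0plus psi = slope"
  unfolding deriv_0plus_def
proof (rule tendsto_Lim)
  have ev: "deriv (\<lambda>u. Re (psi (of_real u))) u = \<alpha> * bernstein_deriv b m 1 (\<alpha> * u)" if u: "0 < u" for u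
  proof (rule DERIV_imp_deriv)
    show "((\<lambda>u. Re (psi (of_real u))) has_real_derivative \<alpha> * bernstein_deriv b m 1 (\<alpha> * u)) (at u)"
      by (rule has_field_derivative_transform_within_open[OF psi_real_has_derivative[OF u], of "{0<..}"])
         (use u in \<open>auto simp: psi_of_real\<close>)
  qed
  have "filterlim (\<lambda>u. \<alpha> * u) (at_right 0) (at_right 0)"
  proof -
    have "((\<lambda>u. \<alpha> * u) \<longlongrightarrow> \<alpha> * 0) (at_right 0)" by (intro tendsto_intros)
    then show ?thesis using \<alpha> by (auto simp: filterlim_at eventually_at_filter)
  qed
  then have "((\<lambda>u. \<alpha> * bernstein_deriv b m 1 (\<alpha> * u)) \<longlongrightarrow> slope) (at_right 0)"
    unfolding slope_def
    by (intro tendsto_mult tendsto_const filterlim_compose[OF bernstein_deriv_1_tendsto[OF m m_nonneg Phi_nn_fin]]) auto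
  then show "(deriv (\<lambda>u. Re (psi (of_real u))) \<longlongrightarrow> slope) (at_right 0)"
    by (rule Lim_transform_eventually) (auto simp: eventually_at_filter ev)
qed simp

text \<open>By monotonicity the limit exists in the extended reals and is a supremum; in that form,
  being inside the disc of convergence is witnessed by a single integer \<open>N\<close>.\<close>

lemma at_infty_psi: "at_infty psi = (SUP u\<in>{1..}. ereal (psi_real u))"
  unfolding at_infty_def
proof (rule tendsto_Lim)
  let ?L = "SUP u\<in>{1..}. ereal (psi_real u)"
  show "((\<lambda>u::real. ereal (Re (psi (of_real u)))) \<longlongrightarrow> ?L) at_top"
  proof (rule order_tendstoI)
    fix a assume "a < ?L"
    then obtain u where u: "1 \<le> u" "a < ereal (psi_real u)" by (auto simp: less_SUP_iff)
    show "\<forall>\<^sub>F v in at_top. a < ereal (Re (psi (of_real v)))"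
      using eventually_ge_at_top[of u]
    proof eventually_elim
      case (elim v)
      then have "ereal (psi_real u) \<le> ereal (psi_real v)" using u psi_real_mono[of u v] by simp
      then show ?case using u elim by (simp add: psi_of_real order.strict_trans2)
    qed
  next
    fix a assume a: "?L < a"
    show "\<forall>\<^sub>F v in at_top. ereal (Re (psi (of_real v))) < a"
      using eventually_ge_at_top[of 1]
    proof eventually_elim
      case (elim v)
      then have "ereal (psi_real v) \<le> ?L" by (intro SUP_upper) auto
      then show ?case using a elim by (simp add: psi_of_real order.strict_trans1)
    qed
  qed
qed simp

lemma psi_real_le_at_infty: "0 < u \<Longrightarrow> ereal (psi_real u) \<le> at_infty psi"
proof -
  assume u: "0 < u"
  have "ereal (psi_real u) \<le> ereal (psi_real (max 1 u))" using psi_real_mono[OF u, of "max 1 u"] by simp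
  also have "\<dots> \<le> at_infty psi" unfolding at_infty_psi by (rule SUP_upper) simp
  finally show ?thesis .
qed

lemma less_at_infty_psi:
  assumes "ereal x < at_infty psi"
  obtains N :: nat where "1 \<le> N" "x < psi_real (real N)"
proof -
  obtain u where u: "1 \<le> u" "x < psi_real u" using assms unfolding at_infty_psi by (auto simp: less_SUP_iff)
  obtain N where "u \<le> real N" using real_arch_simple by blast
  then show ?thesis using u psi_real_mono[of u "real N"] by (intro that[of N]) auto
qed

definition W_nat :: "nat \<Rightarrow> real" where "W_nat n = (\<Prod>k=1..<n. psi_real (real k))"

text \<open>The value 1 at n = 0 is the limit convention n W(n) = 1/\<open>slope\<close>
  there.\<close>

definition E_coeff :: "nat \<Rightarrow> real" where
  "E_coeff n = (if n = 0 then 1 else 1 / (slope * (real n * W_nat n)))"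

definition E_real :: "real \<Rightarrow> real" where "E_real x = (\<Sum>n. E_coeff n * x ^ n)"

lemma W_nat_pos: "0 < W_nat n"
  unfolding W_nat_def by (intro prod_pos) (auto intro: psi_real_pos)

lemma E_coeff_pos: "0 < E_coeff n"
  using W_nat_pos[of n] slope_pos by (simp add: E_coeff_def)

lemma W_nat_Suc: "0 < n \<Longrightarrow> W_nat (Suc n) = psi_real (real n) * W_nat n"
  unfolding W_nat_def by (simp add: mult.commute)

text \<open>This is W(n+1) = psi(n) W(n) divided by n. Written with psi(n)/n it remains true for n =
  0, where the quotient is to be read as \<open>slope\<close>.\<close>

lemma E_coeff_rec: "diffs E_coeff n * (\<alpha> * (b + ln_moment m 0 (\<alpha> * real n))) = E_coeff n"
proof (cases "n = 0")
  case True
  then show ?thesis using slope_pos by (simp add: diffs_def E_coeff_def W_nat_def slope_def[symmetric])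
next
  case False
  have p: "psi_real (real n) = real n * (\<alpha> * (b + ln_moment m 0 (\<alpha> * real n)))"
    by (simp add: psi_real_eq)
  have "0 < psi_real (real n)" using False by (intro psi_real_pos) simp
  then have nz: "\<alpha> * (b + ln_moment m 0 (\<alpha> * real n)) \<noteq> 0" using p by auto
  have "diffs E_coeff n = 1 / (slope * (psi_real (real n) * W_nat n))"
    using False W_nat_Suc[of n] by (simp add: diffs_def E_coeff_def)
  then show ?thesis using False nz W_nat_pos[of n] slope_pos unfolding p by (simp add: E_coeff_def)
qed

text \<open>Consecutive coefficients have ratio at most 1/psi(n), and psi is increasing, so the
  radius of convergence is at least psi(N) for every N.\<close>

lemma E_coeff_summable:
  assumes N: "1 \<le> N" and x: "\<bar>x\<bar> < psi_real (real N)"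
  shows "summable (\<lambda>n. E_coeff n * x ^ n)"
proof (rule summable_ratio_test)
  let ?\<rho> = "psi_real (real N)"
  have \<rho>: "0 < ?\<rho>" using N by (intro psi_real_pos) simp
  show "\<bar>x\<bar> / ?\<rho> < 1" using x \<rho> by simp
  fix n assume n: "N \<le> n"
  have "W_nat (Suc n) = psi_real (real n) * W_nat n" using N n by (intro W_nat_Suc) simp
  moreover have "?\<rho> \<le> psi_real (real n)" using N n by (intro psi_real_mono) auto
  then have "?\<rho> * W_nat n \<le> psi_real (real n) * W_nat n" using W_nat_pos[of n] by simp
  ultimately have "real n * (?\<rho> * W_nat n) \<le> real (Suc n) * W_nat (Suc n)"
    using \<rho> W_nat_pos[of n] by (intro mult_mono) auto
  then have "slope * (?\<rho> * (real n * W_nat n)) \<le> slope * (real (Suc n) * W_nat (Suc n))"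
    using slope_pos by (simp add: mult_ac)
  moreover have "0 < slope * (?\<rho> * (real n * W_nat n))" using slope_pos \<rho> W_nat_pos[of n] N n by simp
  ultimately have "1 / (slope * (real (Suc n) * W_nat (Suc n))) \<le> 1 / (slope * (?\<rho> * (real n * W_nat n)))"
    by (intro divide_left_mono) auto
  also have "\<dots> = E_coeff n / ?\<rho>" using N n by (simp add: E_coeff_def)
  finally have "E_coeff (Suc n) \<le> E_coeff n / ?\<rho>" by (simp add: E_coeff_def)
  then have "E_coeff (Suc n) * (\<bar>x\<bar> * \<bar>x\<bar> ^ n) \<le> E_coeff n / ?\<rho> * (\<bar>x\<bar> * \<bar>x\<bar> ^ n)"
    by (intro mult_right_mono) auto
  then show "norm (E_coeff (Suc n) * x ^ Suc n) \<le> \<bar>x\<bar> / ?\<rho> * norm (E_coeff n * x ^ n)"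
    using E_coeff_pos[of n] E_coeff_pos[of "Suc n"] by (simp add: abs_mult power_abs less_imp_le mult_ac)
qed

text \<open>At positive integers psi is positive, so the recursion, stated as a quotient, can be
  solved for W(n+1) and yields the product \<open>W_nat\<close>.\<close>

lemma E_series_eq:
  assumes W1: "W 1 = 1" and rec: "\<And>n. 0 < n \<Longrightarrow> W (of_nat n) = W (of_nat n + 1) / psi (of_nat n)"
    and N: "1 \<le> N" and x: "\<bar>x\<bar> < psi_real (real N)"
  shows "E_series psi W (of_real x) = of_real (E_real x)"
proof -
  have W: "W (of_nat (Suc n)) = of_real (W_nat (Suc n))" for n
  proof (induction n)
    case (Suc n)
    have "psi (of_nat (Suc n)) = of_real (psi_real (real (Suc n)))"
      using psi_of_real[of "real (Suc n)"] by (simp only: of_real_of_nat_eq of_nat_0_le_iff)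
    moreover have "0 < psi_real (real (Suc n))" by (rule psi_real_pos) simp
    ultimately have "W (of_nat (Suc n) + 1) = of_real (psi_real (real (Suc n))) * W (of_nat (Suc n))"
      using rec[of "Suc n"] by (simp del: of_nat_Suc)
    then show ?case using Suc by (simp add: W_nat_Suc add.commute del: of_nat_Suc) (simp add: add.commute)
  qed (simp add: W1 W_nat_def)
  have "of_real (E_coeff n * x ^ n) = 1 / of_real (deriv_0plus psi) *
     (if n = 0 then of_real (deriv_0plus psi) else of_real x ^ n / (of_nat n * W (of_nat n)))" for n
    using slope_pos W by (cases n) (auto simp: E_coeff_def deriv_0plus_psi simp del: of_nat_Suc)
  then have 1: "(\<lambda>n. 1 / of_real (deriv_0plus psi) *
     (if n = 0 then of_real (deriv_0plus psi) else of_real x ^ n / (of_nat n * W (of_nat n))))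
     = (\<lambda>n. complex_of_real (E_coeff n * x ^ n))" by (simp only:)
  have "summable (\<lambda>n. complex_of_real (E_coeff n * x ^ n))"
    using E_coeff_summable[OF N x] by (rule summable_of_real)
  then have s: "summable (\<lambda>n. if n = 0 then complex_of_real (deriv_0plus psi) else of_real x ^ n / (of_nat n * W (of_nat n)))"
    unfolding 1[symmetric] using slope_pos by (subst (asm) summable_cmult_iff) (simp add: deriv_0plus_psi)
  show ?thesis
    unfolding E_series_def E_real_def suminf_mult[OF s, symmetric] 1
    by (rule suminf_of_real[symmetric, OF E_coeff_summable[OF N x]])
qed

lemma E_real_has_derivative:
  assumes N: "1 \<le> N" and x: "\<bar>x\<bar> < psi_real (real N)"
  shows "(E_real has_real_derivative (\<Sum>n. diffs E_coeff n * x ^ n)) (at x)"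
    and "summable (\<lambda>n. diffs E_coeff n * x ^ n)"
proof -
  let ?k = "(\<bar>x\<bar> + psi_real (real N)) / 2"
  have "summable (\<lambda>n. E_coeff n * ?k ^ n)" by (rule E_coeff_summable[OF N]) (use x in auto)
  then show "(E_real has_real_derivative (\<Sum>n. diffs E_coeff n * x ^ n)) (at x)"
    unfolding E_real_def[abs_def] by (rule termdiffs_strong) (use x in auto)
  show "summable (\<lambda>n. diffs E_coeff n * x ^ n)"
    by (rule termdiff_converges[of x "psi_real (real N)"]) (use x E_coeff_summable[OF N] in auto)
qed

text \<open>The n-th term of the derivative series, taken at x r^\<alpha>, integrates against m(r)/r
  to a \<open>ln_moment\<close> at \<alpha> n; together with the drift, \<open>E_coeff_rec\<close>
  turns it into the n-th term of the series itself. Since the drift is nonnegative, the same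
  recursion bounds the integrated norms by a multiple of the convergent series.\<close>

lemma E_real_integral:
  assumes N: "1 \<le> N" and x: "\<bar>x\<bar> < psi_real (real N)"
  defines "g \<equiv> \<lambda>r. indicator {0<..<1} r * ((\<Sum>n. diffs E_coeff n * (x * r powr \<alpha>) ^ n) * (r powr (0 - 1) * m r))"
  shows "integrable lebesgue g"
    and "\<alpha> * (b * (\<Sum>n. diffs E_coeff n * x ^ n) + (\<integral>r. g r \<partial>lebesgue)) = E_real x"
proof -
  let ?d = "diffs E_coeff"
  let ?H = "\<lambda>n. ln_moment m 0 (\<alpha> * real n)"
  have d_pos: "0 < ?d n" for n using E_coeff_pos[of "Suc n"] by (simp add: diffs_def)
  have H_nn: "0 \<le> ?H n" for n by (rule ln_moment_0_nonneg[OF m_nonneg])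
  define f where "f n r = ?d n * x ^ n * (indicator {0<..<1} r * (r powr (\<alpha> * real n - 1) * m r))" for n r
  have base_int: "integrable lebesgue (\<lambda>r. indicator {0<..<1} r * (r powr (\<alpha> * real n - 1) * m r))" for n
    using \<alpha> by (intro Phi_nn_integrable[OF m m_nonneg] Phi_nn_fin) simp
  have base_val: "(\<integral>r. indicator {0<..<1} r * (r powr (\<alpha> * real n - 1) * m r) \<partial>lebesgue) = ?H n" for n
    by (simp add: ln_moment_def)
  have f_int: "integrable lebesgue (f n)" for n
    unfolding f_def by (intro integrable_mult_right base_int)
  have f_val: "(\<integral>r. f n r \<partial>lebesgue) = ?d n * x ^ n * ?H n" for n
    unfolding f_def integral_mult_right_zero base_val ..
  have f_norm: "norm (f n r) = ?d n * \<bar>x\<bar> ^ n * (indicator {0<..<1} r * (r powr (\<alpha> * real n - 1) * m r))" for n r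
    using d_pos[of n] m_nonneg by (auto simp: f_def abs_mult power_abs indicator_def)
  have f_norm_val: "(\<integral>r. norm (f n r) \<partial>lebesgue) = ?d n * \<bar>x\<bar> ^ n * ?H n" for n
    unfolding f_norm integral_mult_right_zero base_val ..
  have sum_norm: "summable (\<lambda>n. \<integral>r. norm (f n r) \<partial>lebesgue)"
  proof (rule summable_comparison_test')
    show "summable (\<lambda>n. 1 / \<alpha> * (E_coeff n * \<bar>x\<bar> ^ n))"
      using x by (intro summable_mult E_coeff_summable[OF N]) simp
    fix n :: nat
    have "?d n * ?H n \<le> ?d n * (b + ?H n)" using d_pos[of n] b_nonneg by (simp add: less_imp_le)
    also have "\<dots> = 1 / \<alpha> * E_coeff n" using E_coeff_rec[of n] \<alpha> by (simp add: field_simps)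
    finally have "?d n * ?H n * \<bar>x\<bar> ^ n \<le> 1 / \<alpha> * E_coeff n * \<bar>x\<bar> ^ n" by (rule mult_right_mono) simp
    then show "norm (\<integral>r. norm (f n r) \<partial>lebesgue) \<le> 1 / \<alpha> * (E_coeff n * \<bar>x\<bar> ^ n)"
      unfolding f_norm_val using d_pos[of n] H_nn[of n] by (simp add: abs_mult less_imp_le mult_ac)
  qed
  have pw: "(\<lambda>n. f n r) sums g r \<and> summable (\<lambda>n. norm (f n r))" for r
  proof (cases "r \<in> {0<..<1}")
    case True
    have xr: "\<bar>x * r powr \<alpha>\<bar> < psi_real (real N)"
    proof -
      have "r powr \<alpha> \<le> 1" using True \<alpha> by (simp add: powr_le1)
      then have "\<bar>x\<bar> * r powr \<alpha> \<le> \<bar>x\<bar>" by (intro mult_left_le) auto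
      then show ?thesis using x True by (simp add: abs_mult)
    qed
    have f_eq: "f n r = ?d n * (x * r powr \<alpha>) ^ n * (r powr (0 - 1) * m r)" for n
    proof -
      have "r powr (\<alpha> * real n - 1) = (r powr \<alpha>) ^ n * r powr (0 - 1)"
        using True by (simp add: powr_power powr_diff powr_minus_divide mult.commute)
      then show ?thesis using True by (simp add: f_def power_mult_distrib)
    qed
    have "(\<lambda>n. ?d n * (x * r powr \<alpha>) ^ n * (r powr (0 - 1) * m r)) sums ((\<Sum>n. ?d n * (x * r powr \<alpha>) ^ n) * (r powr (0 - 1) * m r))"
      by (intro sums_mult2 summable_sums E_real_has_derivative(2)[OF N xr])
    moreover have "summable (\<lambda>n. ?d n * \<bar>x * r powr \<alpha>\<bar> ^ n * \<bar>r powr (0 - 1) * m r\<bar>)"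
      by (intro summable_mult2 E_real_has_derivative(2)[OF N]) (use xr in simp)
    then have "summable (\<lambda>n. norm (f n r))"
      using d_pos unfolding f_eq by (simp add: abs_mult power_abs less_imp_le)
    ultimately show ?thesis using True unfolding f_eq by (simp add: g_def)
  qed (simp add: f_def g_def)
  have g_eq: "g = (\<lambda>r. \<Sum>n. f n r)" using pw by (auto simp: sums_iff)
  have sn: "AE r in lebesgue. summable (\<lambda>n. norm (f n r))" using pw by auto
  show "integrable lebesgue g" unfolding g_eq by (rule integrable_suminf[OF f_int sn sum_norm])
  have s1: "summable (\<lambda>n. \<integral>r. f n r \<partial>lebesgue)"
    using summable_integral[OF f_int sn sum_norm] .
  have g_val: "(\<integral>r. g r \<partial>lebesgue) = (\<Sum>n. ?d n * x ^ n * ?H n)"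
    unfolding g_eq integral_suminf[OF f_int sn sum_norm] f_val ..
  have "b * (\<Sum>n. ?d n * x ^ n) + (\<integral>r. g r \<partial>lebesgue) = (\<Sum>n. b * (?d n * x ^ n) + ?d n * x ^ n * ?H n)"
    using suminf_add[OF summable_mult[OF E_real_has_derivative(2)[OF N x], of b] s1]
      suminf_mult[OF E_real_has_derivative(2)[OF N x], of b] unfolding g_val f_val by simp
  then have "\<alpha> * (b * (\<Sum>n. ?d n * x ^ n) + (\<integral>r. g r \<partial>lebesgue)) = \<alpha> * (\<Sum>n. b * (?d n * x ^ n) + ?d n * x ^ n * ?H n)"
    by simp
  also have "\<dots> = (\<Sum>n. \<alpha> * (b * (?d n * x ^ n) + ?d n * x ^ n * ?H n))"
    by (intro suminf_mult[symmetric] summable_add summable_mult E_real_has_derivative(2)[OF N x] s1[unfolded f_val])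
  also have "\<dots> = E_real x"
    unfolding E_real_def
  proof (rule suminf_cong)
    fix n
    have "\<alpha> * (b * (?d n * x ^ n) + ?d n * x ^ n * ?H n) = (?d n * (\<alpha> * (b + ?H n))) * x ^ n"
      by (simp add: algebra_simps)
    then show "\<alpha> * (b * (?d n * x ^ n) + ?d n * x ^ n * ?H n) = E_coeff n * x ^ n"
      unfolding E_coeff_rec .
  qed
  finally show "\<alpha> * (b * (\<Sum>n. ?d n * x ^ n) + (\<integral>r. g r \<partial>lebesgue)) = E_real x" .
qed

lemma dstar_E_real:
  assumes t: "0 < t" and N: "1 \<le> N" and q: "\<bar>q * t powr \<alpha>\<bar> < psi_real (real N)"
    and F: "\<And>s. 0 < s \<Longrightarrow> \<bar>q * s powr \<alpha>\<bar> < psi_real (real N) \<Longrightarrow> F s = of_real (E_real (q * s powr \<alpha>))"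
  shows "dstar_defined (m_tilt \<alpha> m) F t"
    and "dstar \<alpha> b (m_tilt \<alpha> m) F t = of_real q * F t"
proof -
  let ?S = "\<lambda>x. \<Sum>n. diffs E_coeff n * x ^ n"
  let ?x = "q * t powr \<alpha>"
  define F' where "F' s = complex_of_real (?S (q * s powr \<alpha>) * (q * (\<alpha> * s powr (\<alpha> - 1))))" for s
  have der: "\<forall>s\<in>{0<..t}. (F has_vector_derivative F' s) (at s)"
  proof
    fix s assume s: "s \<in> {0<..t}"
    have "s powr \<alpha> \<le> t powr \<alpha>" using s \<alpha> by (intro powr_mono2) auto
    then have "\<bar>q\<bar> * s powr \<alpha> \<le> \<bar>q\<bar> * t powr \<alpha>" by (rule mult_left_mono) simp
    then have qs: "\<bar>q * s powr \<alpha>\<bar> < psi_real (real N)" using q s t by (simp add: abs_mult)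
    have "((\<lambda>s. q * s powr \<alpha>) has_real_derivative q * (\<alpha> * s powr (\<alpha> - 1))) (at s)"
      using s by (auto intro!: derivative_eq_intros)
    then have D: "((\<lambda>s. q * s powr \<alpha>) has_real_derivative q * (\<alpha> * s powr (\<alpha> - 1))) (at s)" .
    have "((\<lambda>s. E_real (q * s powr \<alpha>)) has_real_derivative ?S (q * s powr \<alpha>) * (q * (\<alpha> * s powr (\<alpha> - 1)))) (at s)"
      by (rule DERIV_chain2[OF E_real_has_derivative(1)[OF N qs] D])
    then have "((\<lambda>s. complex_of_real (E_real (q * s powr \<alpha>))) has_vector_derivative F' s) (at s)"
      unfolding F'_def by (rule has_vector_derivative_of_real)
    \<comment> \<open>\<open>F\<close> coincides with the series only inside the disc. The
      inequality is strict, hence valid near s, which is enough for the derivative, even at the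
      right end s = t.\<close>
    moreover have "\<forall>\<^sub>F s' in nhds s. F s' = complex_of_real (E_real (q * s' powr \<alpha>))"
    proof -
      have "isCont (\<lambda>s. \<bar>q * s powr \<alpha>\<bar>) s" using s by (intro continuous_intros) auto
      then have "((\<lambda>s. \<bar>q * s powr \<alpha>\<bar>) \<longlongrightarrow> \<bar>q * s powr \<alpha>\<bar>) (nhds s)"
        using tendsto_at_iff_tendsto_nhds[of "\<lambda>s. \<bar>q * s powr \<alpha>\<bar>" s] by (simp only: isCont_def)
      then have "\<forall>\<^sub>F s' in nhds s. \<bar>q * s' powr \<alpha>\<bar> < psi_real (real N)" using qs by (rule order_tendstoD)
      moreover have "\<forall>\<^sub>F s' in nhds s. 0 < s'" using s by (intro eventually_nhds_in_open[of "{0<..}" s, simplified]) auto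
      ultimately show ?thesis by eventually_elim (rule F)
    qed
    ultimately show "(F has_vector_derivative F' s) (at s)"
      using F[OF _ qs] s by (subst has_vector_derivative_cong_ev) (auto elim!: eventually_mono)
  qed
  let ?g = "\<lambda>r. indicator {0<..<1} r * (?S (?x * r powr \<alpha>) * (r powr (0 - 1) * m r))"
  have ind: "indicator {0<..<1} r *\<^sub>R (F' (t * r) * of_real (m_tilt \<alpha> m r)) = of_real (q * \<alpha> * t powr (\<alpha> - 1) * ?g r)" for r
  proof (cases "r \<in> {0<..<1}")
    case True
    have 1: "q * (t * r) powr \<alpha> = ?x * r powr \<alpha>" using True t by (simp add: powr_mult)
    have "r powr (\<alpha> - 1) * r powr (- \<alpha>) = r powr (0 - 1)" by (simp add: powr_add[symmetric])
    then have 2: "(t * r) powr (\<alpha> - 1) * r powr (- \<alpha>) = t powr (\<alpha> - 1) * r powr (0 - 1)"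
      using True t by (simp add: powr_mult mult.assoc)
    have "?S (?x * r powr \<alpha>) * (q * (\<alpha> * (t * r) powr (\<alpha> - 1))) * (r powr (- \<alpha>) * m r)
      = q * \<alpha> * ((t * r) powr (\<alpha> - 1) * r powr (- \<alpha>)) * (?S (?x * r powr \<alpha>) * m r)" by (simp only: mult_ac)
    also have "\<dots> = q * \<alpha> * t powr (\<alpha> - 1) * (?S (?x * r powr \<alpha>) * (r powr (0 - 1) * m r))"
      unfolding 2 by (simp only: mult_ac)
    finally show ?thesis using True by (simp only: F'_def m_tilt_def 1 of_real_mult[symmetric] indicator_simps scaleR_one mult_1)
  qed simp
  note gi = E_real_integral[OF N q]
  have "dstar_defined (m_tilt \<alpha> m) F t \<and> dstar \<alpha> b (m_tilt \<alpha> m) F t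
    = of_real (t powr (1 - \<alpha>)) * (of_real b * F' t + of_real (q * \<alpha> * t powr (\<alpha> - 1) * (\<integral>r. ?g r \<partial>lebesgue)))"
  proof (intro conjI dstar_of_derivative[OF t der])
    show "integrable lebesgue (\<lambda>r. indicator {0<..<1} r *\<^sub>R (F' (t * r) * of_real (m_tilt \<alpha> m r)))"
      unfolding ind by (intro integrable_of_real integrable_mult_right gi(1))
    then show "integrable lebesgue (\<lambda>r. indicator {0<..<1} r *\<^sub>R (F' (t * r) * of_real (m_tilt \<alpha> m r)))" .
    show "(\<integral>r. indicator {0<..<1} r *\<^sub>R (F' (t * r) * of_real (m_tilt \<alpha> m r)) \<partial>lebesgue)
      = of_real (q * \<alpha> * t powr (\<alpha> - 1) * (\<integral>r. ?g r \<partial>lebesgue))"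
      unfolding ind integral_complex_of_real integral_mult_right_zero ..
    then show "(\<integral>r. indicator {0<..<1} r *\<^sub>R (F' (t * r) * of_real (m_tilt \<alpha> m r)) \<partial>lebesgue)
      = of_real (q * \<alpha> * t powr (\<alpha> - 1) * (\<integral>r. ?g r \<partial>lebesgue))" .
  qed
  then show "dstar_defined (m_tilt \<alpha> m) F t" by blast
  \<comment> \<open>Isolates t^(1-\<alpha>) t^(\<alpha>-1) = 1, so that the identity of
    \<open>E_real_integral\<close> remains.\<close>
  have factor: "A * (b * (S * (q * (\<alpha> * B))) + q * \<alpha> * B * I) = (A * B) * (q * (\<alpha> * (b * S + I)))"
    for A B S I :: real by (simp add: algebra_simps)
  have "t powr (1 - \<alpha>) * t powr (\<alpha> - 1) = 1" using t by (simp add: powr_add[symmetric])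
  then have "t powr (1 - \<alpha>) * (b * (?S ?x * (q * (\<alpha> * t powr (\<alpha> - 1)))) + q * \<alpha> * t powr (\<alpha> - 1) * (\<integral>r. ?g r \<partial>lebesgue))
    = q * (\<alpha> * (b * ?S ?x + (\<integral>r. ?g r \<partial>lebesgue)))" (is "?L = _")
    unfolding factor by simp
  also have "\<dots> = q * E_real ?x" unfolding gi(2) ..
  finally have eq: "?L = q * E_real ?x" .
  have "dstar \<alpha> b (m_tilt \<alpha> m) F t = of_real ?L"
    using \<open>dstar_defined (m_tilt \<alpha> m) F t \<and> _\<close> by (simp add: F'_def)
  also have "\<dots> = of_real q * F t" unfolding eq using F[OF t q] by simp
  finally show "dstar \<alpha> b (m_tilt \<alpha> m) F t = of_real q * F t" .
qed

section \<open>Bounded exponents: finite jump rate and the eigenfunction outside the disc\<close>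

lemma psi_real_le_of_bounded:
  assumes "at_infty psi < \<infinity>"
  shows "\<exists>C. \<forall>u>0. psi_real u \<le> C"
proof (intro exI allI impI)
  fix u :: real assume u: "0 < u"
  then have "ereal (psi_real u) \<le> at_infty psi" by (rule psi_real_le_at_infty)
  then show "psi_real u \<le> real_of_ereal (at_infty psi)"
    using assms by (cases "at_infty psi") auto
qed

lemma bounded_imp_no_drift:
  assumes "at_infty psi < \<infinity>"
  shows "b = 0"
proof (rule ccontr)
  assume "b \<noteq> 0"
  then have b: "0 < b" using b_nonneg by simp
  obtain C where C: "\<forall>u>0. psi_real u \<le> C" using psi_real_le_of_bounded[OF assms] by blast
  have C0: "0 < C" using C[rule_format, of 1] psi_real_pos[of 1] by simp
  \<comment> \<open>Chosen so that the drift alone contributes \<alpha> u b = C + 1.\<close>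
  define u where "u = (C + 1) / (\<alpha> * b)"
  have u: "0 < u" using C0 \<alpha> b by (simp add: u_def)
  have "C + 1 = \<alpha> * u * b" using \<alpha> b by (simp add: u_def)
  also have "\<dots> \<le> psi_real u"
    unfolding psi_real_eq using u \<alpha> ln_moment_0_nonneg[OF m_nonneg] by (intro mult_left_mono) auto
  also have "\<dots> \<le> C" by (rule C[rule_format, OF u])
  finally show False by simp
qed

text \<open>At n/\<alpha> the exponent is at least n times the integral of r^(n-1) m(r). Since m is
  nondecreasing, this integral is asymptotically at least m(c)/n for each c < 1, so m(c) inherits
  the bound.\<close>

lemma bounded_imp_weight_bounded:
  assumes "at_infty psi < \<infinity>"
  shows "\<exists>C\<ge>0. \<forall>c\<in>{0<..<1}. m c \<le> C"
proof -
  obtain C where C: "\<forall>u>0. psi_real u \<le> C" using psi_real_le_of_bounded[OF assms] by blast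
  have C0: "0 \<le> C" using C[rule_format, of 1] psi_real_pos[of 1] by simp
  have "m c \<le> C" if c: "c \<in> {0<..<1}" for c
  proof -
    have bound: "m c * (1 - real n * c ^ n / c) \<le> C" if n: "1 \<le> n" for n :: nat
    proof -
      \<comment> \<open>Subtracting the constant c^(n-1) makes the comparison m(c) (r^(n-1) -
        c^(n-1)) \<le> r^(n-1) m(r) hold on all of (0,1): for r < c the left side is nonpositive.
        The integral is 1/n - c^(n-1), and n c^(n-1) tends to 0.\<close>
      let ?f = "\<lambda>r. indicator {0<..<1} r * (ln r ^ 0 * r powr (real n - 1) * 1) - c powr (real n - 1) * indicator {0<..<1} r"
      have one: "Phi_nn (\<lambda>_. 1) (1 / 2) < \<infinity>" by (simp add: Phi_nn_one)
      have i1: "integrable lebesgue (\<lambda>r. indicator {0<..<1} r * (ln r ^ 0 * r powr (real n - 1) * 1))"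
        by (rule ln_moment_integrable[OF _ _ one]) (use n in auto)
      have i2: "integrable lebesgue (\<lambda>r. c powr (real n - 1) * indicator {0<..<1} (r :: real))"
        by (intro integrable_mult_right integrable_real_indicator) auto
      have "m c * (1 / real n - c powr (real n - 1)) = m c * (\<integral>r. ?f r \<partial>lebesgue)"
        using n ln_moment_one[of "real n"]
        by (subst Bochner_Integration.integral_diff[OF i1 i2]) (simp add: ln_moment_def)
      also have "\<dots> = (\<integral>r. m c * ?f r \<partial>lebesgue)" by simp
      also have "\<dots> \<le> ln_moment m 0 (real n)"
        unfolding ln_moment_def
      proof (rule integral_mono)
        show "integrable lebesgue (\<lambda>r. m c * ?f r)"
          by (intro integrable_mult_right Bochner_Integration.integrable_diff i1 i2)
        show "integrable lebesgue (\<lambda>r. indicator {0<..<1} r * (ln r ^ 0 * r powr (real n - 1) * m r))"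
          by (rule ln_moment_integrable[OF m m_nonneg Phi_nn_fin[of 0]]) (use n in auto)
        fix r
        show "m c * ?f r \<le> indicator {0<..<1} r * (ln r ^ 0 * r powr (real n - 1) * m r)"
        proof (cases "r \<in> {0<..<1}")
          case True
          have "m c * (r powr (real n - 1) - c powr (real n - 1)) \<le> r powr (real n - 1) * m r"
          proof (cases "c \<le> r")
            case t: True
            have "m c * (r powr (real n - 1) - c powr (real n - 1)) \<le> m c * r powr (real n - 1)"
              using c m_nonneg by (intro mult_left_mono) auto
            also have "\<dots> \<le> m r * r powr (real n - 1)"
              using mono_onD[OF m_mono c True t] by (intro mult_right_mono) auto
            finally show ?thesis by (simp add: mult.commute)
          next
            case False
            then have "r powr (real n - 1) \<le> c powr (real n - 1)" using True n by (intro powr_mono2) auto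
            then have "m c * (r powr (real n - 1) - c powr (real n - 1)) \<le> 0"
              using c m_nonneg by (intro mult_nonneg_nonpos) auto
            also have "0 \<le> r powr (real n - 1) * m r" using True m_nonneg by auto
            finally show ?thesis .
          qed
          then show ?thesis using True by simp
        qed simp
      qed
      finally have "real n * (m c * (1 / real n - c powr (real n - 1))) \<le> real n * ln_moment m 0 (real n)"
        by (rule mult_left_mono) simp
      also have "\<dots> \<le> psi_real (real n / \<alpha>)"
        unfolding psi_real_eq using \<alpha> b_nonneg by (simp add: algebra_simps)
      also have "\<dots> \<le> C" using n \<alpha> by (intro C[rule_format]) simp
      finally have "real n * (m c * (1 / real n - c powr (real n - 1))) \<le> C" .
      moreover have "c powr (real n - 1) = c ^ n / c" using c by (simp add: powr_diff powr_realpow)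
      ultimately show ?thesis using n by (simp add: algebra_simps)
    qed
    have "(\<lambda>n. real n * c ^ n) \<longlonglongrightarrow> 0" using c powser_times_n_limit_0[of c] by simp
    then have "(\<lambda>n. m c * (1 - real n * c ^ n / c)) \<longlonglongrightarrow> m c * (1 - 0 / c)"
      using c by (intro tendsto_intros) auto
    then show ?thesis using bound by (intro LIMSEQ_le_const2[of _ "m c" C]) auto
  qed
  then show ?thesis using C0 by blast
qed

text \<open>Boundedness of m makes the measure m(dr) finite on (0,1), by exhaustion with intervals
  (0,s n); its mass l is the jump rate. It is not 0, for then m would vanish and, the drift being
  absent, \<phi> would be zero. A monotone m is Borel on (0,1), so its cut-off is Borel on the
  line.\<close>

lemma bounded_perpetuity_exists:
  assumes bdd: "at_infty psi < \<infinity>"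
    and a: "0 < a" and fin: "Phi_nn m (- (\<alpha> * a)) < \<infinity>"
  obtains K where "perpetuity_law \<alpha> a (\<lambda>r. if r \<in> {0<..<1} then m r else 0) K"
proof -
  let ?m = "\<lambda>r. if r \<in> {0<..<1} then m r else 0"
  obtain \<mu> where sets: "sets \<mu> = sets borel"
    and em: "\<And>r. r \<in> {0<..<1} \<Longrightarrow> emeasure \<mu> {0<..<r} = ennreal (m r)"
    using rep unfolding rep_B_def by blast
  obtain C where C: "0 \<le> C" "\<forall>c\<in>{0<..<1}. m c \<le> C" using bounded_imp_weight_bounded[OF bdd] by blast
  define s where "s n = (1 :: real) - 1 / real (n + 2)" for n
  have s: "s n \<in> {0<..<1}" "s n \<le> s (Suc n)" for n
    by (auto simp: s_def field_simps)
  have "(\<lambda>n. (1 :: real) - 1 / real (n + 2)) \<longlonglongrightarrow> 1 - 0"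
    by (intro tendsto_intros LIMSEQ_ignore_initial_segment[of "\<lambda>n. 1 / real n"] lim_const_over_n)
  then have s_lim: "s \<longlonglongrightarrow> 1" by (simp add: s_def[abs_def])
  have U: "(\<Union>n. {0<..<s n}) = {0<..<1}"
  proof (intro equalityI subsetI)
    fix x :: real assume x: "x \<in> {0<..<1}"
    then obtain n where "x < s n" using order_tendstoD(1)[OF s_lim, of x] by (auto dest: eventually_happens)
    then show "x \<in> (\<Union>n. {0<..<s n})" using x by auto
  next
    fix x assume "x \<in> (\<Union>n. {0<..<s n})"
    then obtain n where "0 < x" "x < s n" by auto
    then show "x \<in> {0<..<1}" using s(1)[of n] by simp
  qed
  have "(\<lambda>n. emeasure \<mu> {0<..<s n}) \<longlonglongrightarrow> emeasure \<mu> (\<Union>n. {0<..<s n})"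
  proof (intro Lim_emeasure_incseq incseq_SucI subsetI)
    show "x \<in> {0<..<s (Suc n)}" if "x \<in> {0<..<s n}" for x n using that s(2)[of n] by auto
  qed (auto simp: sets)
  then have "emeasure \<mu> {0<..<1} \<le> ennreal C"
    unfolding U using em[OF s(1)] bspec[OF C(2) s(1)]
    by (intro LIMSEQ_le_const2) (auto intro!: ennreal_leI exI[of _ 0])
  then obtain l where l: "emeasure \<mu> {0<..<1} = ennreal l" "0 \<le> l"
    by (cases "emeasure \<mu> {0<..<1}") (auto simp: top_unique)
  have "l \<noteq> 0"
  proof
    assume "l = 0"
    have "m r = 0" if r: "r \<in> {0<..<1}" for r
    proof -
      have "emeasure \<mu> {0<..<r} \<le> emeasure \<mu> {0<..<1}" using r by (intro emeasure_mono) (auto simp: sets)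
      then show ?thesis using em[OF r] l \<open>l = 0\<close> bspec[OF m_nonneg r] by (auto simp: ennreal_eq_0_iff)
    qed
    then have "ln_moment m 0 0 = 0"
      using ln_moment_0_zero_iff[OF m m_nonneg Phi_nn_fin[of 0]] by simp
    then show False using coeff_pos[of 0] bounded_imp_no_drift[OF bdd] by simp
  qed
  with l have l_pos: "0 < l" by simp
  have m_borel: "?m \<in> borel_measurable borel"
  proof -
    have "(\<lambda>r. indicator {0<..<1} r *\<^sub>R m r) \<in> borel_measurable borel"
      using borel_measurable_mono_on_fnc[OF m_mono] by (subst (asm) borel_measurable_restrict_space_iff) auto
    moreover have "(\<lambda>r. indicator {0<..<1} r *\<^sub>R m r) = ?m" by auto
    ultimately show ?thesis by (simp only:)
  qed
  obtain K where K: "prob_space K" "sets K = sets borel" "AE y in K. 0 < y"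
    and law: "\<And>h. h \<in> borel_measurable borel \<Longrightarrow>
       (\<integral>\<^sup>+y. h y \<partial>K) =
       (\<integral>\<^sup>+y. \<integral>\<^sup>+r. ennreal y * (ennreal (?m r) * (ennreal (\<alpha> * r powr (\<alpha> - 1)) * h (y * r powr \<alpha>)))
          * indicator {0<..<1} r \<partial>lborel \<partial>K)"
    by (rule bounded_levy_perpetuity_exists[OF \<alpha> l_pos sets _ l(1), of ?m]) (use em in auto)
  have fin': "(\<integral>\<^sup>+r. ennreal (\<alpha> * ?m r * r powr (- (\<alpha> * a) - 1)) * indicator {0<..<1} r \<partial>lborel) < \<infinity>"
  proof -
    have "(\<integral>\<^sup>+r. ennreal (\<alpha> * ?m r * r powr (- (\<alpha> * a) - 1)) * indicator {0<..<1} r \<partial>lborel)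
      = (\<integral>\<^sup>+r. ennreal (\<alpha> * ?m r * r powr (- (\<alpha> * a) - 1)) * indicator {0<..<1} r \<partial>lebesgue)"
      using m_borel by (intro nn_integral_completion[symmetric])
    also have "\<dots> = (\<integral>\<^sup>+r. ennreal \<alpha> * (ennreal (indicator {0<..<1} r * (r powr (- (\<alpha> * a) - 1) * m r))) \<partial>lebesgue)"
      using \<alpha> m_nonneg by (intro nn_integral_cong) (auto simp: indicator_def ennreal_mult[symmetric] mult_ac)
    also have "\<dots> = ennreal \<alpha> * (\<integral>\<^sup>+r. ennreal (indicator {0<..<1} r * (r powr (- (\<alpha> * a) - 1) * m r)) \<partial>lebesgue)"
      using measurable_compose[OF borel_measurable_integrable[OF Phi_nn_integrable[OF m m_nonneg fin]] measurable_ennreal]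
      by (rule nn_integral_cmult)
    also have "(\<integral>\<^sup>+r. ennreal (indicator {0<..<1} r * (r powr (- (\<alpha> * a) - 1) * m r)) \<partial>lebesgue) = Phi_nn m (- (\<alpha> * a))"
      unfolding Phi_nn_def by (intro nn_integral_cong) (auto simp: indicator_def)
    finally show ?thesis using fin by (simp add: ennreal_mult_less_top)
  qed
  have "perpetuity_law \<alpha> a ?m K"
  proof (rule perpetuity_law.intro)
    show "0 \<le> ?m r" for r using m_nonneg by auto
    show "prob_space K" "sets K = sets borel" "AE y in K. 0 < y" by (fact K)+
  qed (fact \<alpha> a m_borel fin' | rule law, assumption)+
  then show ?thesis by (rule that)
qed

text \<open>G and L are E [I^(-1) e^(-x I)] and E [e^(-x I)]; of the perpetuity only these
  properties are needed further on. The last two identify both branches of \<open>E_fun\<close> with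
  G / \<open>slope\<close>, so no seam is left where the series stops.\<close>

lemma bounded_representation:
  assumes bdd: "at_infty psi < \<infinity>"
    and gam: "bernstein_gamma psi (abscissa (\<lambda>u. Phi_ext b m (\<alpha> * u))) W"
    and a: "0 < a" "ereal a < \<bar>abscissa (\<lambda>u. Phi_ext b m (\<alpha> * u))\<bar>"
  obtains G L :: "real \<Rightarrow> real" where
    "\<forall>x>0. (G has_real_derivative - L x) (at x)"
    "\<forall>x\<ge>0. integrable lebesgue (\<lambda>r. indicator {0<..<1} r * (\<alpha> * m r / r * L (x * r powr \<alpha>)))"
    "\<forall>x\<ge>0. (\<integral>r. indicator {0<..<1} r * (\<alpha> * m r / r * L (x * r powr \<alpha>)) \<partial>lebesgue) = G x"
    "\<forall>x>0. E_mellin_barnes psi W a (- of_real x) = of_real (G x / slope)"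
    "\<forall>x\<ge>0. \<forall>N\<ge>1. x < psi_real (real N) \<longrightarrow> E_real (- x) = G x / slope"
proof -
  let ?A = "abscissa (\<lambda>u. Phi_ext b m (\<alpha> * u))"
  let ?m = "\<lambda>r. if r \<in> {0<..<1} then m r else 0"
  have b0: "b = 0" by (rule bounded_imp_no_drift[OF bdd])
  \<comment> \<open>An abscissa is never positive, so the bound on \<open>a\<close> in terms of its
    absolute value says that the vertical line at -a lies in the half plane of analyticity.\<close>
  have Aa: "?A < ereal (- a)"
    using a abscissa_le_0[of "\<lambda>u. Phi_ext b m (\<alpha> * u)"]
    by (cases "abscissa (\<lambda>u. Phi_ext b m (\<alpha> * u))") auto
  have ab: "abscissa (Phi_ext b m) < ereal (- (\<alpha> * a))" using abscissa_scale_less[OF \<alpha> Aa] by simp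
  have fin: "Phi_nn m (- (\<alpha> * a)) < \<infinity>" by (rule Phi_nn_finite[OF m_int m_nonneg ab])
  obtain K where "perpetuity_law \<alpha> a ?m K" using bounded_perpetuity_exists[OF bdd a(1) fin] .
  then interpret P: perpetuity_law \<alpha> a ?m K .
  have weight_eq: "P.weight z = of_real \<alpha> * (LINT r:{0<..<1}|lebesgue. complex_of_real r powr (of_real \<alpha> * z - 1) * of_real (m r))" for z
  proof -
    have "P.weight z = (\<integral>r. indicator {0<..<1} r *\<^sub>R (of_real (\<alpha> * ?m r) * complex_of_real r powr (of_real \<alpha> * z - 1)) \<partial>lebesgue)"
      unfolding P.weight_def using P.m_meas by (intro integral_completion[symmetric]) simp
    also have "\<dots> = (\<integral>r. of_real \<alpha> * (indicator {0<..<1} r *\<^sub>R (complex_of_real r powr (of_real \<alpha> * z - 1) * of_real (m r))) \<partial>lebesgue)"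
      by (intro Bochner_Integration.integral_cong) (auto simp: indicator_def)
    finally show ?thesis by (simp only: set_lebesgue_integral_def integral_mult_right_zero)
  qed
  have weight_nat: "P.weight (of_nat n) = of_real (\<alpha> * (b + ln_moment m 0 (\<alpha> * real n)))" for n
    unfolding weight_eq using Phi_integral_of_real[of "\<alpha> * real n" m] by (simp add: b0)
  have psi_eq: "psi z = z * P.weight z" if z: "- a \<le> Re z" for z
  proof -
    have "\<alpha> * - a \<le> \<alpha> * Re z" using z \<alpha> by (intro mult_left_mono) auto
    then have "abscissa (Phi_ext b m) < ereal (Re (of_real \<alpha> * z))"
      using ab by (elim order.strict_trans2) simp
    then have "psi z = Phi b m (of_real \<alpha> * z)" unfolding psi_def by (rule phi_ext)
    then show ?thesis unfolding Phi_def weight_eq by (simp add: b0)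
  qed
  obtain \<nu> where \<nu>: "sets \<nu> = sets borel" "emeasure \<nu> {..0} = 0"
    "\<And>z. 0 < Re z \<Longrightarrow> integrable \<nu> (\<lambda>x. complex_of_real x powr (z - 1))"
    "\<And>z. 0 < Re z \<Longrightarrow> W z = (\<integral>x. complex_of_real x powr (z - 1) \<partial>\<nu>)"
    and W1: "W 1 = 1" and Wrec': "\<And>z. ?A < ereal (Re z) \<Longrightarrow> W z = W (z + 1) / psi z"
    using gam unfolding bernstein_gamma_def by blast
  have Wrec: "W z = W (z + 1) / psi z" if "- a \<le> Re z" for z
    by (rule Wrec', rule order.strict_trans2[OF Aa]) (use that in simp)
  have weight_nz: "P.weight (of_nat n) \<noteq> 0" for n
    unfolding weight_nat of_real_eq_0_iff using coeff_pos[of "\<alpha> * real n"] \<alpha> by simp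
  have Wnat: "W (of_nat n + 1) = of_nat n * P.weight (of_nat n) * W (of_nat n)" if n: "0 < n" for n
    using Wrec[of "of_nat n"] psi_eq[of "of_nat n"] weight_nz[of n] n a by (simp add: field_simps)
  have pair: "W z * P.mellin z = Gamma z" if "0 < Re z" "Re z < 2" for z
    by (rule P.mellin_pair[OF \<nu> W1 Wnat that])
  have MB: "E_mellin_barnes psi W a (- of_real x) = of_real (P.recip_laplace x / slope)" if x: "0 < x" for x
    using P.E_mellin_barnes_eq[OF psi_eq pair Wrec x] by (simp add: deriv_0plus_psi)
  \<comment> \<open>\<open>E_coeff_rec\<close> is the Mellin recursion at integers up to the
    factorial; the starting value is M(0) = weight(0) = \<open>slope\<close>.\<close>
  have moment: "P.mellin (of_nat n) = of_real (fact n * slope * E_coeff n)" for n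
  proof (induction n)
    case 0
    have "P.mellin 0 = P.weight (of_nat 0) * P.mellin 1" using P.mellin_rec[of 0] a by simp
    then show ?case unfolding weight_nat by (simp add: P.mellin_1 slope_def E_coeff_def)
  next
    case (Suc n)
    have "P.mellin (of_nat n) = P.weight (of_nat n) * P.mellin (of_nat n + 1)"
      using a by (intro P.mellin_rec) simp
    moreover have "of_real (fact n * slope * E_coeff n) = P.weight (of_nat n) * complex_of_real (fact (Suc n) * slope * E_coeff (Suc n))"
      unfolding weight_nat E_coeff_rec[of n, symmetric] diffs_def of_real_mult[symmetric] of_real_eq_iff by simp
    ultimately have "P.weight (of_nat n) * P.mellin (of_nat n + 1) = P.weight (of_nat n) * complex_of_real (fact (Suc n) * slope * E_coeff (Suc n))"
      using Suc by (simp only:)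
    then have "P.mellin (of_nat n + 1) = complex_of_real (fact (Suc n) * slope * E_coeff (Suc n))"
      using weight_nz[of n] by (simp only: mult_left_cancel not_False_eq_True)
    then show ?case by (simp only: of_nat_Suc add.commute)
  qed
  have series: "E_real (- x) = P.recip_laplace x / slope"
    if x: "0 \<le> x" and N: "1 \<le> N" and lt: "x < psi_real (real N)" for x N
  proof -
    have sum: "summable (\<lambda>n. E_coeff n * x ^ n)" "summable (\<lambda>n. E_coeff n * (- x) ^ n)"
      using x lt by (auto intro!: E_coeff_summable[OF N])
    have "of_real (P.recip_laplace x) = (\<Sum>n. (- complex_of_real x) ^ n / fact n * P.mellin (of_nat n))"
    proof (rule P.recip_laplace_series[OF x])
      have "summable (\<lambda>n. slope * (E_coeff n * x ^ n))" using sum(1) by (rule summable_mult)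
      moreover have "x ^ n / fact n * norm (P.mellin (of_nat n)) = slope * (E_coeff n * x ^ n)" for n
        unfolding moment using slope_pos E_coeff_pos[of n] by (simp add: abs_mult less_imp_le norm_mult)
      ultimately show "summable (\<lambda>n. x ^ n / fact n * norm (P.mellin (of_nat n)))" by simp
    qed
    also have "(\<lambda>n. (- complex_of_real x) ^ n / fact n * P.mellin (of_nat n)) = (\<lambda>n. of_real (slope * (E_coeff n * (- x) ^ n)))"
      unfolding moment by (auto simp: fun_eq_iff)
    also have "(\<Sum>n. complex_of_real (slope * (E_coeff n * (- x) ^ n))) = of_real (slope * E_real (- x))"
      unfolding E_real_def suminf_mult[OF sum(2), symmetric]
      by (rule suminf_of_real[symmetric]) (rule summable_mult[OF sum(2)])
    finally have "P.recip_laplace x = slope * E_real (- x)" by (simp only: of_real_eq_iff)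
    then show ?thesis using slope_pos by simp
  qed
  have conv: "indicator {0<..<1} r * (\<alpha> * ?m r / r * y) = indicator {0<..<1} r * (\<alpha> * m r / r * y)" for r y :: real
    by (auto simp: indicator_def)
  note RL = P.recip_laplace_eq_laplace_integral[unfolded conv]
  show ?thesis
  proof (rule that[of P.recip_laplace P.laplace])
    show "\<forall>x\<ge>0. integrable lebesgue (\<lambda>r. indicator {0<..<1} r * (\<alpha> * m r / r * P.laplace (x * r powr \<alpha>)))"
    proof (intro allI impI)
      fix x :: real assume x: "0 \<le> x"
      show "integrable lebesgue (\<lambda>r. indicator {0<..<1} r * (\<alpha> * m r / r * P.laplace (x * r powr \<alpha>)))"
        using RL(2)[OF x] borel_measurable_integrable[OF RL(2)[OF x]] by (subst integrable_completion)
    qed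
    show "\<forall>x\<ge>0. (\<integral>r. indicator {0<..<1} r * (\<alpha> * m r / r * P.laplace (x * r powr \<alpha>)) \<partial>lebesgue) = P.recip_laplace x"
    proof (intro allI impI)
      fix x :: real assume x: "0 \<le> x"
      show "(\<integral>r. indicator {0<..<1} r * (\<alpha> * m r / r * P.laplace (x * r powr \<alpha>)) \<partial>lebesgue) = P.recip_laplace x"
        unfolding RL(1)[OF x] by (rule integral_completion[OF borel_measurable_integrable[OF RL(2)[OF x]]])
    qed
    show "\<forall>x>0. (P.recip_laplace has_real_derivative - P.laplace x) (at x)"
      using P.recip_laplace_has_derivative by blast
    show "\<forall>x>0. E_mellin_barnes psi W a (- of_real x) = of_real (P.recip_laplace x / slope)"
      using MB by blast
    show "\<forall>x\<ge>0. \<forall>N\<ge>1. x < psi_real (real N) \<longrightarrow> E_real (- x) = P.recip_laplace x / slope"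
      using series by blast
  qed
qed

text \<open>By the chain rule with x = -q s^\<alpha>, the powers of r in F'(t r) and in the tilted
  weight combine to 1/r, which reproduces the integral in the equation for G; the powers of t
  cancel.\<close>

lemma dstar_bounded:
  assumes t: "0 < t" and q: "q < 0" and b0: "b = 0"
    and der': "\<forall>x>0. (G has_real_derivative - L x) (at x)"
    and int': "\<forall>x\<ge>0. integrable lebesgue (\<lambda>r. indicator {0<..<1} r * (\<alpha> * m r / r * L (x * r powr \<alpha>)))"
    and val': "\<forall>x\<ge>0. (\<integral>r. indicator {0<..<1} r * (\<alpha> * m r / r * L (x * r powr \<alpha>)) \<partial>lebesgue) = G x"
    and F': "\<forall>s>0. F s = of_real (G (- q * s powr \<alpha>) / slope)"
  shows "dstar_defined (m_tilt \<alpha> m) F t"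
    and "dstar \<alpha> b (m_tilt \<alpha> m) F t = of_real q * F t"
proof -
  let ?x = "- q * t powr \<alpha>"
  note der = der'[rule_format] and int = int'[rule_format] and val = val'[rule_format] and F = F'[rule_format]
  define F' where "F' s = complex_of_real (- L (- q * s powr \<alpha>) * (- q * (\<alpha> * s powr (\<alpha> - 1))) / slope)" for s
  have derF: "\<forall>s\<in>{0<..t}. (F has_vector_derivative F' s) (at s)"
  proof
    fix s assume "s \<in> {0<..t}"
    then have s: "0 < s" by simp
    have D: "((\<lambda>s. - q * s powr \<alpha>) has_real_derivative - q * (\<alpha> * s powr (\<alpha> - 1))) (at s)"
      using s by (auto intro!: derivative_eq_intros)
    have "((\<lambda>s. G (- q * s powr \<alpha>) / slope) has_real_derivative - L (- q * s powr \<alpha>) * (- q * (\<alpha> * s powr (\<alpha> - 1))) / slope) (at s)"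
      by (intro DERIV_cdivide DERIV_chain2[OF der D]) (use q s in \<open>simp add: mult_neg_pos\<close>)
    then have "((\<lambda>s. complex_of_real (G (- q * s powr \<alpha>) / slope)) has_vector_derivative F' s) (at s)"
      unfolding F'_def by (rule has_vector_derivative_of_real)
    then show "(F has_vector_derivative F' s) (at s)"
      by (rule has_vector_derivative_transform_within_open[of _ _ _ "{0<..}"]) (use s F in auto)
  qed
  let ?g = "\<lambda>r. indicator {0<..<1} r * (\<alpha> * m r / r * L (?x * r powr \<alpha>))"
  have ind: "indicator {0<..<1} r *\<^sub>R (F' (t * r) * of_real (m_tilt \<alpha> m r)) = of_real (q * t powr (\<alpha> - 1) / slope * ?g r)" for r
  proof (cases "r \<in> {0<..<1}")
    case True
    have 1: "- q * (t * r) powr \<alpha> = ?x * r powr \<alpha>" using True t by (simp add: powr_mult)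
    have "r powr (\<alpha> - 1) * r powr (- \<alpha>) = r powr (- 1)"
      unfolding powr_add[symmetric] by simp
    also have "\<dots> = 1 / r" using True powr_minus_divide[of r 1] by simp
    finally have "r powr (\<alpha> - 1) * r powr (- \<alpha>) = 1 / r" .
    then have 2: "(t * r) powr (\<alpha> - 1) * r powr (- \<alpha>) = t powr (\<alpha> - 1) * (1 / r)"
      using True t by (simp add: powr_mult mult.assoc)
    have "- L (?x * r powr \<alpha>) * (- q * (\<alpha> * (t * r) powr (\<alpha> - 1))) / slope * (r powr (- \<alpha>) * m r)
      = q / slope * ((t * r) powr (\<alpha> - 1) * r powr (- \<alpha>)) * (\<alpha> * m r * L (?x * r powr \<alpha>))" by simp
    also have "\<dots> = q * t powr (\<alpha> - 1) / slope * (\<alpha> * m r / r * L (?x * r powr \<alpha>))"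
      unfolding 2 by simp
    finally show ?thesis using True by (simp only: F'_def m_tilt_def 1 of_real_mult[symmetric] indicator_simps scaleR_one mult_1)
  qed simp
  have x: "0 \<le> ?x" using q by (simp add: mult_nonpos_nonneg)
  have I: "integrable lebesgue (\<lambda>r. indicator {0<..<1} r *\<^sub>R (F' (t * r) * of_real (m_tilt \<alpha> m r)))"
    unfolding ind by (intro integrable_of_real integrable_mult_right int[OF x])
  have V: "(\<integral>r. indicator {0<..<1} r *\<^sub>R (F' (t * r) * of_real (m_tilt \<alpha> m r)) \<partial>lebesgue)
    = of_real (q * t powr (\<alpha> - 1) / slope * G ?x)"
    unfolding ind integral_complex_of_real integral_mult_right_zero val[OF x] ..
  show "dstar_defined (m_tilt \<alpha> m) F t" by (rule dstar_of_derivative(1)[OF t derF I V])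
  have "t powr (1 - \<alpha>) * t powr (\<alpha> - 1) = 1" using t by (simp add: powr_add[symmetric])
  then have "t powr (1 - \<alpha>) * (q * t powr (\<alpha> - 1) / slope * G ?x) = q * (G ?x / slope)"
    by (simp add: field_simps)
  moreover have "dstar \<alpha> b (m_tilt \<alpha> m) F t = of_real (t powr (1 - \<alpha>) * (q * t powr (\<alpha> - 1) / slope * G ?x))"
    unfolding dstar_of_derivative(2)[OF t derF I V] by (simp add: b0)
  ultimately show "dstar \<alpha> b (m_tilt \<alpha> m) F t = of_real q * F t"
    unfolding F[OF t] by (simp only: of_real_mult)
qed

lemma dstar_E_fun:
  fixes q t :: real
  assumes gam: "bernstein_gamma psi (abscissa (\<lambda>u. Phi_ext b m (\<alpha> * u))) W"
    and a: "0 < a" "ereal a < \<bar>abscissa (\<lambda>u. Phi_ext b m (\<alpha> * u))\<bar>"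
    and t: "0 < t" and dom: "of_real (q * t powr \<alpha>) \<in> E_dom psi"
  defines "F \<equiv> \<lambda>t. E_fun psi W a (of_real (q * t powr \<alpha>))"
  shows "dstar_defined (m_tilt \<alpha> m) F t \<and> dstar \<alpha> b (m_tilt \<alpha> m) F t = of_real q * F t"
proof -
  have A0: "abscissa (\<lambda>u. Phi_ext b m (\<alpha> * u)) < ereal (real n)" if "0 < n" for n
    using abscissa_le_0[of "\<lambda>u. Phi_ext b m (\<alpha> * u)"] that by (elim order.strict_trans1) simp
  have W1: "W 1 = 1" and Wrec: "\<And>n. 0 < n \<Longrightarrow> W (of_nat n) = W (of_nat n + 1) / psi (of_nat n)"
    using gam A0 unfolding bernstein_gamma_def by auto
  have F_series: "F s = of_real (E_real (q * s powr \<alpha>))"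
    if N: "1 \<le> N" and s: "\<bar>q * s powr \<alpha>\<bar> < psi_real (real N)" for s N
  proof -
    have "ereal \<bar>q * s powr \<alpha>\<bar> < ereal (psi_real (real N))" using s by simp
    also have "\<dots> \<le> at_infty psi" using N by (intro psi_real_le_at_infty) simp
    finally have "ereal (norm (complex_of_real (q * s powr \<alpha>))) < at_infty psi" by (simp only: norm_of_real)
    then show ?thesis using E_series_eq[OF W1 Wrec N s] by (simp add: F_def E_fun_def)
  qed
  show ?thesis
  proof (cases "ereal \<bar>q * t powr \<alpha>\<bar> < at_infty psi")
    case True
    obtain N :: nat where N: "1 \<le> N" "\<bar>q * t powr \<alpha>\<bar> < psi_real (real N)" using less_at_infty_psi[OF True] .
    show ?thesis using dstar_E_real[OF t N] F_series[OF N(1)] by blast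
  next
    case False
    \<comment> \<open>A finite point outside the disc exists only if the radius is finite, i.e. if
      \<phi> is bounded.\<close>
    then have bdd: "at_infty psi < \<infinity>" by (cases "at_infty psi") auto
    have "\<not> ereal (norm (complex_of_real (q * t powr \<alpha>))) < at_infty psi" unfolding norm_of_real by (rule False)
    then have arg: "q * t powr \<alpha> \<noteq> 0" "\<bar>Arg (- complex_of_real (q * t powr \<alpha>))\<bar> < pi / 2"
      using dom by (auto simp: E_dom_def)
    \<comment> \<open>For a positive real argument the negative has argument pi, outside the
      sector.\<close>
    have q: "q < 0"
    proof (rule ccontr)
      assume "\<not> q < 0"
      then have "0 < q * t powr \<alpha>" using arg(1) t by (simp add: zero_less_mult_iff)
      then have "Arg (- complex_of_real (q * t powr \<alpha>)) = pi"
        using Arg_of_real[of "- (q * t powr \<alpha>)"] by (simp only: of_real_minus) simp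
      then show False using arg(2) pi_gt_zero by simp
    qed
    obtain G L where GL:
      "\<forall>x>0. (G has_real_derivative - L x) (at x)"
      "\<forall>x\<ge>0. integrable lebesgue (\<lambda>r. indicator {0<..<1} r * (\<alpha> * m r / r * L (x * r powr \<alpha>)))"
      "\<forall>x\<ge>0. (\<integral>r. indicator {0<..<1} r * (\<alpha> * m r / r * L (x * r powr \<alpha>)) \<partial>lebesgue) = G x"
      and MB: "\<forall>x>0. E_mellin_barnes psi W a (- of_real x) = of_real (G x / slope)"
      and ser: "\<forall>x\<ge>0. \<forall>N\<ge>1. x < psi_real (real N) \<longrightarrow> E_real (- x) = G x / slope"
      by (rule bounded_representation[OF bdd gam a])
    \<comment> \<open>Needed at every s > 0: for small s the definition uses the series, beyond the
      disc the contour integral, and both are G.\<close>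
    have F: "\<forall>s>0. F s = of_real (G (- q * s powr \<alpha>) / slope)"
    proof (intro allI impI)
      fix s :: real assume s: "0 < s"
      have x: "0 < - q * s powr \<alpha>" using q s by (simp add: mult_neg_pos)
      show "F s = of_real (G (- q * s powr \<alpha>) / slope)"
      proof (cases "ereal \<bar>q * s powr \<alpha>\<bar> < at_infty psi")
        case True
        obtain N :: nat where N: "1 \<le> N" "\<bar>q * s powr \<alpha>\<bar> < psi_real (real N)" using less_at_infty_psi[OF True] .
        have "F s = of_real (E_real (- (- q * s powr \<alpha>)))" using F_series[OF N] by simp
        also have "E_real (- (- q * s powr \<alpha>)) = G (- q * s powr \<alpha>) / slope"
          by (rule ser[rule_format, OF less_imp_le[OF x] N(1)]) (use N(2) x in linarith)
        finally show ?thesis .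
      next
        case False
        then have "\<not> ereal (norm (complex_of_real (q * s powr \<alpha>))) < at_infty psi" unfolding norm_of_real .
        then have "F s = E_mellin_barnes psi W a (of_real (q * s powr \<alpha>))" by (simp only: F_def E_fun_def if_False)
        also have "complex_of_real (q * s powr \<alpha>) = - of_real (- q * s powr \<alpha>)" by simp
        finally show ?thesis using MB[rule_format, OF x] by (simp only:)
      qed
    qed
    show ?thesis
      by (intro conjI dstar_bounded[OF t q bounded_imp_no_drift[OF bdd] GL F])
  qed
qed

end

theorem proposition3p1:
  fixes \<alpha> b :: real and m :: "real \<Rightarrow> real"
  assumes alpha: "0 < \<alpha>" "\<alpha> < 1"
    and m_meas: "m \<in> borel_measurable (lebesgue_on {0<..<1})"
    and m_nonneg: "\<forall>r\<in>{0<..<1}. 0 \<le> m r"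
  shows
    \<comment> \<open>(i)\<close>
    "((\<lambda>_. 0) \<in> dstar_domain m \<and>
      (\<forall>f\<in>dstar_domain m. \<forall>g\<in>dstar_domain m. \<forall>c d :: complex.
         (\<lambda>t. c * f t + d * g t) \<in> dstar_domain m \<and>
         (\<forall>t>0. dstar \<alpha> b m (\<lambda>t. c * f t + d * g t) t
                = c * dstar \<alpha> b m f t + d * dstar \<alpha> b m g t)) \<and>
      (\<forall>f\<in>dstar_domain m. \<forall>c>0.
         dil c f \<in> dstar_domain m \<and>
         (\<forall>t>0. dstar \<alpha> b m (dil c f) t = of_real (c powr \<alpha>) * dstar \<alpha> b m f (c * t)))) \<and>
    \<comment> \<open>(ii)\<close>
     ((\<forall>z\<in>Phi_dom m. \<forall>t>0.
         dstar_defined m (pow_fun z) t \<and>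
         dstar \<alpha> b m (pow_fun z) t = Phi b m z * pow_fun (z - of_real \<alpha>) t) \<and>
      (\<forall>\<phi>. rep_B \<phi> b m \<longrightarrow>
         (\<forall>z t. ereal (Re z) > abscissa (Phi_ext b m) \<longrightarrow> t > 0 \<longrightarrow>
            dstar_defined m (pow_fun z) t \<and>
            dstar \<alpha> b m (pow_fun z) t = \<phi> z * pow_fun (z - of_real \<alpha>) t)) \<and>
      (\<forall>z\<in>Phi_dom (m_tilt \<alpha> m). \<forall>t>0.
         dstar_defined (m_tilt \<alpha> m) (pow_fun z) t \<and>
         dstar \<alpha> b (m_tilt \<alpha> m) (pow_fun z) t
           = bold \<alpha> m (Phi b m) z * pow_fun (z - of_real \<alpha>) t) \<and>
      (\<forall>t>0. dstar_defined (m_tilt \<alpha> m) (pow_fun 0) t \<and>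
             dstar \<alpha> b (m_tilt \<alpha> m) (pow_fun 0) t = 0)) \<and>
    \<comment> \<open>(iii)\<close>
     (\<forall>\<phi>. (rep_B \<phi> b m \<and> abscissa (Phi_ext b m) < 0 \<and> at_infty \<phi> = \<infinity>) \<or>
           (rep_B_star \<alpha> \<phi> b m \<and> abscissa (Phi_ext b m) < ereal (- \<alpha>)) \<longrightarrow>
        (let \<phi>\<^sub>\<alpha> = (\<lambda>z. \<phi> (of_real \<alpha> * z));
             A\<^sub>\<alpha> = abscissa (\<lambda>u. Phi_ext b m (\<alpha> * u)) in
         \<forall>W a. bernstein_gamma \<phi>\<^sub>\<alpha> A\<^sub>\<alpha> W \<longrightarrow> 0 < a \<longrightarrow> ereal a < \<bar>A\<^sub>\<alpha>\<bar> \<longrightarrow>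
           (\<forall>q t :: real. t > 0 \<longrightarrow> of_real (q * t powr \<alpha>) \<in> E_dom \<phi>\<^sub>\<alpha> \<longrightarrow>
              (let F = (\<lambda>t. E_fun \<phi>\<^sub>\<alpha> W a (of_real (q * t powr \<alpha>))) in
               dstar_defined (m_tilt \<alpha> m) F t \<and>
               dstar \<alpha> b (m_tilt \<alpha> m) F t = of_real q * F t))) \<and>
        (rep_B_star \<alpha> \<phi> b m \<and> mono_on {0<..<1} (m_tilt \<alpha> m) \<longrightarrow>
           (\<exists>g. bernstein_function g \<and> (\<forall>u>0. bold \<alpha> m \<phi> (of_real u) = of_real (g u))) \<and>
           (abscissa (Phi_ext b m) < ereal (- \<alpha>) \<longrightarrow> bold \<alpha> m \<phi> \<in> class_B))) \<and>
    \<comment> \<open>(iv)\<close>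
     ((\<forall>f. Lam (Lam f) = f) \<and>
      (\<forall>\<phi> Lev f. rep_B \<phi> b m \<longrightarrow> levy_measure m Lev \<longrightarrow>
         f \<in> C_b \<longrightarrow> (\<forall>t>0. f differentiable (at t)) \<longrightarrow>
         (\<lambda>t. of_real t * vector_derivative f (at t)) \<in> C_b \<longrightarrow>
         (\<forall>t>0. dstar_defined m (Lam f) t \<and>
                set_integrable Lev {0<..} (\<lambda>y. f (1 / t * exp y) - f (1 / t)) \<and>
                dstar \<alpha> b m (Lam f) t
                  = - of_real (t powr (- (2 * \<alpha>))) * Lam (A_op \<alpha> b Lev f) t)))"
proof (intro conjI allI ballI impI)
  fix c :: real and f assume "f \<in> dstar_domain m" "0 < c"
  then show "dil c f \<in> dstar_domain m"
    and "0 < t \<Longrightarrow> dstar \<alpha> b m (dil c f) t = of_real (c powr \<alpha>) * dstar \<alpha> b m f (c * t)" for t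
    by (rule dstar_dil)+
next
  fix \<phi> z t assume rep: "rep_B \<phi> b m" and z: "abscissa (Phi_ext b m) < ereal (Re z)" and t: "0 < (t::real)"
  have "z \<in> Phi_dom m"
    unfolding Phi_dom_iff[OF m_meas m_nonneg]
    using rep z by (intro Phi_nn_finite[of m b]) (auto simp: rep_B_def)
  moreover have "\<phi> z = Phi b m z" using rep z by (simp add: rep_B_def)
  ultimately show "dstar_defined m (pow_fun z) t"
    and "dstar \<alpha> b m (pow_fun z) t = \<phi> z * pow_fun (z - of_real \<alpha>) t"
    using t by (simp_all add: dstar_pow_fun)
next
  fix z t assume z: "z \<in> Phi_dom (m_tilt \<alpha> m)" and t: "0 < (t::real)"
  show "dstar \<alpha> b (m_tilt \<alpha> m) (pow_fun z) t = bold \<alpha> m (Phi b m) z * pow_fun (z - of_real \<alpha>) t"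
    unfolding dstar_pow_fun(2)[OF z t] using bold_eq_Phi[OF m_meas m_nonneg z, of "Phi b m" b] by simp
next
  fix \<phi>
  assume *: "(rep_B \<phi> b m \<and> abscissa (Phi_ext b m) < 0 \<and> at_infty \<phi> = \<infinity>) \<or>
    (rep_B_star \<alpha> \<phi> b m \<and> abscissa (Phi_ext b m) < ereal (- \<alpha>))"
  then have rep: "rep_B \<phi> b m" by (auto simp: rep_B_star_def)
  interpret bernstein_rep \<alpha> b m \<phi> by (rule bernstein_rep.intro[OF alpha(1) m_meas rep])
  have psi: "(\<lambda>z. \<phi> (of_real \<alpha> * z)) = psi" by (simp add: psi_def[abs_def])
  show "let \<phi>\<^sub>\<alpha> = (\<lambda>z. \<phi> (of_real \<alpha> * z));
             A\<^sub>\<alpha> = abscissa (\<lambda>u. Phi_ext b m (\<alpha> * u)) in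
         \<forall>W a. bernstein_gamma \<phi>\<^sub>\<alpha> A\<^sub>\<alpha> W \<longrightarrow> 0 < a \<longrightarrow> ereal a < \<bar>A\<^sub>\<alpha>\<bar> \<longrightarrow>
           (\<forall>q t :: real. t > 0 \<longrightarrow> of_real (q * t powr \<alpha>) \<in> E_dom \<phi>\<^sub>\<alpha> \<longrightarrow>
              (let F = (\<lambda>t. E_fun \<phi>\<^sub>\<alpha> W a (of_real (q * t powr \<alpha>))) in
               dstar_defined (m_tilt \<alpha> m) F t \<and>
               dstar \<alpha> b (m_tilt \<alpha> m) F t = of_real q * F t))"
    unfolding Let_def psi by (intro allI impI dstar_E_fun)
next
  fix \<phi> Lev f t
  assume "rep_B \<phi> b m" "levy_measure m Lev" "\<forall>t>0. f differentiable (at t)"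
    "(\<lambda>t. of_real t * vector_derivative f (at t)) \<in> C_b" "0 < (t::real)"
  note dstar_Lam = dstar_Lam[OF m_meas this(1,2) this(3)[rule_format] this(4,5)]
  show "dstar_defined m (Lam f) t"
    and "set_integrable Lev {0<..} (\<lambda>y. f (1 / t * exp y) - f (1 / t))"
    and "dstar \<alpha> b m (Lam f) t = - of_real (t powr (- (2 * \<alpha>))) * Lam (A_op \<alpha> b Lev f) t"
    by (rule dstar_Lam; assumption)+
qed (auto simp: Lam_Lam intro: zero_in_dstar_domain dstar_linear dstar_pow_fun dstar_pow_fun_0
    bold_bernstein[OF alpha(1) m_meas] bold_in_class_B[OF alpha(1) m_meas])

end
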